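(* There is an algorithm in the hash-ordered neighbor access model that, given $p\in[0,1]$, a positive integer $t$ and $\delta\in(0,1)$, on an $n$-vertex graph with $m$ edges does the following: with probability at least $1-\delta$, it returns $t$ samples $T_1,\dots,T_t\subseteq \vec E$ such that each oriented edge is included in $T_i$ with probability $p$, and the events $\{e\in T_i\}_{e\in\vec E,\,i\in[t]}$ are jointly independent. Its expected time complexity is $O\big(\sqrt{tp}\,n\sqrt{\log(n)\log(n/\delta)}+t\,(1+p\,m\log^2 n\log(n/\delta))\big)$.
   Context: $G=(V,E)$ is an undirected graph with $n$ vertices and $m$ edges; $\vec E$ denotes the set of oriented edges obtained by replacing each undirected edge $\{u,v\}$ by the two oriented edges $(u,v),(v,u)$. Hash-ordered neighbor access model: the algorithm knows $n$ and may query (i) the $i$-th vertex, $i\in[n]$, (ii) the degree $d(v)$, (iii) the $i$-th neighbor of $v$ for $i\in[d(v)]$, (iv) $id(v)$, and (v) a hash value $h(v)$, where the values $h(v)$ are independent and uniform on $[0,1]$; moreover the neighbor list of each vertex is ordered by increasing hash value. Each query has unit cost. *)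

theory Defs
  imports "HOL-Probability.Probability"
begin

text \<open>
  The input: a finite simple undirected graph, together with the order in which the vertices are
  enumerated and the identifiers of the vertices. The algorithm sees it only through queries.
\<close>

record 'v hgraph =
  vlist :: "'v list"
  edges :: "'v set set"
  vid :: "'v \<Rightarrow> nat"

definition wf_hgraph :: "'v hgraph \<Rightarrow> bool" where
  "wf_hgraph G \<longleftrightarrow>
     distinct (vlist G) \<and>
     edges G \<subseteq> {{u, v} | u v. u \<in> set (vlist G) \<and> v \<in> set (vlist G) \<and> u \<noteq> v} \<and>
     inj_on (vid G) (set (vlist G))"

definition nverts :: "'v hgraph \<Rightarrow> nat" where
  "nverts G = card (set (vlist G))"

definition nedges :: "'v hgraph \<Rightarrow> nat" where
  "nedges G = card (edges G)"

definition oriented :: "'v hgraph \<Rightarrow> ('v \<times> 'v) set" where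
  "oriented G = {(u, v). {u, v} \<in> edges G}"

definition degree :: "'v hgraph \<Rightarrow> 'v \<Rightarrow> nat" where
  "degree G v = card {u \<in> set (vlist G). {v, u} \<in> edges G}"

text \<open>
  The neighbour list of \<open>v\<close>, by increasing hash value. Equal hash values (an event of
  probability 0) leave the vertices in the order of \<open>vlist\<close>.
\<close>

definition neighbors :: "'v hgraph \<Rightarrow> ('v \<Rightarrow> real) \<Rightarrow> 'v \<Rightarrow> 'v list" where
  "neighbors G h v = sort_key h (filter (\<lambda>u. {v, u} \<in> edges G) (vlist G))"

text \<open>
  Algorithms are programs of a unit-cost random access machine. As the hash values and \<open>p\<close>,
  \<open>\<delta>\<close> are reals, its numbers are reals. Memory consists of named arrays of numbers and named
  arrays of vertex handles; a scalar variable is cell 0 of an array. A number used as an index is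
  rounded down, negative ones to 0. The only constants are integers, so that a program cannot
  contain infinitely many bits of advice. The size of an expression is bounded in terms of the
  program text, hence charging 1 for an atomic command or a test measures time up to a factor that
  depends on the program alone.
\<close>

datatype nexp =
    Const int
  | Cell string nexp
  | Add nexp nexp
  | Sub nexp nexp
  | Mul nexp nexp
  | Div nexp nexp
  | Floor nexp
  | Sqrt nexp
  | Ln nexp

datatype bexp =
    Less nexp nexp
  | Not bexp
  | And bexp bexp

type_synonym cell = "string \<times> nexp"

text \<open>
  In \<open>NSet\<close>, \<open>VSet\<close>, \<open>Rand\<close> and the queries the first argument is the cell that receives the
  result. \<open>Rand\<close> draws a fresh uniform number from \<open>[0,1]\<close>. The returned samples are built up by
  \<open>NewSample\<close>, which appends an empty sample to the output, and \<open>Emit i u v\<close>, which adds the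
  oriented edge \<open>(u, v)\<close> to the sample with index \<open>i\<close>.
\<close>

datatype acom =
    NSet cell nexp
  | VSet cell cell
  | QVertex cell nexp
  | QDegree cell cell
  | QNeighbor cell cell nexp
  | QId cell cell
  | QHash cell cell
  | Rand cell
  | NewSample
  | Emit nexp cell cell

datatype com =
    Atom acom
  | Seq com com
  | If bexp com com
  | While bexp com

record 'v state =
  nums :: "string \<Rightarrow> nat \<Rightarrow> real"
  vtxs :: "string \<Rightarrow> nat \<Rightarrow> 'v option"
  coins :: "real stream"
  out :: "('v \<times> 'v) list list"

definition index :: "real \<Rightarrow> nat" where
  "index x = nat \<lfloor>x\<rfloor>"

primrec neval :: "nexp \<Rightarrow> 'v state \<Rightarrow> real" where
  "neval (Const i) s = of_int i"
| "neval (Cell x e) s = nums s x (index (neval e s))"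
| "neval (Add a b) s = neval a s + neval b s"
| "neval (Sub a b) s = neval a s - neval b s"
| "neval (Mul a b) s = neval a s * neval b s"
| "neval (Div a b) s = neval a s / neval b s"
| "neval (Floor a) s = of_int \<lfloor>neval a s\<rfloor>"
| "neval (Sqrt a) s = sqrt (neval a s)"
| "neval (Ln a) s = ln (neval a s)"

primrec beval :: "bexp \<Rightarrow> 'v state \<Rightarrow> bool" where
  "beval (Less a b) s \<longleftrightarrow> neval a s < neval b s"
| "beval (Not b) s \<longleftrightarrow> \<not> beval b s"
| "beval (And b c) s \<longleftrightarrow> beval b s \<and> beval c s"

fun nput :: "cell \<Rightarrow> real \<Rightarrow> 'v state \<Rightarrow> 'v state" where
  "nput (x, e) r s = s\<lparr>nums := (nums s)(x := (nums s x)(index (neval e s) := r))\<rparr>"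

fun vput :: "cell \<Rightarrow> 'v \<Rightarrow> 'v state \<Rightarrow> 'v state" where
  "vput (x, e) v s = s\<lparr>vtxs := (vtxs s)(x := (vtxs s x)(index (neval e s) := Some v))\<rparr>"

fun vget :: "cell \<Rightarrow> 'v state \<Rightarrow> 'v option" where
  "vget (x, e) s = vtxs s x (index (neval e s))"

text \<open>
  The effect of an atomic command on the graph \<open>G\<close> with hash function \<open>h\<close>. The result is \<open>None\<close>
  if the command is not admissible: the vertex or neighbour index is out of range, a handle is read
  that has not been obtained, or the sample to be extended does not exist. The machine then gets
  stuck and never halts. Indices, including those of samples, start at 0.
\<close>

fun astep :: "'v hgraph \<Rightarrow> ('v \<Rightarrow> real) \<Rightarrow> acom \<Rightarrow> 'v state \<Rightarrow> 'v state option" where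
  "astep G h (NSet x e) s = Some (nput x (neval e s) s)"
| "astep G h (VSet x y) s = map_option (\<lambda>v. vput x v s) (vget y s)"
| "astep G h (QVertex x e) s =
     (let i = index (neval e s)
      in if i < length (vlist G) then Some (vput x (vlist G ! i) s) else None)"
| "astep G h (QDegree x y) s = map_option (\<lambda>v. nput x (real (degree G v)) s) (vget y s)"
| "astep G h (QNeighbor x y e) s =
     (case vget y s of
        None \<Rightarrow> None
      | Some v \<Rightarrow>
          (let i = index (neval e s)
           in if i < degree G v then Some (vput x (neighbors G h v ! i) s) else None))"
| "astep G h (QId x y) s = map_option (\<lambda>v. nput x (real (vid G v)) s) (vget y s)"
| "astep G h (QHash x y) s = map_option (\<lambda>v. nput x (h v) s) (vget y s)"
| "astep G h (Rand x) s = Some ((nput x (shd (coins s)) s)\<lparr>coins := stl (coins s)\<rparr>)"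
| "astep G h NewSample s = Some (s\<lparr>out := out s @ [[]]\<rparr>)"
| "astep G h (Emit e y z) s =
     (case (vget y s, vget z s) of
        (Some u, Some v) \<Rightarrow>
          (let i = index (neval e s)
           in if i < length (out s) then Some (s\<lparr>out := (out s)[i := (u, v) # out s ! i]\<rparr>)
              else None)
      | _ \<Rightarrow> None)"

text \<open>\<open>exec G h c s k s'\<close>: started in \<open>s\<close>, the program \<open>c\<close> halts in \<open>s'\<close> after \<open>k\<close> time units.\<close>

inductive exec ::
  "'v hgraph \<Rightarrow> ('v \<Rightarrow> real) \<Rightarrow> com \<Rightarrow> 'v state \<Rightarrow> nat \<Rightarrow> 'v state \<Rightarrow> bool"
  for G :: "'v hgraph" and h :: "'v \<Rightarrow> real"
where
  Atom: "astep G h a s = Some s' \<Longrightarrow> exec G h (Atom a) s 1 s'"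
| Seq: "exec G h c s k s' \<Longrightarrow> exec G h d s' l s'' \<Longrightarrow> exec G h (Seq c d) s (k + l) s''"
| IfTrue: "beval b s \<Longrightarrow> exec G h c s k s' \<Longrightarrow> exec G h (If b c d) s (1 + k) s'"
| IfFalse: "\<not> beval b s \<Longrightarrow> exec G h d s k s' \<Longrightarrow> exec G h (If b c d) s (1 + k) s'"
| WhileFalse: "\<not> beval b s \<Longrightarrow> exec G h (While b c) s 1 s"
| WhileTrue: "beval b s \<Longrightarrow> exec G h c s k s' \<Longrightarrow> exec G h (While b c) s' l s'' \<Longrightarrow>
    exec G h (While b c) s (1 + k + l) s''"

inductive_cases AtomE: "exec G h (Atom a) s k s'"
inductive_cases SeqE: "exec G h (Seq c d) s k s'"
inductive_cases IfE: "exec G h (If b c d) s k s'"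
inductive_cases WhileE: "exec G h (While b c) s k s'"

lemma exec_deterministic:
  "exec G h c s k s' \<Longrightarrow> exec G h c s l s'' \<Longrightarrow> l = k \<and> s'' = s'"
proof (induction arbitrary: l s'' rule: exec.induct)
  case (Atom a s s')
  from Atom.prems Atom.hyps show ?case by (auto elim!: AtomE)
next
  case (Seq c s k s' d l s'')
  from Seq.prems show ?case by (rule SeqE) (metis Seq.IH)
next
  case (IfTrue b s c k s' d)
  from IfTrue.prems show ?case by (rule IfE) (auto simp: IfTrue.hyps dest: IfTrue.IH)
next
  case (IfFalse b s d k s' c)
  from IfFalse.prems show ?case by (rule IfE) (auto simp: IfFalse.hyps dest: IfFalse.IH)
next
  case (WhileFalse b s c)
  from WhileFalse.prems show ?case by (rule WhileE) (simp_all add: WhileFalse.hyps)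
next
  case (WhileTrue b s c k s' l s'')
  from WhileTrue.prems show ?case 
    by (rule WhileE) (use WhileTrue.hyps(1) in \<open>auto dest!: WhileTrue.IH\<close>)
qed

definition init :: "nat \<Rightarrow> real \<Rightarrow> nat \<Rightarrow> real \<Rightarrow> real stream \<Rightarrow> 'v state" where
  "init n p t \<delta> r =
     \<lparr>nums = (\<lambda>x i. 0)(''n'' := (\<lambda>i. real n), ''p'' := (\<lambda>i. p), ''t'' := (\<lambda>i. real t),
                       ''delta'' := (\<lambda>i. \<delta>)),
      vtxs = (\<lambda>x i. None),
      coins = r,
      out = []\<rparr>"

text \<open>
  Sample points are pairs of a hash function and the random numbers drawn by the algorithm.
\<close>

definition unif :: "real measure" where
  "unif = uniform_measure lborel {0..1}"

definition rspace :: "'v hgraph \<Rightarrow> (('v \<Rightarrow> real) \<times> real stream) measure" where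
  "rspace G = (\<Pi>\<^sub>M v\<in>set (vlist G). unif) \<Otimes>\<^sub>M stream_space unif"

definition halts ::
  "com \<Rightarrow> 'v hgraph \<Rightarrow> real \<Rightarrow> nat \<Rightarrow> real \<Rightarrow> ('v \<Rightarrow> real) \<times> real stream \<Rightarrow> nat \<Rightarrow> 'v state \<Rightarrow> bool"
where
  "halts c G p t \<delta> \<omega> k s \<longleftrightarrow> exec G (fst \<omega>) c (init (nverts G) p t \<delta> (snd \<omega>)) k s"

text \<open>By determinism there is at most one \<open>k\<close>; the infimum is \<open>\<infinity>\<close> if the program does not halt.\<close>

definition runtime ::
  "com \<Rightarrow> 'v hgraph \<Rightarrow> real \<Rightarrow> nat \<Rightarrow> real \<Rightarrow> ('v \<Rightarrow> real) \<times> real stream \<Rightarrow> ennreal"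
where
  "runtime c G p t \<delta> \<omega> = (INF k \<in> {k. \<exists>s. halts c G p t \<delta> \<omega> k s}. of_nat k)"

text \<open>The returned list of samples, \<open>None\<close> if the program does not halt.\<close>

definition returned ::
  "com \<Rightarrow> 'v hgraph \<Rightarrow> real \<Rightarrow> nat \<Rightarrow> real \<Rightarrow> ('v \<Rightarrow> real) \<times> real stream \<Rightarrow>
   ('v \<times> 'v) set list option"
where
  "returned c G p t \<delta> \<omega> =
     (if \<exists>k s. halts c G p t \<delta> \<omega> k s
      then Some (map set (out (THE s. \<exists>k. halts c G p t \<delta> \<omega> k s))) else None)"

text \<open>The event that the program returns a list of samples whose \<open>i\<close>-th one contains \<open>e\<close>.\<close>

definition included ::
  "com \<Rightarrow> 'v hgraph \<Rightarrow> real \<Rightarrow> nat \<Rightarrow> real \<Rightarrow> 'v \<times> 'v \<Rightarrow> nat \<Rightarrow> (('v \<Rightarrow> real) \<times> real stream) set"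
where
  "included c G p t \<delta> e i =
     {\<omega> \<in> space (rspace G). \<exists>Ts. returned c G p t \<delta> \<omega> = Some Ts \<and> i < length Ts \<and> e \<in> Ts ! i}"

lemma prob_space_unif: "prob_space unif"
  unfolding unif_def by (rule prob_space_uniform_measure) auto

lemma prob_space_rspace: "prob_space (rspace G)"
proof -
  interpret U: prob_space unif by (rule prob_space_unif)
  interpret H: prob_space "\<Pi>\<^sub>M v\<in>set (vlist G). unif"
    by (intro prob_space_PiM prob_space_unif)
  interpret R: prob_space "stream_space unif"
    by (rule U.prob_space_stream_space)
  interpret pair_prob_space "\<Pi>\<^sub>M v\<in>set (vlist G). unif" "stream_space unif" ..
  show ?thesis unfolding rspace_def by (rule prob_space_axioms)
qed

lemma returned_eq:
  assumes "halts c G p t \<delta> \<omega> k s"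
  shows "returned c G p t \<delta> \<omega> = Some (map set (out s))"
proof -
  have "(THE s. \<exists>k. halts c G p t \<delta> \<omega> k s) = s"
    using assms unfolding halts_def by (blast dest: exec_deterministic)
  with assms show ?thesis by (auto simp: returned_def)
qed

lemma runtime_eq:
  assumes "halts c G p t \<delta> \<omega> k s"
  shows "runtime c G p t \<delta> \<omega> = of_nat k"
proof -
  have "{k. \<exists>s. halts c G p t \<delta> \<omega> k s} = {k}"
    using assms unfolding halts_def by (blast dest: exec_deterministic)
  then show ?thesis by (simp add: runtime_def)
qed

end

theory Submission
  imports Defs
begin

text \<open>
  Put \<open>q = t p\<close> and call a vertex heavy if its degree exceeds \<open>\<theta> = \<lfloor>sqrt (ln (n/\<delta>) / q)\<rfloor>\<close>. The oriented
  edges leaving light vertices are sampled by geometric skipping over \<open>t n \<theta>\<close> slots, most of which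
  may be void. The row of a heavy vertex \<open>v\<close>, its \<open>t deg v\<close> slots, is nonempty with probability at
  most \<open>\<sigma> = min 1 (q deg v)\<close>, so it only has to be looked at if \<open>h v < \<sigma>\<close>. Given that, the first skip is
  drawn from a uniform number scaled by \<open>\<sigma>\<close>, which makes the row an exact Bernoulli sample again.
  The hash value itself must not serve as that number: it also determines the order of the
  neighbour lists that contain \<open>v\<close>.

  The heavy vertices with small hash value are found from random vertices \<open>w\<close>: the \<open>s\<close>-th one is
  used to find neighbours of degree up to about \<open>n ln (n/\<delta>) / s\<close>, and since neighbour lists are sorted
  by hash value, only those with hash value below \<open>q\<close> times that degree are read. Each \<open>v\<close> of degree
  \<open>d\<close> has about \<open>(n/d) ln (n/\<delta>)\<close> chances to be hit, hence is missed with probability at most \<open>\<delta>/n\<close>.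
  The event that no heavy vertex is missed depends on the first coins only; for every choice of
  these coins and of the hash values the subsequent coins yield inclusion probabilities that
  depend on the hash values through the tests \<open>h v < \<sigma>\<close> alone, and integrating over the hash values
  gives \<open>p ^ card X\<close> for every set \<open>X\<close> of pairs of an oriented edge and a sample index.
\<close>

subsection \<open>Measurability of the machine semantics\<close>

text \<open>The threshold balances two costs. The light task visits about q n \<theta> slots, and
  the search for heavy vertices takes about (n / \<theta>) ln (n/\<delta>) probes; both are near n
  sqrt (q ln (n/\<delta>)) for the chosen \<theta>. In round j, a vertex u is a neighbour of the
  probed vertex with probability deg u / n and passes the hash test with probability at most q n /
  j. So a probe accepts on average at most 2 q / j times the number of edges, and summing over the
  rounds gives a harmonic sum, hence a logarithm.

  The event conditioned on asks that every heavy vertex be hit in time, and not merely those whose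
  hash value is small. The weaker event would depend on the hash values, and conditioning on it
  would bias them.

  A run is a relation between states, and the vertex type is arbitrary. Measurability of the running
  time and of the inclusion events is therefore proved separately, for every program, by induction
  over the run.\<close>

lemma sets_unif [measurable_cong, simp]: "sets unif = sets borel"
  by (simp add: unif_def)

lemma space_unif [simp]: "space unif = UNIV"
  by (simp add: unif_def)

definition handles :: "'v set \<Rightarrow> 'v option set" where
  "handles V = insert None (Some ` V)"

definition outputs :: "'v set \<Rightarrow> ('v \<times> 'v) list list set" where
  "outputs V = lists (lists (V \<times> V))"

lemma countable_handles: "finite V \<Longrightarrow> countable (handles V)"
  by (auto simp: handles_def intro: countable_finite)

text \<open>
  Memory cells are random variables one by one; handles and outputs take countably many values
  because the vertex set is finite, whatever the size of the vertex type.
\<close>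

definition mstate :: "'a measure \<Rightarrow> 'v set \<Rightarrow> ('a \<Rightarrow> 'v state) \<Rightarrow> bool" where
  "mstate M V F \<longleftrightarrow>
     (\<forall>x i. (\<lambda>\<omega>. nums (F \<omega>) x i) \<in> borel_measurable M) \<and>
     (\<forall>x i. (\<lambda>\<omega>. vtxs (F \<omega>) x i) \<in> measurable M (count_space (handles V))) \<and>
     (\<lambda>\<omega>. coins (F \<omega>)) \<in> measurable M (stream_space unif) \<and>
     (\<lambda>\<omega>. out (F \<omega>)) \<in> measurable M (count_space (outputs V))"

lemma mstateD:
  assumes "mstate M V F"
  shows "(\<lambda>\<omega>. nums (F \<omega>) x i) \<in> borel_measurable M"
    "(\<lambda>\<omega>. vtxs (F \<omega>) x i) \<in> measurable M (count_space (handles V))"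
    "(\<lambda>\<omega>. coins (F \<omega>)) \<in> measurable M (stream_space unif)"
    "(\<lambda>\<omega>. out (F \<omega>)) \<in> measurable M (count_space (outputs V))"
  using assms by (auto simp: mstate_def)

lemma mstate_if:
  assumes "mstate M V F" "mstate M V F'" and [measurable]: "Measurable.pred M P"
  shows "mstate M V (\<lambda>\<omega>. if P \<omega> then F \<omega> else F' \<omega>)"
proof -
  have *: "(\<lambda>\<omega>. f (if P \<omega> then F \<omega> else F' \<omega>)) = (\<lambda>\<omega>. if P \<omega> then f (F \<omega>) else f (F' \<omega>))"
    for f :: "'b state \<Rightarrow> 'c"
    by auto
  note [measurable] = mstateD[OF assms(1)] mstateD[OF assms(2)]
  show ?thesis
    unfolding mstate_def *[of "\<lambda>s. nums s _ _"] *[of "\<lambda>s. vtxs s _ _"] *[of coins] *[of out]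
    by (intro conjI allI; measurable)
qed

lemma measurable_index [measurable]: "index \<in> measurable borel (count_space UNIV)"
  unfolding index_def by measurable

lemma measurable_neval:
  assumes F: "mstate M V F"
  shows "(\<lambda>\<omega>. neval e (F \<omega>)) \<in> borel_measurable M"
proof (induction e)
  case (Cell x e)
  note [measurable] = Cell mstateD(1)[OF F]
  have "(\<lambda>\<omega>. (\<lambda>i \<omega>. nums (F \<omega>) x i) (index (neval e (F \<omega>))) \<omega>) \<in> borel_measurable M"
    by (rule measurable_compose_countable) measurable
  then show ?case by simp
qed (auto simp: borel_measurable_divide)

lemma measurable_beval:
  assumes F: "mstate M V F"
  shows "Measurable.pred M (\<lambda>\<omega>. beval b (F \<omega>))"
proof (induction b)
  case (Less a b)
  note [measurable] = measurable_neval[OF F]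
  show ?case by simp
qed auto

lemma mstate_nput:
  assumes F: "mstate M V F" and [measurable]: "r \<in> borel_measurable M"
  shows "mstate M V (\<lambda>\<omega>. nput c (r \<omega>) (F \<omega>))"
proof (cases c)
  case (Pair x e)
  note [measurable] = measurable_neval[OF F] mstateD[OF F]
  have "(\<lambda>\<omega>. nums (nput c (r \<omega>) (F \<omega>)) y i) \<in> borel_measurable M" for y i
  proof -
    have "(\<lambda>\<omega>. nums (nput c (r \<omega>) (F \<omega>)) y i) =
      (\<lambda>\<omega>. if y = x \<and> index (neval e (F \<omega>)) = i then r \<omega> else nums (F \<omega>) y i)"
      by (auto simp: Pair)
    also have "\<dots> \<in> borel_measurable M" by measurable
    finally show ?thesis .
  qed
  then show ?thesis
    by (auto simp: mstate_def Pair mstateD[OF F])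
qed

lemma mstate_vput:
  assumes F: "mstate M V F" and v: "v \<in> measurable M (count_space V)"
  shows "mstate M V (\<lambda>\<omega>. vput c (v \<omega>) (F \<omega>))"
proof (cases c)
  case (Pair x e)
  have [measurable]: "(\<lambda>\<omega>. Some (v \<omega>)) \<in> measurable M (count_space (handles V))"
    by (rule measurable_compose[OF v]) (auto simp: handles_def)
  note [measurable] = measurable_neval[OF F] mstateD[OF F]
  have "(\<lambda>\<omega>. vtxs (vput c (v \<omega>) (F \<omega>)) y i) \<in> measurable M (count_space (handles V))" for y i
  proof -
    have "(\<lambda>\<omega>. vtxs (vput c (v \<omega>) (F \<omega>)) y i) =
      (\<lambda>\<omega>. if y = x \<and> index (neval e (F \<omega>)) = i then Some (v \<omega>) else vtxs (F \<omega>) y i)"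
      by (auto simp: Pair)
    also have "\<dots> \<in> measurable M (count_space (handles V))" by measurable
    finally show ?thesis .
  qed
  then show ?thesis
    by (auto simp: mstate_def Pair mstateD[OF F])
qed

lemma measurable_vget:
  assumes F: "mstate M V F"
  shows "(\<lambda>\<omega>. vget y (F \<omega>)) \<in> measurable M (count_space (handles V))"
proof (cases y)
  case (Pair x e)
  note [measurable] = measurable_neval[OF F] mstateD[OF F]
  have "(\<lambda>\<omega>. (\<lambda>i \<omega>. vtxs (F \<omega>) x i) (index (neval e (F \<omega>))) \<omega>) \<in> measurable M (count_space (handles V))"
    by (rule measurable_compose_countable) measurable
  then show ?thesis by (simp add: Pair)
qed

lemma measurable_insort_key:
  fixes h :: "'a \<Rightarrow> 'v \<Rightarrow> real"
  assumes h: "\<And>v. v \<in> V \<Longrightarrow> (\<lambda>\<omega>. h \<omega> v) \<in> borel_measurable M"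
    and "a \<in> V" "ys \<in> lists V"
  shows "(\<lambda>\<omega>. insort_key (h \<omega>) a ys) \<in> measurable M (count_space (lists V))"
  using assms(3)
proof (induction ys)
  case Nil
  then show ?case using assms(2) by simp
next
  case (Cons y ys)
  have y: "y \<in> V" using Cons.hyps by simp
  have 1: "(\<lambda>\<omega>. y # insort_key (h \<omega>) a ys) \<in> measurable M (count_space (lists V))"
    by (rule measurable_compose[OF Cons.IH]) (use Cons.hyps in auto)
  have 2: "(\<lambda>\<omega>. a # y # ys) \<in> measurable M (count_space (lists V))"
    using Cons.hyps assms(2) by simp
  have 3: "{\<omega> \<in> space M. h \<omega> a \<le> h \<omega> y} \<in> sets M"
    using h[OF assms(2)] h[OF y] by measurable
  show ?case
    unfolding insort_key.simps by (rule measurable_If[OF 2 1 3])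
qed

text \<open>Sorting inspects the keys only through pairwise comparisons, each of them a measurable
  event, and the partial results range over the countable set \<open>lists V\<close>.\<close>

lemma measurable_sort_key:
  fixes h :: "'a \<Rightarrow> 'v \<Rightarrow> real"
  assumes h: "\<And>v. v \<in> V \<Longrightarrow> (\<lambda>\<omega>. h \<omega> v) \<in> borel_measurable M"
    and "xs \<in> lists V" and "finite V"
  shows "(\<lambda>\<omega>. sort_key (h \<omega>) xs) \<in> measurable M (count_space (lists V))"
  using assms(2)
proof (induction xs)
  case (Cons a xs)
  have "(\<lambda>\<omega>. (\<lambda>ys \<omega>. insort_key (h \<omega>) a ys) (sort_key (h \<omega>) xs) \<omega>)
      \<in> measurable M (count_space (lists V))"
  proof (rule measurable_compose_countable'[where I = "lists V" and g = "\<lambda>\<omega>. sort_key (h \<omega>) xs"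
        and f = "\<lambda>ys \<omega>. insort_key (h \<omega>) a ys"])
    show "(\<lambda>\<omega>. insort_key (h \<omega>) a ys) \<in> measurable M (count_space (lists V))" if "ys \<in> lists V" for ys
      using h Cons.hyps that by (intro measurable_insort_key) auto
    show "countable (lists V)"
      using assms(3) by (simp add: countable_lists countable_finite)
  qed (fact Cons.IH)
  then show ?case by simp
qed (simp add: sort_key_def)

context
  fixes G :: "'v hgraph" and M :: "'a measure" and h :: "'a \<Rightarrow> 'v \<Rightarrow> real" and V :: "'v set"
  defines "V \<equiv> set (vlist G)"
  assumes h: "\<And>v. v \<in> V \<Longrightarrow> (\<lambda>\<omega>. h \<omega> v) \<in> borel_measurable M"
begin

lemma finV: "finite V"
  by (simp add: V_def)

lemma length_neighbors': "length (neighbors G g v) = card {u \<in> V. {v, u} \<in> edges G} \<or> \<not> distinct (vlist G)"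
  by (auto simp: neighbors_def V_def distinct_length_filter Int_def conj_commute)

text \<open>A random handle has finitely many possible values, so the case distinction glues
  countably many branches; only handles of vertices in \<open>V\<close> occur.\<close>

lemma mstate_option:
  assumes X: "X \<in> measurable M (count_space (handles V))" and F: "mstate M V F"
    and K: "\<And>v. v \<in> V \<Longrightarrow> mstate M V (\<lambda>\<omega>. K v \<omega>)"
  shows "mstate M V (\<lambda>\<omega>. case X \<omega> of None \<Rightarrow> F \<omega> | Some v \<Rightarrow> K v \<omega>)"
proof -
  define H where "H y \<omega> = (case y of None \<Rightarrow> F \<omega> | Some v \<Rightarrow> K v \<omega>)" for y \<omega>
  have H: "mstate M V (H y)" if "y \<in> handles V" for y
    using that F K by (auto simp: handles_def H_def[abs_def])
  have "(\<lambda>\<omega>. f (H (X \<omega>) \<omega>)) \<in> measurable M N"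
    if "\<And>y. y \<in> handles V \<Longrightarrow> (\<lambda>\<omega>. f (H y \<omega>)) \<in> measurable M N" for f :: "'v state \<Rightarrow> 'c" and N
    by (rule measurable_compose_countable'[OF that X]) (auto simp: countable_handles finV)
  note * = this
  show ?thesis
    unfolding mstate_def H_def[symmetric]
    by (intro conjI allI *[of "\<lambda>s. nums s _ _"] *[of "\<lambda>s. vtxs s _ _"] *[of coins] *[of out]
        mstateD[OF H])
qed

lemma measurable_handle_pred:
  assumes X: "X \<in> measurable M (count_space (handles V))"
    and "\<And>v. v \<in> V \<Longrightarrow> Measurable.pred M (P v)"
  shows "Measurable.pred M (\<lambda>\<omega>. case X \<omega> of None \<Rightarrow> False | Some v \<Rightarrow> P v \<omega>)"
proof -
  have "Measurable.pred M (\<lambda>\<omega>. (\<lambda>y \<omega>. case y of None \<Rightarrow> False | Some v \<Rightarrow> P v \<omega>) (X \<omega>) \<omega>)"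
    by (rule measurable_compose_countable'[OF _ X])
      (use assms(2) in \<open>auto simp: handles_def intro: countable_finite finV\<close>)
  then show ?thesis .
qed

lemma measurable_neighbors:
  assumes F: "mstate M V F"
  shows "(\<lambda>\<omega>. let i = index (neval e (F \<omega>)); xs = neighbors G (h \<omega>) v
            in if i < length xs then Some (xs ! i) else None) \<in> measurable M (count_space (handles V))"
proof -
  have nb: "(\<lambda>\<omega>. neighbors G (h \<omega>) v) \<in> measurable M (count_space (lists V))"
    unfolding neighbors_def by (rule measurable_sort_key) (use h finV in \<open>auto simp: V_def\<close>)
  have [measurable]: "(\<lambda>\<omega>. index (neval e (F \<omega>))) \<in> measurable M (count_space UNIV)"
    using measurable_neval[OF F] by measurable
  have "(\<lambda>\<omega>. (\<lambda>xs \<omega>. (if index (neval e (F \<omega>)) < length xs then Some (xs ! index (neval e (F \<omega>))) else None))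
     (neighbors G (h \<omega>) v) \<omega>) \<in> measurable M (count_space (handles V))"
  proof (rule measurable_compose_countable'[OF _ nb])
    fix xs assume xs: "xs \<in> lists V"
    have "(\<lambda>i. if i < length xs then Some (xs ! i) else None) \<in> measurable (count_space UNIV) (count_space (handles V))"
      using xs by (auto simp: handles_def in_lists_conv_set)
    then show "(\<lambda>\<omega>. if index (neval e (F \<omega>)) < length xs then Some (xs ! index (neval e (F \<omega>))) else None)
       \<in> measurable M (count_space (handles V))"
      by (rule measurable_compose[rotated]) measurable
  qed (auto simp: countable_lists countable_finite finV)
  then show ?thesis by (simp add: Let_def)
qed

lemma mstate_coins:
  assumes F: "mstate M V F" and "c \<in> measurable M (stream_space unif)"
  shows "mstate M V (\<lambda>\<omega>. (F \<omega>)\<lparr>coins := c \<omega>\<rparr>)"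
  using assms by (simp add: mstate_def)

lemma mstate_out:
  assumes F: "mstate M V F" and "c \<in> measurable M (count_space (outputs V))"
  shows "mstate M V (\<lambda>\<omega>. (F \<omega>)\<lparr>out := c \<omega>\<rparr>)"
  using assms by (simp add: mstate_def)

text \<open>Admissibility and effect are separated: the first is an event, the second a total
  function that keeps the state when the command fails. \<open>mstate\<close> has no room for
  failure.\<close>

lemma mstate_astep:
  assumes wf: "distinct (vlist G)" and F: "mstate M V F"
  shows "Measurable.pred M (\<lambda>\<omega>. astep G (h \<omega>) a (F \<omega>) \<noteq> None) \<and>
    mstate M V (\<lambda>\<omega>. case astep G (h \<omega>) a (F \<omega>) of None \<Rightarrow> F \<omega> | Some s \<Rightarrow> s)"
proof -
  have pq: "Measurable.pred M (\<lambda>\<omega>. map_option (f \<omega>) (X \<omega>) \<noteq> None)"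
    if "X \<in> measurable M (count_space (handles V))" for X :: "'a \<Rightarrow> 'v option" and f :: "'a \<Rightarrow> 'v \<Rightarrow> 'b"
  proof -
    have "(\<lambda>\<omega>. map_option (f \<omega>) (X \<omega>) \<noteq> None) = (\<lambda>\<omega>. case X \<omega> of None \<Rightarrow> False | Some v \<Rightarrow> True)"
      by (auto split: option.splits)
    then show ?thesis using measurable_handle_pred[OF that, of "\<lambda>_ _. True"] by simp
  qed
  have co: "(case map_option f z of None \<Rightarrow> s | Some s' \<Rightarrow> s') = (case z of None \<Rightarrow> s | Some v \<Rightarrow> f v)"
    for f z and s :: "'v state" by (cases z) auto
  note [measurable] = measurable_neval[OF F] mstateD[OF F]
  show ?thesis
  proof (cases a)
    case (NSet x e)
    then show ?thesis using mstate_nput[OF F measurable_neval[OF F]] by simp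
  next
    case (VSet x y)
    show ?thesis unfolding VSet astep.simps co
    proof (intro conjI mstate_option pq measurable_vget F)
      fix v assume "v \<in> V" then show "mstate M V (\<lambda>\<omega>. vput x v (F \<omega>))"
        by (intro mstate_vput F) auto
    qed
  next
    case (QVertex x e)
    let ?n = "length (vlist G)"
    have i: "(\<lambda>\<omega>. index (neval e (F \<omega>))) \<in> measurable M (count_space UNIV)" by measurable
    have *: "(\<lambda>\<omega>. case astep G (h \<omega>) a (F \<omega>) of None \<Rightarrow> F \<omega> | Some s \<Rightarrow> s)
       = (\<lambda>\<omega>. case (if index (neval e (F \<omega>)) < ?n then Some (vlist G ! index (neval e (F \<omega>))) else None) of
            None \<Rightarrow> F \<omega> | Some v \<Rightarrow> vput x v (F \<omega>))"
      by (auto simp: QVertex Let_def)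
    show ?thesis
    proof
      show "Measurable.pred M (\<lambda>\<omega>. astep G (h \<omega>) a (F \<omega>) \<noteq> None)"
        unfolding QVertex astep.simps Let_def by (simp, measurable)
      show "mstate M V (\<lambda>\<omega>. case astep G (h \<omega>) a (F \<omega>) of None \<Rightarrow> F \<omega> | Some s \<Rightarrow> s)"
        unfolding *
      proof (rule mstate_option)
        have "(\<lambda>i. if i < ?n then Some (vlist G ! i) else None) \<in> measurable (count_space UNIV) (count_space (handles V))"
          by (auto simp: handles_def V_def)
        then show "(\<lambda>\<omega>. if index (neval e (F \<omega>)) < ?n then Some (vlist G ! index (neval e (F \<omega>))) else None)
           \<in> measurable M (count_space (handles V))"
          by (rule measurable_compose[rotated]) measurable
        show "mstate M V (\<lambda>\<omega>. vput x v (F \<omega>))" if "v \<in> V" for v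
          using that by (intro mstate_vput F) auto
      qed (fact F)
    qed
  next
    case (QDegree x y)
    show ?thesis unfolding QDegree astep.simps co
      by (intro conjI mstate_option pq measurable_vget F mstate_nput) auto
  next
    case (QNeighbor x y e)
    have deg: "degree G v = length (neighbors G g v)" for v g
      using length_neighbors'[of g v] wf by (simp add: degree_def V_def)
    define nb where "nb v \<omega> = (let i = index (neval e (F \<omega>)); xs = neighbors G (h \<omega>) v
            in if i < length xs then Some (xs ! i) else None)" for v \<omega>
    have nb: "nb v \<in> measurable M (count_space (handles V))" for v
      unfolding nb_def[abs_def] by (rule measurable_neighbors[OF F])
    have *: "(\<lambda>\<omega>. case astep G (h \<omega>) a (F \<omega>) of None \<Rightarrow> F \<omega> | Some s \<Rightarrow> s)
       = (\<lambda>\<omega>. case vget y (F \<omega>) of None \<Rightarrow> F \<omega> | Some v \<Rightarrow>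
            (case nb v \<omega> of None \<Rightarrow> F \<omega> | Some u \<Rightarrow> vput x u (F \<omega>)))"
      by (rule ext) (auto simp: QNeighbor Let_def nb_def deg[symmetric] split: option.splits)
    have **: "(\<lambda>\<omega>. astep G (h \<omega>) a (F \<omega>) \<noteq> None) = (\<lambda>\<omega>. case vget y (F \<omega>) of None \<Rightarrow> False | Some v \<Rightarrow>
            index (neval e (F \<omega>)) < degree G v)"
      by (rule ext) (auto simp: QNeighbor Let_def split: option.splits)
    show ?thesis
      unfolding * unfolding **
    proof (intro conjI mstate_option measurable_handle_pred measurable_vget F nb)
      fix v u assume "u \<in> V" then show "mstate M V (\<lambda>\<omega>. vput x u (F \<omega>))"
        by (intro mstate_vput F) auto
    qed measurable
  next
    case (QId x y)
    show ?thesis unfolding QId astep.simps co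
      by (intro conjI mstate_option pq measurable_vget F mstate_nput) auto
  next
    case (QHash x y)
    show ?thesis unfolding QHash astep.simps co
      by (intro conjI mstate_option pq measurable_vget F mstate_nput h)
  next
    case (Rand x)
    have "(\<lambda>\<omega>. shd (coins (F \<omega>))) \<in> measurable M unif" by measurable
    then have "(\<lambda>\<omega>. shd (coins (F \<omega>))) \<in> borel_measurable M"
      using measurable_cong_sets[OF refl sets_unif, of M] by simp
    then show ?thesis unfolding Rand by (auto intro!: mstate_coins mstate_nput F)
  next
    case NewSample
    have "(\<lambda>xs. xs @ [[]]) \<in> measurable (count_space (outputs V)) (count_space (outputs V))"
      by (auto simp: outputs_def)
    then have "(\<lambda>\<omega>. out (F \<omega>) @ [[]]) \<in> measurable M (count_space (outputs V))"
      by (rule measurable_compose[rotated]) measurable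
    then show ?thesis unfolding NewSample by (auto intro!: mstate_out F)
  next
    case (Emit e y z)
    define len where "len \<omega> \<longleftrightarrow> index (neval e (F \<omega>)) < length (out (F \<omega>))" for \<omega>
    have len [measurable]: "Measurable.pred M len"
    proof -
      have "Measurable.pred M (\<lambda>\<omega>. i < length (out (F \<omega>)))" for i
        by (rule measurable_compose[OF mstateD(4)[OF F]]) simp
      then show ?thesis unfolding len_def
        by (rule measurable_compose_countable[where g = "\<lambda>\<omega>. index (neval e (F \<omega>))"]) measurable
    qed
    have upd: "(\<lambda>\<omega>. (out (F \<omega>))[index (neval e (F \<omega>)) := (u, v) # out (F \<omega>) ! index (neval e (F \<omega>))])
        \<in> measurable M (count_space (outputs V))" (is "?f \<in> _")
      if uv: "u \<in> V" "v \<in> V" for u v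
    proof -
      have "(\<lambda>\<omega>. (\<lambda>i \<omega>. (out (F \<omega>))[i := (u, v) # out (F \<omega>) ! i]) (index (neval e (F \<omega>))) \<omega>)
        \<in> measurable M (count_space (outputs V))"
      proof (rule measurable_compose_countable)
        fix i
        have "(\<lambda>xs. xs[i := (u, v) # xs ! i]) \<in> measurable (count_space (outputs V)) (count_space (outputs V))"
        proof (unfold measurable_count_space_eq1 space_count_space, rule Pi_I)
          fix xs assume "xs \<in> outputs V"
          then have xs: "set xs \<subseteq> lists (V \<times> V)" by (auto simp: outputs_def)
          have "set (xs[i := (u, v) # xs ! i]) \<subseteq> lists (V \<times> V)"
          proof (cases "i < length xs")
            case True
            with xs have "xs ! i \<in> lists (V \<times> V)" by (meson nth_mem subsetD)
            with uv have "(u, v) # xs ! i \<in> lists (V \<times> V)" by auto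
            with set_update_subset_insert[of xs i "(u, v) # xs ! i"] xs show ?thesis by blast
          qed (metis list_update_beyond not_less xs)
          then show "xs[i := (u, v) # xs ! i] \<in> outputs V" by (auto simp: outputs_def)
        qed
        then show "(\<lambda>\<omega>. (out (F \<omega>))[i := (u, v) # out (F \<omega>) ! i]) \<in> measurable M (count_space (outputs V))"
          by (rule measurable_compose[rotated]) measurable
      qed measurable
      then show ?thesis .
    qed
    have *: "(\<lambda>\<omega>. case astep G (h \<omega>) a (F \<omega>) of None \<Rightarrow> F \<omega> | Some s \<Rightarrow> s)
       = (\<lambda>\<omega>. case vget y (F \<omega>) of None \<Rightarrow> F \<omega> | Some u \<Rightarrow> (case vget z (F \<omega>) of None \<Rightarrow> F \<omega> | Some v \<Rightarrow>
            if len \<omega> then (F \<omega>)\<lparr>out := (out (F \<omega>))[index (neval e (F \<omega>)) := (u, v) # out (F \<omega>) ! index (neval e (F \<omega>))]\<rparr>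
            else F \<omega>))"
      by (rule ext) (auto simp: Emit Let_def len_def split: option.splits)
    have **: "(\<lambda>\<omega>. astep G (h \<omega>) a (F \<omega>) \<noteq> None) = (\<lambda>\<omega>. case vget y (F \<omega>) of None \<Rightarrow> False | Some u \<Rightarrow>
         (case vget z (F \<omega>) of None \<Rightarrow> False | Some v \<Rightarrow> len \<omega>))"
      by (rule ext) (auto simp: Emit Let_def len_def split: option.splits)
    show ?thesis
      unfolding * unfolding **
      by (intro conjI mstate_option measurable_handle_pred measurable_vget F mstate_if mstate_out upd len)
  qed
qed

text \<open>For a fixed time, \<open>exec\<close> is a partial function of the random start state.
  It is represented by the event \<open>D\<close> that a run of exactly this length exists and by a
  total random state \<open>F'\<close> that matters only on \<open>D\<close>.\<close>

definition mrun :: "com \<Rightarrow> ('a \<Rightarrow> 'v state) \<Rightarrow> nat \<Rightarrow> bool" where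
  "mrun c F k \<longleftrightarrow> (\<exists>D F'. Measurable.pred M D \<and> mstate M V F' \<and>
     (\<forall>\<omega>\<in>space M. if D \<omega> then exec G (h \<omega>) c (F \<omega>) k (F' \<omega>) else \<not> (\<exists>s. exec G (h \<omega>) c (F \<omega>) k s)))"

lemma mrunE:
  assumes "mrun c F k"
  obtains D F' where "Measurable.pred M D" "mstate M V F'"
    "\<forall>\<omega>\<in>space M. if D \<omega> then exec G (h \<omega>) c (F \<omega>) k (F' \<omega>) else \<not> (\<exists>s. exec G (h \<omega>) c (F \<omega>) k s)"
  using assms unfolding mrun_def by (elim exE conjE) (rule that)

text \<open>Runs are assembled from finitely many cases, such as the ways to divide the time between
  two parts. The events may overlap, since every case that applies supplies a run of the same
  length.\<close>

lemma mrun_combine: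
  assumes F: "mstate M V F" and fin: "finite I"
    and D: "\<And>i. i \<in> I \<Longrightarrow> Measurable.pred M (D i)" and F': "\<And>i. i \<in> I \<Longrightarrow> mstate M V (F' i)"
    and ex: "\<And>i \<omega>. i \<in> I \<Longrightarrow> \<omega> \<in> space M \<Longrightarrow> D i \<omega> \<Longrightarrow> exec G (h \<omega>) c (F \<omega>) k (F' i \<omega>)"
    and nex: "\<And>\<omega> s. \<omega> \<in> space M \<Longrightarrow> exec G (h \<omega>) c (F \<omega>) k s \<Longrightarrow> \<exists>i\<in>I. D i \<omega>"
  shows "mrun c F k"
proof -
  have "\<exists>H. mstate M V H \<and> (\<forall>\<omega>\<in>space M. (\<exists>i\<in>I. D i \<omega>) \<longrightarrow> exec G (h \<omega>) c (F \<omega>) k (H \<omega>))"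
    using fin D F' ex
  proof (induction I)
    case empty
    then show ?case using F by auto
  next
    case (insert i I)
    then obtain H where H: "mstate M V H" "\<forall>\<omega>\<in>space M. (\<exists>i\<in>I. D i \<omega>) \<longrightarrow> exec G (h \<omega>) c (F \<omega>) k (H \<omega>)"
      by auto
    have "mstate M V (\<lambda>\<omega>. if D i \<omega> then F' i \<omega> else H \<omega>)"
      by (rule mstate_if) (use insert.prems H in auto)
    with H(2) insert.prems show ?case
      by (intro exI[of _ "\<lambda>\<omega>. if D i \<omega> then F' i \<omega> else H \<omega>"]) auto
  qed
  then obtain H where H: "mstate M V H" "\<forall>\<omega>\<in>space M. (\<exists>i\<in>I. D i \<omega>) \<longrightarrow> exec G (h \<omega>) c (F \<omega>) k (H \<omega>)"
    by auto
  have "Measurable.pred M (\<lambda>\<omega>. \<exists>i\<in>I. D i \<omega>)"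
    using fin D by (intro pred_intros_finite) auto
  moreover have "if \<exists>i\<in>I. D i \<omega> then exec G (h \<omega>) c (F \<omega>) k (H \<omega>)
      else \<not> (\<exists>s. exec G (h \<omega>) c (F \<omega>) k s)" if "\<omega> \<in> space M" for \<omega>
    using H(2) nex[OF that] that by meson
  ultimately show ?thesis
    unfolding mrun_def using H(1) by blast
qed

text \<open>The outer induction is over the time, the inner one over the program. A loop reappears
  after its own body, so only the time, which each test consumes, decreases. Sequencing is free of
  charge, so one part may take all the time; there the structural hypothesis is needed.\<close>

lemma mrun_exec:
  assumes wf: "distinct (vlist G)"
  shows "mstate M V F \<Longrightarrow> mrun c F k"
proof (induction k arbitrary: c F rule: less_induct)
  case (less k)
  note IHk = less.IH
  from less.prems show ?case
  proof (induction c arbitrary: F)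
    case (Atom a)
    note as = mstate_astep[OF wf Atom, of a]
    define D where "D \<omega> \<longleftrightarrow> k = 1 \<and> astep G (h \<omega>) a (F \<omega>) \<noteq> None" for \<omega>
    define F' where "F' \<omega> = (case astep G (h \<omega>) a (F \<omega>) of None \<Rightarrow> F \<omega> | Some s \<Rightarrow> s)" for \<omega>
    have "Measurable.pred M D"
    proof (cases "k = 1")
      case True
      then show ?thesis using as by (simp add: D_def[abs_def])
    qed (simp add: D_def[abs_def])
    moreover have "mstate M V F'" using as by (simp add: F'_def[abs_def])
    moreover have "exec G (h \<omega>) (com.Atom a) (F \<omega>) k (F' \<omega>)" if "D \<omega>" for \<omega>
      using that exec.Atom[of G "h \<omega>" a "F \<omega>"] by (auto simp: D_def F'_def)
    moreover have "D \<omega>" if "exec G (h \<omega>) (com.Atom a) (F \<omega>) k s" for \<omega> s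
      using that by (auto simp: D_def elim: AtomE)
    ultimately show ?case
      unfolding mrun_def by (metis (no_types, lifting))
  next
    case (Seq c d)
    have "mrun c F i" if "i \<le> k" for i
        using that Seq.IH(1)[OF Seq.prems] IHk[of i F c] Seq.prems by (cases "i = k") auto
      then obtain D1 F1 where 1: "\<And>i. i \<le> k \<Longrightarrow> Measurable.pred M (D1 i)" "\<And>i. i \<le> k \<Longrightarrow> mstate M V (F1 i)"
      "\<And>i \<omega>. i \<le> k \<Longrightarrow> \<omega> \<in> space M \<Longrightarrow>
        if D1 i \<omega> then exec G (h \<omega>) c (F \<omega>) i (F1 i \<omega>) else \<not> (\<exists>s. exec G (h \<omega>) c (F \<omega>) i s)"
      unfolding mrun_def by metis
    have "mrun d (F1 i) (k - i)" if "i \<le> k" for i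
        using Seq.IH(2)[OF 1(2)[OF that]] IHk[of "k - i" "F1 i" d] 1(2)[OF that] that by (cases "i = 0") auto
      then obtain D2 F2 where 2: "\<And>i. i \<le> k \<Longrightarrow> Measurable.pred M (D2 i)" "\<And>i. i \<le> k \<Longrightarrow> mstate M V (F2 i)"
      "\<And>i \<omega>. i \<le> k \<Longrightarrow> \<omega> \<in> space M \<Longrightarrow>
        if D2 i \<omega> then exec G (h \<omega>) d (F1 i \<omega>) (k - i) (F2 i \<omega>) else \<not> (\<exists>s. exec G (h \<omega>) d (F1 i \<omega>) (k - i) s)"
      unfolding mrun_def by metis
    show ?case
    proof (rule mrun_combine[where I = "{..k}" and D = "\<lambda>i \<omega>. D1 i \<omega> \<and> D2 i \<omega>" and F' = F2])
      fix i \<omega> assume "i \<in> {..k}" "\<omega> \<in> space M" "D1 i \<omega> \<and> D2 i \<omega>"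
      then show "exec G (h \<omega>) (Seq c d) (F \<omega>) k (F2 i \<omega>)"
        using exec.Seq[of G "h \<omega>" c "F \<omega>" i "F1 i \<omega>" d "k - i" "F2 i \<omega>"] 1(3)[of i \<omega>] 2(3)[of i \<omega>] by auto
    next
      fix \<omega> s assume \<omega>: "\<omega> \<in> space M" and "exec G (h \<omega>) (Seq c d) (F \<omega>) k s"
      then obtain i l s' where i: "k = i + l" "exec G (h \<omega>) c (F \<omega>) i s'" "exec G (h \<omega>) d s' l s"
        by (auto elim: SeqE)
      then have "D1 i \<omega>" using 1(3)[of i \<omega>] \<omega> by (auto split: if_splits)
      moreover from this have "F1 i \<omega> = s'" using 1(3)[of i \<omega>] \<omega> i by (auto dest: exec_deterministic)
      ultimately show "\<exists>i\<in>{..k}. D1 i \<omega> \<and> D2 i \<omega>"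
        using 2(3)[of i \<omega>] \<omega> i by (intro bexI[of _ i]) (auto split: if_splits)
    qed (use Seq.prems 1 2 in auto)
  next
    case (If b c d)
    show ?case
    proof (cases k)
      case 0
      then show ?thesis using If.prems unfolding mrun_def
        by (intro exI[of _ "\<lambda>_. False"] exI[of _ F]) (auto elim: IfE)
    next
      case (Suc j)
      obtain D1 F1 where 1: "Measurable.pred M D1" "mstate M V F1"
        "\<forall>\<omega>\<in>space M. if D1 \<omega> then exec G (h \<omega>) c (F \<omega>) j (F1 \<omega>) else \<not> (\<exists>s. exec G (h \<omega>) c (F \<omega>) j s)"
        by (rule mrunE[OF IHk[of j F c, OF _ If.prems]]) (use Suc in simp)
      obtain D2 F2 where 2: "Measurable.pred M D2" "mstate M V F2"
        "\<forall>\<omega>\<in>space M. if D2 \<omega> then exec G (h \<omega>) d (F \<omega>) j (F2 \<omega>) else \<not> (\<exists>s. exec G (h \<omega>) d (F \<omega>) j s)"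
        by (rule mrunE[OF IHk[of j F d, OF _ If.prems]]) (use Suc in simp)
      note [measurable] = measurable_beval[OF If.prems] 1(1) 2(1)
      show ?thesis
      proof (rule mrun_combine[where I = "UNIV :: bool set" and
            D = "\<lambda>i \<omega>. beval b (F \<omega>) = i \<and> (if i then D1 \<omega> else D2 \<omega>)" and F' = "\<lambda>i. if i then F1 else F2"])
        fix i \<omega> assume \<omega>: "\<omega> \<in> space M" and i: "beval b (F \<omega>) = i \<and> (if i then D1 \<omega> else D2 \<omega>)"
        show "exec G (h \<omega>) (If b c d) (F \<omega>) k ((if i then F1 else F2) \<omega>)"
          using exec.IfTrue[of b "F \<omega>" G "h \<omega>" c j "F1 \<omega>" d] exec.IfFalse[of b "F \<omega>" G "h \<omega>" d j "F2 \<omega>" c]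
            i 1(3) 2(3) \<omega> Suc by (auto split: if_splits)
      next
        fix \<omega> s assume \<omega>: "\<omega> \<in> space M" and "exec G (h \<omega>) (If b c d) (F \<omega>) k s"
        then show "\<exists>i\<in>UNIV. beval b (F \<omega>) = i \<and> (if i then D1 \<omega> else D2 \<omega>)"
          using 1(3) 2(3) Suc by (auto elim!: IfE split: if_splits)
      qed (use If.prems 1 2 in auto)
    qed
  next
    case (While b c)
    note [measurable] = measurable_beval[OF While.prems]
    show ?case
    proof (cases k)
      case 0
      then show ?thesis using While.prems unfolding mrun_def
        by (intro exI[of _ "\<lambda>_. False"] exI[of _ F]) (auto elim: WhileE)
    next
      case (Suc j)
      have "mrun c F i" if "i \<le> j" for i
        using that IHk[of i F c] While.prems Suc by auto
      then obtain D1 F1 where 1: "\<And>i. i \<le> j \<Longrightarrow> Measurable.pred M (D1 i)" "\<And>i. i \<le> j \<Longrightarrow> mstate M V (F1 i)"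
        "\<And>i \<omega>. i \<le> j \<Longrightarrow> \<omega> \<in> space M \<Longrightarrow>
          if D1 i \<omega> then exec G (h \<omega>) c (F \<omega>) i (F1 i \<omega>) else \<not> (\<exists>s. exec G (h \<omega>) c (F \<omega>) i s)"
        unfolding mrun_def by metis
      have "mrun (While b c) (F1 i) (j - i)" if "i \<le> j" for i
        using IHk[of "j - i" "F1 i" "While b c"] 1(2)[OF that] that Suc by auto
      then obtain D2 F2 where 2: "\<And>i. i \<le> j \<Longrightarrow> Measurable.pred M (D2 i)" "\<And>i. i \<le> j \<Longrightarrow> mstate M V (F2 i)"
        "\<And>i \<omega>. i \<le> j \<Longrightarrow> \<omega> \<in> space M \<Longrightarrow>
          if D2 i \<omega> then exec G (h \<omega>) (While b c) (F1 i \<omega>) (j - i) (F2 i \<omega>)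
          else \<not> (\<exists>s. exec G (h \<omega>) (While b c) (F1 i \<omega>) (j - i) s)"
        unfolding mrun_def by metis
      \<comment> \<open>\<open>None\<close> stands for leaving the loop at once,
        \<open>Some i\<close> for a first pass whose body takes \<open>i\<close> units.\<close>
      define D where "D i \<omega> \<longleftrightarrow> (case i of None \<Rightarrow> k = 1 \<and> \<not> beval b (F \<omega>)
         | Some i \<Rightarrow> beval b (F \<omega>) \<and> D1 i \<omega> \<and> D2 i \<omega>)" for i \<omega>
      define H where "H i = (case i of None \<Rightarrow> F | Some i \<Rightarrow> F2 i)" for i
      show ?thesis
      proof (rule mrun_combine[where I = "insert None (Some ` {..j})" and D = D and F' = H])
        fix i \<omega> assume "i \<in> insert None (Some ` {..j})" "\<omega> \<in> space M" "D i \<omega>"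
        then show "exec G (h \<omega>) (While b c) (F \<omega>) k (H i \<omega>)"
          using exec.WhileTrue[of b "F \<omega>" G "h \<omega>" c "the i" "F1 (the i) \<omega>" "j - the i" "F2 (the i) \<omega>"]
            exec.WhileFalse[of b "F \<omega>" G "h \<omega>" c] 1(3)[of "the i" \<omega>] 2(3)[of "the i" \<omega>] Suc
          by (auto simp: D_def H_def)
      next
        fix \<omega> s assume \<omega>: "\<omega> \<in> space M" and ex: "exec G (h \<omega>) (While b c) (F \<omega>) k s"
        show "\<exists>i\<in>insert None (Some ` {..j}). D i \<omega>"
        proof (cases "beval b (F \<omega>)")
          case False
          with ex show ?thesis by (auto simp: D_def elim: WhileE)
        next
          case True
          with ex obtain i s' l where i: "k = 1 + i + l" "exec G (h \<omega>) c (F \<omega>) i s'"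
              "exec G (h \<omega>) (While b c) s' l s"
            by (auto elim: WhileE)
          then have "D1 i \<omega>" using 1(3)[of i \<omega>] \<omega> Suc by (auto split: if_splits)
          moreover from this have "F1 i \<omega> = s'"
            using 1(3)[of i \<omega>] \<omega> i Suc by (auto dest: exec_deterministic)
          moreover have "l = j - i" "i \<le> j" using i Suc by auto
          ultimately have "D (Some i) \<omega>"
            using 2(3)[of i \<omega>] \<omega> i True by (auto split: if_splits simp: D_def)
          with \<open>i \<le> j\<close> show ?thesis by blast
        qed
      next
        show "\<And>i. i \<in> insert None (Some ` {..j}) \<Longrightarrow> Measurable.pred M (D i)"
          using measurable_beval[OF While.prems, of b] 1(1) 2(1)
          unfolding D_def by (auto intro!: pred_intros_logic)
      qed (use While.prems 1 2 in \<open>auto simp: H_def\<close>)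
    qed
  qed
qed

end

lemma measurable_hash:
  assumes "v \<in> set (vlist G)"
  shows "(\<lambda>\<omega>. fst \<omega> v) \<in> borel_measurable (rspace G)"
proof -
  have "(\<lambda>\<omega>. fst \<omega> v) \<in> measurable (rspace G) unif"
    unfolding rspace_def using assms by measurable
  then show ?thesis using measurable_cong_sets[OF refl sets_unif, of "rspace G"] by simp
qed

lemma halts_measurable:
  fixes G :: "'v hgraph"
  assumes "distinct (vlist G)"
  obtains D F where "\<And>k. Measurable.pred (rspace G) (D k)"
    "\<And>k. (\<lambda>\<omega>. out (F k \<omega>)) \<in> measurable (rspace G) (count_space (outputs (set (vlist G))))"
    "\<And>k \<omega>. \<omega> \<in> space (rspace G) \<Longrightarrow>
       if D k \<omega> then halts c G p t \<delta> \<omega> k (F k \<omega>) else \<not> (\<exists>s. halts c G p t \<delta> \<omega> k s)"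
proof -
  let ?M = "rspace G" and ?V = "set (vlist G)"
  have "(\<lambda>\<omega>. snd \<omega>) \<in> measurable ?M (stream_space unif)"
    unfolding rspace_def by measurable
  then have "mstate ?M ?V (\<lambda>\<omega>. init (nverts G) p t \<delta> (snd \<omega>))"
    by (auto simp: mstate_def init_def handles_def outputs_def)
  from mrun_exec[where h = fst, OF measurable_hash assms this, of c]
  have "mrun G ?M fst c (\<lambda>\<omega>. init (nverts G) p t \<delta> (snd \<omega>)) k" for k by simp
  note mr = this
  have "\<exists>D F. Measurable.pred ?M D \<and> mstate ?M ?V F \<and> (\<forall>\<omega>\<in>space ?M.
      if D \<omega> then halts c G p t \<delta> \<omega> k (F \<omega>) else \<not> (\<exists>s. halts c G p t \<delta> \<omega> k s))" for k
    unfolding halts_def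
    by (rule mrunE[where h = fst, OF measurable_hash mr[of k]], assumption) (intro exI conjI, assumption+)
  then obtain D F where *: "\<And>k. Measurable.pred ?M (D k)" "\<And>k. mstate ?M ?V (F k)"
     "\<And>k \<omega>. \<omega> \<in> space ?M \<Longrightarrow>
        if D k \<omega> then halts c G p t \<delta> \<omega> k (F k \<omega>) else \<not> (\<exists>s. halts c G p t \<delta> \<omega> k s)"
    by metis
  show ?thesis by (rule that[OF *(1) mstateD(4)[OF *(2)] *(3)])
qed

lemma runtime_measurable:
  assumes "distinct (vlist G)"
  shows "runtime c G p t \<delta> \<in> borel_measurable (rspace G)"
proof -
  obtain D F where D [measurable]: "\<And>k. Measurable.pred (rspace G) (D k)"
    and DF: "\<And>k \<omega>. \<omega> \<in> space (rspace G) \<Longrightarrow>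
       if D k \<omega> then halts c G p t \<delta> \<omega> k (F k \<omega>) else \<not> (\<exists>s. halts c G p t \<delta> \<omega> k s)"
    by (rule halts_measurable[OF assms, of c p t \<delta>]) blast
  \<comment> \<open>An infimum over a random index set becomes a countable infimum of measurable
    functions, with the value \<top> where no run of length \<open>k\<close> exists.\<close>
  have "runtime c G p t \<delta> \<omega> = (INF k. if D k \<omega> then of_nat k else \<top>)" if "\<omega> \<in> space (rspace G)" for \<omega>
  proof -
    have "{k. \<exists>s. halts c G p t \<delta> \<omega> k s} = {k. D k \<omega>}"
      using DF[OF that] by (auto split: if_splits) metis+
    moreover have "(INF k\<in>{k. D k \<omega>}. of_nat k) = (INF k. if D k \<omega> then of_nat k else \<top> :: ennreal)"
    proof (rule antisym)
      show "(INF k\<in>{k. D k \<omega>}. of_nat k) \<le> (INF k. if D k \<omega> then of_nat k else \<top> :: ennreal)"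
        by (rule INF_greatest) (simp add: INF_lower)
      show "(INF k. if D k \<omega> then of_nat k else \<top> :: ennreal) \<le> (INF k\<in>{k. D k \<omega>}. of_nat k)"
      proof (rule INF_greatest)
        fix k assume "k \<in> {k. D k \<omega>}"
        then show "(INF k. if D k \<omega> then of_nat k else \<top> :: ennreal) \<le> of_nat k"
          by (intro INF_lower2[of k]) auto
      qed
    qed
    ultimately show ?thesis unfolding runtime_def by simp
  qed
  moreover have "(\<lambda>\<omega>. INF k. if D k \<omega> then of_nat k else \<top> :: ennreal) \<in> borel_measurable (rspace G)"
    by measurable
  ultimately show ?thesis by (subst measurable_cong) auto
qed

lemma included_measurable:
  assumes "distinct (vlist G)"
  shows "included c G p t \<delta> e i \<in> sets (rspace G)"
proof -
  let ?M = "rspace G"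
  obtain D F where D [measurable]: "\<And>k. Measurable.pred (rspace G) (D k)"
    and F: "\<And>k. (\<lambda>\<omega>. out (F k \<omega>)) \<in> measurable ?M (count_space (outputs (set (vlist G))))"
    and DF: "\<And>k \<omega>. \<omega> \<in> space (rspace G) \<Longrightarrow>
       if D k \<omega> then halts c G p t \<delta> \<omega> k (F k \<omega>) else \<not> (\<exists>s. halts c G p t \<delta> \<omega> k s)"
    by (rule halts_measurable[OF assms, of c p t \<delta>]) blast
  have [measurable]: "Measurable.pred ?M (\<lambda>\<omega>. i < length (out (F k \<omega>)) \<and> e \<in> set (out (F k \<omega>) ! i))" for k
    by (rule measurable_compose[OF F]) simp
  have "(\<exists>Ts. returned c G p t \<delta> \<omega> = Some Ts \<and> i < length Ts \<and> e \<in> Ts ! i) \<longleftrightarrow>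
     (\<exists>k. D k \<omega> \<and> i < length (out (F k \<omega>)) \<and> e \<in> set (out (F k \<omega>) ! i))" (is "?L \<longleftrightarrow> ?R")
    if \<omega>: "\<omega> \<in> space ?M" for \<omega>
  proof
    assume ?L
    then obtain k s where ks: "halts c G p t \<delta> \<omega> k s" by (auto simp: returned_def split: if_splits)
    with DF[OF \<omega>, of k] have "D k \<omega>" "halts c G p t \<delta> \<omega> k (F k \<omega>)" by (auto split: if_splits)
    with \<open>?L\<close> returned_eq[OF this(2)] show ?R by auto
  next
    assume ?R
    then obtain k where k: "D k \<omega>" "i < length (out (F k \<omega>))" "e \<in> set (out (F k \<omega>) ! i)" by auto
    with DF[OF \<omega>, of k] have "halts c G p t \<delta> \<omega> k (F k \<omega>)" by simp
    from returned_eq[OF this] k show ?L by auto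
  qed
  then have "included c G p t \<delta> e i =
     {\<omega> \<in> space ?M. \<exists>k. D k \<omega> \<and> i < length (out (F k \<omega>)) \<and> e \<in> set (out (F k \<omega>) ! i)}"
    unfolding included_def by blast
  also have "\<dots> \<in> sets ?M" by measurable
  finally show ?thesis .
qed

subsection \<open>The sampling process as a function of the coins\<close>

text \<open>For \<open>p = 1\<close> the denominator is \<open>ln 0 = 0\<close>, and \<open>x / 0 = 0\<close> gives the correct value 0.\<close>

definition skip :: "real \<Rightarrow> real \<Rightarrow> nat" where
  "skip p u = nat \<lfloor>ln (1 - u) / ln (1 - p)\<rfloor>"

text \<open>The unread coins are returned as well, so that the next row starts on fresh ones. The
  recursion ends because the position strictly increases.\<close>

function row :: "real \<Rightarrow> nat \<Rightarrow> nat \<Rightarrow> real stream \<Rightarrow> nat list \<times> real stream" where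
  "row p N k r =
     (if k < N
      then (k # fst (row p N (k + 1 + skip p (shd r)) (stl r)), snd (row p N (k + 1 + skip p (shd r)) (stl r)))
      else ([], r))"
  by auto
termination by (relation "Wellfounded.measure (\<lambda>(p, N, k, r). N - k)") auto

declare row.simps [simp del]

lemma row_less:
  assumes "k < N"
  shows "fst (row p N k r) = k # fst (row p N (k + 1 + skip p (shd r)) (stl r))"
    "snd (row p N k r) = snd (row p N (k + 1 + skip p (shd r)) (stl r))"
  using assms row.simps[of p N k r] by auto

lemma row_ge: "N \<le> k \<Longrightarrow> row p N k r = ([], r)"
  by (subst row.simps) simp

text \<open>Multiplying the first uniform number by \<open>\<sigma> a\<close> conditions it on being
  below \<open>\<sigma> a\<close>. If this bound is at least the probability 1 - (1 - p) ^ N a that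
  the row is nonempty, no visit is lost and each visit probability is divided by
  \<open>\<sigma> a\<close>.\<close>

primrec visits :: "real \<Rightarrow> ('a \<Rightarrow> nat) \<Rightarrow> ('a \<Rightarrow> real) \<Rightarrow> 'a list \<Rightarrow> real stream \<Rightarrow> ('a \<times> nat) list" where
  "visits p N \<sigma> [] r = []"
| "visits p N \<sigma> (a # as) r =
     map (Pair a) (fst (row p (N a) (skip p (\<sigma> a * shd r)) (stl r))) @
     visits p N \<sigma> as (snd (row p (N a) (skip p (\<sigma> a * shd r)) (stl r)))"

definition adjoin :: "'a list \<Rightarrow> 'a \<Rightarrow> 'a list" where
  "adjoin xs x = (if x \<in> set xs then xs else xs @ [x])"

lemma set_adjoin_all: "set (foldl adjoin xs ys) = set xs \<union> set ys"
  by (induction ys arbitrary: xs) (auto simp: adjoin_def)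

lemma distinct_adjoin_all: "distinct xs \<Longrightarrow> distinct (foldl adjoin xs ys)"
  by (induction ys arbitrary: xs) (auto simp: adjoin_def)

lemma length_adjoin_all: "length (foldl adjoin xs ys) \<le> length xs + length ys"
  by (induction ys rule: rev_induct) (auto simp: adjoin_def)

text \<open>For the other inputs, p = 0 or fewer than two vertices, empty samples are correct and a
  separate branch of the program returns them. Here \<open>q\<close> and \<open>lg\<close> are
  positive.\<close>

locale sampler =
  fixes G :: "'v hgraph" and p :: real and t :: nat and \<delta> :: real
  assumes wf: "wf_hgraph G" and p: "0 < p" "p \<le> 1" and t: "1 \<le> t" and \<delta>: "0 < \<delta>" "\<delta> < 1"
    and two: "2 \<le> nverts G"
begin

abbreviation "V \<equiv> set (vlist G)"
abbreviation "n \<equiv> nverts G"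
abbreviation "deg v \<equiv> Defs.degree G v"

definition q :: real where "q = real t * p"
definition lg :: real where "lg = ln (real n / \<delta>)"
text \<open>The factor 2 compensates rounding: a vertex of degree d is granted n div d rounds, and
  (d / n) * (n div d) may drop to about 1/2.\<close>

definition K :: nat where "K = nat \<lfloor>2 * lg\<rfloor> + 1"
definition th :: nat where "th = nat \<lfloor>sqrt (lg / q)\<rfloor>"
text \<open>A heavy vertex has degree at least \<open>th + 1\<close>, so the rounds up to n div (th
  + 1) serve all of them.\<close>

definition J :: nat where "J = n div (th + 1)"
definition m :: nat where "m = K * J"

text \<open>
  There are \<open>J\<close> rounds of \<open>K\<close> probes. Round \<open>j\<close> (counted from 1) is responsible for the vertices of
  degree at most \<open>n / j\<close>.
\<close>

definition tau :: "nat \<Rightarrow> real" where "tau s = q * real n / (real (s div K) + 1)"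
definition probe :: "real \<Rightarrow> 'v" where "probe u = vlist G ! nat \<lfloor>u * real n\<rfloor>"

definition cand :: "('v \<Rightarrow> real) \<Rightarrow> real stream \<Rightarrow> nat \<Rightarrow> 'v list" where
  "cand h r s = filter (\<lambda>u. h u < tau s) (neighbors G h (probe (r !! s)))"

definition found :: "('v \<Rightarrow> real) \<Rightarrow> real stream \<Rightarrow> nat \<Rightarrow> 'v list" where
  "found h r s = foldl adjoin [] (concat (map (cand h r) [0..<s]))"

text \<open>The task \<open>Some v\<close> is the row of the heavy vertex \<open>v\<close>, the task \<open>None\<close> covers all light vertices.\<close>

definition \<sigma> :: "'v option \<Rightarrow> real" where
  "\<sigma> a = (case a of None \<Rightarrow> 1 | Some v \<Rightarrow> min 1 (q * real (deg v)))"

definition slots :: "'v option \<Rightarrow> nat" where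
  "slots a = (case a of None \<Rightarrow> t * (n * th) | Some v \<Rightarrow> t * deg v)"

definition selected :: "('v \<Rightarrow> real) \<Rightarrow> 'v \<Rightarrow> bool" where
  "selected h v \<longleftrightarrow> th < deg v \<and> h v < \<sigma> (Some v)"

definition tasks :: "('v \<Rightarrow> real) \<Rightarrow> 'v list \<Rightarrow> 'v option list" where
  "tasks h L = map Some (filter (selected h) L) @ [None]"

text \<open>Slot numbers are read in mixed radix: the quotient is the sample index, the remainder
  the place in the row. The light task reserves \<open>th\<close> places per vertex; places beyond
  the degree and places of heavy vertices are void and yield the empty set. A slot in range excludes
  division by zero, because \<open>slots\<close> is then positive.\<close>

definition emit :: "('v \<Rightarrow> real) \<Rightarrow> 'v option \<times> nat \<Rightarrow> (('v \<times> 'v) \<times> nat) set" where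
  "emit h x = (case x of
      (Some v, k) \<Rightarrow> {((v, neighbors G h v ! (k mod deg v)), k div deg v)}
    | (None, k) \<Rightarrow>
        (let y = k mod (n * th); v = vlist G ! (y div th)
         in if y mod th < deg v \<and> deg v \<le> th
            then {((v, neighbors G h v ! (y mod th)), k div (n * th))} else {}))"

lemma distinctV: "distinct (vlist G)"
  using wf by (simp add: wf_hgraph_def)

lemma length_vlist: "length (vlist G) = n"
  using distinctV by (simp add: nverts_def distinct_card)

lemma n_pos: "0 < n"
  using two by simp

lemma q_pos: "0 < q"
  using p t by (simp add: q_def)

lemma lg_ge: "ln 2 \<le> lg" "ln (real n) \<le> lg"
proof -
  have "2 \<le> real n" "real n \<le> real n / \<delta>"
    using two \<delta> by (auto simp: field_simps)
  then show "ln 2 \<le> lg" "ln (real n) \<le> lg"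
    by (auto simp: lg_def)
qed

lemma lg_pos: "0 < lg"
  using lg_ge(1) by (smt (verit) ln_gt_zero)

lemma K_pos: "0 < K"
  by (simp add: K_def)

lemma set_neighbors: "set (neighbors G h v) = {u \<in> V. {v, u} \<in> edges G}"
  by (auto simp: neighbors_def)

lemma distinct_neighbors: "distinct (neighbors G h v)"
  using distinctV by (simp add: neighbors_def)

lemma length_neighbors: "length (neighbors G h v) = deg v"
  using distinct_card[OF distinct_neighbors, of h v] by (simp add: set_neighbors Defs.degree_def)

lemma sorted_neighbors: "sorted (map h (neighbors G h v))"
  by (simp add: neighbors_def)

lemma deg_le: "deg v < n" if "v \<in> V"
proof -
  have "{u \<in> V. {v, u} \<in> edges G} \<subseteq> V - {v}"
    using wf by (auto simp: wf_hgraph_def doubleton_eq_iff)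
  then have "deg v \<le> card (V - {v})" unfolding Defs.degree_def by (intro card_mono) auto
  also have "\<dots> < n" using card_Diff1_less[OF finite_set that] by (simp only: nverts_def)
  finally show ?thesis .
qed

lemma probe_in: "probe u \<in> V" if "0 \<le> u" "u < 1"
proof -
  have "\<lfloor>u * real n\<rfloor> < int n"
    using that n_pos by (simp add: floor_less_iff)
  then show ?thesis using n_pos unfolding probe_def by (intro nth_mem) (simp add: length_vlist nat_less_iff)
qed

end

subsection \<open>Weakest preconditions with time\<close>

definition wpt ::
  "'v hgraph \<Rightarrow> ('v \<Rightarrow> real) \<Rightarrow> com \<Rightarrow> (nat \<Rightarrow> 'v state \<Rightarrow> bool) \<Rightarrow> 'v state \<Rightarrow> bool" where
  "wpt G h c Q s \<longleftrightarrow> (\<exists>k s'. exec G h c s k s' \<and> Q k s')"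

lemma wpt_atom: "wpt G h (Atom a) Q s \<longleftrightarrow> (case astep G h a s of None \<Rightarrow> False | Some s' \<Rightarrow> Q 1 s')"
  unfolding wpt_def
  by (auto elim!: AtomE split: option.splits) (metis One_nat_def exec.Atom)

lemma wpt_seq: "wpt G h (Seq c d) Q s \<longleftrightarrow> wpt G h c (\<lambda>k. wpt G h d (\<lambda>l. Q (k + l))) s"
  unfolding wpt_def by (blast elim: SeqE intro: exec.Seq)

lemma wpt_if:
  "wpt G h (If b c d) Q s \<longleftrightarrow>
     (if beval b s then wpt G h c (\<lambda>k. Q (1 + k)) s else wpt G h d (\<lambda>k. Q (1 + k)) s)"
  unfolding wpt_def by (auto elim!: IfE) (metis plus_1_eq_Suc exec.IfTrue exec.IfFalse)+

lemma wpt_mono: "wpt G h c Q s \<Longrightarrow> (\<And>k s'. Q k s' \<Longrightarrow> Q' k s') \<Longrightarrow> wpt G h c Q' s"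
  unfolding wpt_def by blast

text \<open>The potential \<open>\<Phi>\<close> of the ghost value \<open>g\<close> pays for the time and for termination.\<close>

lemma wpt_while:
  assumes I: "I g s"
    and step: "\<And>g s. I g s \<Longrightarrow> beval b s \<Longrightarrow>
      wpt G h c (\<lambda>k s'. \<exists>g'. I g' s' \<and> 1 + k + \<Phi> g' \<le> (\<Phi> g :: nat)) s"
    and post: "\<And>g' s' k. I g' s' \<Longrightarrow> \<not> beval b s' \<Longrightarrow> k \<le> \<Phi> g + 1 \<Longrightarrow> Q k s'"
  shows "wpt G h (While b c) Q s"
proof -
  have "\<exists>k s' g'. exec G h (While b c) s k s' \<and> I g' s' \<and> \<not> beval b s' \<and> k \<le> \<Phi> g + 1"
    using I
  proof (induction "\<Phi> g" arbitrary: g s rule: less_induct)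
    case less
    show ?case
    proof (cases "beval b s")
      case False
      then have "exec G h (While b c) s 1 s" by (rule exec.WhileFalse)
      with False less.prems show ?thesis by (metis le_add2)
    next
      case True
      then obtain k s1 g1 where 1: "exec G h c s k s1" "I g1 s1" "1 + k + \<Phi> g1 \<le> \<Phi> g"
        using step[OF less.prems True] unfolding wpt_def by blast
      then obtain l s2 g2 where 2: "exec G h (While b c) s1 l s2" "I g2 s2" "\<not> beval b s2" "l \<le> \<Phi> g1 + 1"
        using less.hyps[of g1 s1] by force
      have "exec G h (While b c) s (1 + k + l) s2"
        by (rule exec.WhileTrue[OF True 1(1) 2(1)])
      moreover have "1 + k + l \<le> \<Phi> g + 1" using 1(3) 2(4) by simp
      ultimately show ?thesis using 2 by blast
    qed
  qed
  then show ?thesis unfolding wpt_def using post by blast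
qed

lemmas wpt_simps = wpt_atom wpt_seq wpt_if

subsection \<open>The program\<close>

abbreviation (input) var :: "string \<Rightarrow> nexp" where "var x \<equiv> Cell x (Const 0)"
abbreviation (input) ref :: "string \<Rightarrow> cell" where "ref x \<equiv> (x, Const 0)"
abbreviation (input) sequence :: "com \<Rightarrow> com \<Rightarrow> com" (infixr ";;" 60) where "c ;; d \<equiv> Seq c d"
abbreviation (input) assign :: "string \<Rightarrow> nexp \<Rightarrow> com" (infix "::=" 62) where
  "x ::= e \<equiv> Atom (NSet (ref x) e)"
abbreviation (input) query :: "acom \<Rightarrow> com" ("\<langle>_\<rangle>") where "\<langle>a\<rangle> \<equiv> Atom a"

definition geo :: "nexp \<Rightarrow> nexp" where
  "geo e = Floor (Div (Ln (Sub (Const 1) e)) (Ln (Sub (Const 1) (var ''p''))))"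

text \<open>
  There is no command that does nothing; in the branches below, an assignment to a scratch cell
  plays its role.
\<close>

definition create_samples :: com where
  "create_samples =
     While (Less (var ''i'') (var ''t''))
       (\<langle>NewSample\<rangle> ;; ''i'' ::= Add (var ''i'') (Const 1))"

text \<open>The array \<open>seen\<close> is indexed by vertex identifiers, which makes the test for
  repetitions take constant time. A hash value that is too large ends the loop by setting the
  counter to the degree.\<close>

definition scan_body :: com where
  "scan_body =
     \<langle>QNeighbor (ref ''x'') (ref ''w'') (var ''i'')\<rangle> ;;
     \<langle>QHash (ref ''hx'') (ref ''x'')\<rangle> ;;
     If (Less (var ''hx'') (var ''tau''))
       (\<langle>QId (ref ''id'') (ref ''x'')\<rangle> ;;
        If (Less (Cell ''seen'' (var ''id'')) (Const 1))
          (\<langle>NSet (''seen'', var ''id'') (Const 1)\<rangle> ;;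
           \<langle>VSet (''L'', var ''c'') (ref ''x'')\<rangle> ;;
           ''c'' ::= Add (var ''c'') (Const 1))
          (''hx'' ::= Const 0) ;;
        ''i'' ::= Add (var ''i'') (Const 1))
       (''i'' ::= var ''d'')"

definition probe_body :: com where
  "probe_body =
     \<langle>Rand (ref ''u'')\<rangle> ;;
     \<langle>QVertex (ref ''w'') (Mul (var ''u'') (var ''n''))\<rangle> ;;
     \<langle>QDegree (ref ''d'') (ref ''w'')\<rangle> ;;
     ''tau'' ::= Div (Mul (var ''q'') (var ''n'')) (Add (Floor (Div (var ''s'') (var ''K''))) (Const 1)) ;;
     ''i'' ::= Const 0 ;;
     While (Less (var ''i'') (var ''d'')) scan_body ;;
     ''s'' ::= Add (var ''s'') (Const 1)"

definition draw_next :: com where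
  "draw_next =
     \<langle>Rand (ref ''u'')\<rangle> ;;
     ''pos'' ::= Add (Add (var ''pos'') (Const 1)) (geo (var ''u''))"

definition heavy_row :: com where
  "heavy_row =
     While (Less (var ''pos'') (Mul (var ''t'') (var ''d'')))
       (''i'' ::= Floor (Div (var ''pos'') (var ''d'')) ;;
        \<langle>QNeighbor (ref ''x'') (ref ''w'') (Sub (var ''pos'') (Mul (var ''i'') (var ''d'')))\<rangle> ;;
        \<langle>Emit (var ''i'') (ref ''w'') (ref ''x'')\<rangle> ;;
        draw_next)"

definition prepare_row :: com where
  "prepare_row =
     \<langle>VSet (ref ''w'') (''L'', var ''s'')\<rangle> ;;
     \<langle>QDegree (ref ''d'') (ref ''w'')\<rangle> ;;
     \<langle>QHash (ref ''hx'') (ref ''w'')\<rangle> ;;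
     ''sg'' ::= Mul (var ''q'') (var ''d'') ;;
     If (Less (Const 1) (var ''sg'')) (''sg'' ::= Const 1) (''i'' ::= Const 0)"

definition heavy_body :: com where
  "heavy_body =
     prepare_row ;;
     If (And (Less (var ''th'') (var ''d'')) (Less (var ''hx'') (var ''sg'')))
       (\<langle>Rand (ref ''u'')\<rangle> ;;
        ''pos'' ::= geo (Mul (var ''sg'') (var ''u'')) ;;
        heavy_row)
       (''i'' ::= Const 0) ;;
     ''s'' ::= Add (var ''s'') (Const 1)"

definition light_row :: com where
  "light_row =
     While (Less (var ''pos'') (Mul (var ''t'') (Mul (var ''n'') (var ''th''))))
       (''i'' ::= Floor (Div (var ''pos'') (Mul (var ''n'') (var ''th''))) ;;
        ''y'' ::= Sub (var ''pos'') (Mul (var ''i'') (Mul (var ''n'') (var ''th''))) ;;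
        ''z'' ::= Floor (Div (var ''y'') (var ''th'')) ;;
        \<langle>QVertex (ref ''w'') (var ''z'')\<rangle> ;;
        \<langle>QDegree (ref ''d'') (ref ''w'')\<rangle> ;;
        ''y'' ::= Sub (var ''y'') (Mul (var ''z'') (var ''th'')) ;;
        If (And (Less (var ''y'') (var ''d'')) (Not (Less (var ''th'') (var ''d''))))
          (\<langle>QNeighbor (ref ''x'') (ref ''w'') (var ''y'')\<rangle> ;;
           \<langle>Emit (var ''i'') (ref ''w'') (ref ''x'')\<rangle>)
          (''y'' ::= Const 0) ;;
        draw_next)"

definition parameters :: com where
  "parameters =
     ''q'' ::= Mul (var ''t'') (var ''p'') ;;
     ''lg'' ::= Ln (Div (var ''n'') (var ''delta'')) ;;
     ''K'' ::= Add (Floor (Mul (Const 2) (var ''lg''))) (Const 1) ;;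
     ''th'' ::= Floor (Sqrt (Div (var ''lg'') (var ''q''))) ;;
     ''M'' ::= Mul (var ''K'') (Floor (Div (var ''n'') (Add (var ''th'') (Const 1))))"

definition sampler_program :: com where
  "sampler_program =
     create_samples ;;
     If (And (Less (Const 1) (var ''n'')) (Less (Const 0) (var ''p'')))
       (parameters ;;
        While (Less (var ''s'') (var ''M'')) probe_body ;;
        ''s'' ::= Const 0 ;;
        While (Less (var ''s'') (var ''c'')) heavy_body ;;
        \<langle>Rand (ref ''u'')\<rangle> ;;
        ''pos'' ::= geo (var ''u'') ;;
        light_row)
       (''s'' ::= Const 0)"

section \<open>Total correctness and running time of the program\<close>

lemma index_real [simp]: "index (real k) = k" "index 0 = 0"
  by (auto simp: index_def)

definition recorded :: "'v state \<Rightarrow> (('v \<times> 'v) \<times> nat) set" where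
  "recorded s = {(e, i). i < length (out s) \<and> e \<in> set (out s ! i)}"

lemma recorded_update:
  assumes "i < length xs"
  shows "{(e, j). j < length (xs[i := x # xs ! i]) \<and> e \<in> set (xs[i := x # xs ! i] ! j)} =
    insert (x, i) {(e, j). j < length xs \<and> e \<in> set (xs ! j)}"
  using assms by (auto simp: nth_list_update split: if_splits)

lemma real_mod: "real a - real (a div b) * real b = real (a mod b)"
  by (metis add_diff_cancel_left' div_mult_mod_eq of_nat_add of_nat_mult)

lemma floor_real_div: "\<lfloor>real a / real b\<rfloor> = int (a div b)"
  by (metis floor_divide_of_nat_eq)

context sampler
begin

text \<open>Both logarithms are nonpositive, so the quotient is nonnegative and the truncation by
  \<open>nat\<close> in \<open>skip\<close> is harmless.\<close>

lemma geo_skip: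
  assumes "0 \<le> x" "x < 1"
  shows "real_of_int \<lfloor>ln (1 - x) / ln (1 - p)\<rfloor> = real (skip p x)"
proof -
  have "ln (1 - x) \<le> 0" using assms by simp
  moreover have "ln (1 - p) \<le> 0" using p by (cases "p = 1") auto
  ultimately have "0 \<le> \<lfloor>ln (1 - x) / ln (1 - p)\<rfloor>" by (simp add: divide_nonpos_nonpos)
  then show ?thesis by (simp add: skip_def)
qed

definition consts_ok :: "(string \<Rightarrow> nat \<Rightarrow> real) \<Rightarrow> bool" where
  "consts_ok F \<longleftrightarrow> F ''n'' 0 = real n \<and> F ''p'' 0 = p \<and> F ''t'' 0 = real t \<and> F ''q'' 0 = q \<and>
     F ''K'' 0 = real K \<and> F ''th'' 0 = real th \<and> F ''M'' 0 = real m"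

lemma consts_ok_upd [simp]:
  "x \<notin> {''n'', ''p'', ''t'', ''q'', ''K'', ''th'', ''M''} \<Longrightarrow> consts_ok (F(x := f)) \<longleftrightarrow> consts_ok F"
  by (auto simp: consts_ok_def)

lemma consts_okD [simp]:
  assumes "consts_ok F"
  shows "F ''n'' 0 = real n" "F ''p'' 0 = p" "F ''t'' 0 = real t" "F ''q'' 0 = q"
    "F ''K'' 0 = real K" "F ''th'' 0 = real th" "F ''M'' 0 = real m"
  using assms by (auto simp: consts_ok_def)

text \<open>The interval for the coins is half open: the value 1 would make the vertex index of a
  probe equal to n, which is out of range, and would lead to the logarithm of 0.\<close>

definition base :: "'v state \<Rightarrow> bool" where
  "base s \<longleftrightarrow> consts_ok (nums s) \<and> length (out s) = t \<and> sset (coins s) \<subseteq> {0..<1}"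

text \<open>Stated for the two memory functions instead of the state, so that updates of unrelated
  arrays simplify away. \<open>seen\<close> is constrained only at identifiers of vertices; by
  injectivity of \<open>vid\<close> these cells are distinct.\<close>

definition listing :: "'v list \<Rightarrow> (string \<Rightarrow> nat \<Rightarrow> real) \<Rightarrow> (string \<Rightarrow> nat \<Rightarrow> 'v option) \<Rightarrow> bool" where
  "listing L F W \<longleftrightarrow> F ''c'' 0 = real (length L) \<and> set L \<subseteq> V \<and>
     (\<forall>j<length L. W ''L'' j = Some (L ! j)) \<and>
     (\<forall>v\<in>V. F ''seen'' (vid G v) = (if v \<in> set L then 1 else 0))"

lemma listing_upd [simp]:
  "x \<notin> {''c'', ''seen''} \<Longrightarrow> listing L (F(x := f)) W \<longleftrightarrow> listing L F W"
  "x \<noteq> ''L'' \<Longrightarrow> listing L F (W(x := g)) \<longleftrightarrow> listing L F W"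
  by (auto simp: listing_def)

definition listed :: "'v list \<Rightarrow> 'v state \<Rightarrow> bool" where
  "listed L s \<longleftrightarrow> listing L (nums s) (vtxs s)"

lemma shd_coins: "sset r \<subseteq> {0..<1::real} \<Longrightarrow> 0 \<le> shd r \<and> shd r < 1 \<and> sset (stl r) \<subseteq> {0..<1}"
  by (cases r) auto

text \<open>This is what the hash order buys: the neighbours below a hash bound form a prefix of the
  list, so a single further read ends the scan.\<close>

lemma takeWhile_neighbors:
  "takeWhile (\<lambda>u. h u < c) (neighbors G h v) = filter (\<lambda>u. h u < c) (neighbors G h v)"
proof -
  have "takeWhile (\<lambda>u. h u < c) xs = filter (\<lambda>u. h u < c) xs" if "sorted (map h xs)" for xs
    using that
  proof (induction xs)
    case (Cons x xs)
    then have "filter (\<lambda>u. h u < c) xs = []" if "\<not> h x < c"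
      using that by (force simp: filter_empty_conv)
    with Cons show ?case by simp
  qed simp
  then show ?thesis using sorted_neighbors by blast
qed

lemma scan_spec:
  assumes "base s" "listed L s" and w: "vtxs s ''w'' 0 = Some w" "w \<in> V"
    and "nums s ''d'' 0 = real (deg w)" "nums s ''i'' 0 = 0"
    and c: "filter (\<lambda>u. h u < nums s ''tau'' 0) (neighbors G h w) = cs"
  shows "wpt G h (While (Less (var ''i'') (var ''d'')) scan_body)
    (\<lambda>k s'. k \<le> 10 * length cs + 11 \<and> base s' \<and> listed (foldl adjoin L cs) s' \<and>
       coins s' = coins s \<and> out s' = out s \<and> nums s' ''s'' 0 = nums s ''s'' 0) s"
proof -
  define nb where "nb = neighbors G h w"
  define tt where "tt = nums s ''tau'' 0"
  define d where "d = deg w"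
  define a where "a = length cs"
  have cs: "cs = takeWhile (\<lambda>u. h u < tt) nb"
    using c by (simp add: nb_def takeWhile_neighbors tt_def)
  have d: "d = length nb" by (simp add: d_def nb_def length_neighbors)
  have take: "take a nb = cs" "a \<le> d"
    by (auto simp: cs a_def d length_takeWhile_le takeWhile_eq_take[symmetric])
  have lt: "h (nb ! i) < tt \<longleftrightarrow> i < a" if "i \<le> a" "i < d" for i
  proof (cases "i < a")
    case True
    then have "nb ! i = cs ! i" using take by (metis nth_take)
    moreover have "cs ! i \<in> set cs" using True by (simp add: a_def)
    ultimately show ?thesis using True cs by (metis set_takeWhileD)
  next
    case False
    with that have "i = a" by simp
    then show ?thesis using that nth_length_takeWhile[of "\<lambda>u. h u < tt" nb] cs a_def d by auto
  qed
  have nbV: "nb ! i \<in> V" if "i < d" for i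
    using nth_mem[of i nb] that set_neighbors[of h w] by (auto simp: d nb_def)
  have vid: "vid G u = vid G v \<longleftrightarrow> u = v" if "u \<in> V" "v \<in> V" for u v
    using wf that by (auto simp: wf_hgraph_def inj_on_def)
  \<comment> \<open>The ghost value is the counter. It jumps to \<open>d\<close> at the first
    rejected neighbour, so a counter below \<open>d\<close> means that exactly \<open>g\<close>
    entries were adjoined, while otherwise all \<open>a\<close> accepted ones were.\<close>
  define I where "I g s' \<longleftrightarrow> base s' \<and> vtxs s' ''w'' 0 = Some w \<and> nums s' ''d'' 0 = real d \<and>
     nums s' ''tau'' 0 = tt \<and> nums s' ''i'' 0 = real g \<and>
     (\<exists>j. listed (foldl adjoin L (take j nb)) s' \<and> (if g < d then j = g \<and> g \<le> a else j = a)) \<and>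
     coins s' = coins s \<and> out s' = out s \<and> nums s' ''s'' 0 = nums s ''s'' 0" for g :: nat and s' :: "'v state"
  \<comment> \<open>An iteration that appends a new vertex takes 10 units including the test; the
    additional 10 pay for the one that rejects.\<close>
  define \<Phi> where "\<Phi> g = (if g < d then 10 * (a - g) + 10 else 0)" for g
  show ?thesis
  proof (rule wpt_while[where I = I and \<Phi> = \<Phi> and g = 0])
    show "I 0 s" using assms take unfolding I_def
      by (auto simp: tt_def d_def[symmetric] intro!: exI[of _ 0])
  next
    fix g s' assume I: "I g s'" and b: "beval (Less (var ''i'') (var ''d'')) s'"
    have g: "g < d" using I b by (auto simp: I_def)
    have ga: "g \<le> a" using I g by (auto simp: I_def)
    have L: "listed (foldl adjoin L (take g nb)) s'" using I g by (auto simp: I_def)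
    define L' where "L' = foldl adjoin L (take g nb)"
    have L1: "foldl adjoin L (take (Suc g) nb) = adjoin L' (nb ! g)"
      using g by (simp add: take_Suc_conv_app_nth d L'_def)
    have q: "nb = neighbors G h w" "d = deg w" by (simp_all add: nb_def d_def)
    show "wpt G h scan_body (\<lambda>k s''. \<exists>g'. I g' s'' \<and> 1 + k + \<Phi> g' \<le> \<Phi> g) s'"
    proof (cases "g < a")
      case True
      have hx: "h (nb ! g) < tt" using lt[of g] True g by simp
      have Sg: "Suc g \<le> a" "\<not> Suc g < d \<longrightarrow> Suc g = a" using True take(2) by auto
      have \<Phi>: "10 + \<Phi> (Suc g) \<le> \<Phi> g" using True g take(2) by (auto simp: \<Phi>_def)
      show ?thesis
      proof (cases "nb ! g \<in> set L'")
        case seen: True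
        have "nums s' ''seen'' (vid G (nb ! g)) = 1"
          using L seen nbV[OF g] by (auto simp: listed_def listing_def L'_def)
        then show ?thesis
          using I g hx \<Phi> L Sg L1 seen unfolding scan_body_def
          by (auto simp: wpt_simps I_def q[symmetric] base_def L'_def[symmetric] listed_def adjoin_def
              intro!: exI[of _ "Suc g"])
      next
        case new: False
        have "nums s' ''seen'' (vid G (nb ! g)) = 0"
          using L new nbV[OF g] by (auto simp: listed_def listing_def L'_def)
        then show ?thesis
          using I g hx \<Phi> L Sg L1 new nbV[OF g] unfolding scan_body_def
          by (auto simp: wpt_simps I_def q[symmetric] base_def L'_def[symmetric] listed_def listing_def adjoin_def
              vid nth_append less_Suc_eq intro!: exI[of _ "Suc g"])
      qed
    next
      case False
      then have ga: "g = a" using ga by simp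
      have hx: "\<not> h (nb ! g) < tt" using lt[of g] ga g by simp
      then show ?thesis
        using I g L ga unfolding scan_body_def
        by (auto simp: wpt_simps I_def q[symmetric] base_def \<Phi>_def listed_def
            intro!: exI[of _ d])
    qed
  next
    fix g' s' k assume I: "I g' s'" and b: "\<not> beval (Less (var ''i'') (var ''d'')) s'" and k: "k \<le> \<Phi> 0 + 1"
    have "\<not> g' < d" using I b by (auto simp: I_def)
    then show "k \<le> 10 * length cs + 11 \<and> base s' \<and> listed (foldl adjoin L cs) s' \<and>
       coins s' = coins s \<and> out s' = out s \<and> nums s' ''s'' 0 = nums s ''s'' 0"
      using I k take by (auto simp: I_def \<Phi>_def a_def split: if_splits)
  qed
qed

end

lemma sset_sdrop: "sset (sdrop k r) \<subseteq> sset r"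
  by (induction k arbitrary: r) (auto dest: stl_sset)

context sampler
begin

lemma found_Suc: "found h r (Suc g) = foldl adjoin (found h r g) (cand h r g)"
  by (simp add: found_def)

lemma probe_spec:
  assumes s: "base s" "listed [] s" "nums s ''s'' 0 = 0" "coins s = r"
  shows "wpt G h (While (Less (var ''s'') (var ''M'')) probe_body)
    (\<lambda>k s'. k \<le> (\<Sum>i<m. 10 * length (cand h r i) + 20) + 1 \<and> base s' \<and> listed (found h r m) s' \<and>
       coins s' = sdrop m r \<and> out s' = out s) s"
proof -
  have rs: "sset r \<subseteq> {0..<1}" using s(1,4) by (simp add: base_def)
  define I where "I g s' \<longleftrightarrow> g \<le> m \<and> base s' \<and> nums s' ''s'' 0 = real g \<and>
     listed (found h r g) s' \<and> coins s' = sdrop g r \<and> out s' = out s" for g :: nat and s' :: "'v state"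
  define \<Phi> where "\<Phi> g = (\<Sum>i\<in>{g..<m}. 10 * length (cand h r i) + 20)" for g
  show ?thesis
  proof (rule wpt_while[where I = I and \<Phi> = \<Phi> and g = 0])
    show "I 0 s" using s by (auto simp: I_def found_def)
  next
    fix g s' assume I: "I g s'" and b: "beval (Less (var ''s'') (var ''M'')) s'"
    have g: "g < m" using I b by (auto simp: I_def base_def)
    have \<Phi>: "\<Phi> g = 10 * length (cand h r g) + 20 + \<Phi> (Suc g)"
      unfolding \<Phi>_def using g by (simp add: sum.atLeast_Suc_lessThan)
    have u: "0 \<le> r !! g" "r !! g < 1"
      using subsetD[OF rs snth_sset[of r g]] by auto
    have w: "probe (r !! g) \<in> V" "index (r !! g * real n) < length (vlist G)"
      using probe_in[OF u] u n_pos
      by (auto simp: index_def length_vlist nat_less_iff floor_less_iff)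
    have fl: "\<lfloor>real g / real K\<rfloor> = int (g div K)" by (rule floor_real_div)
    have tl: "sdrop (Suc g) r = stl (sdrop g r)" by simp
    have ss: "sset (sdrop (Suc g) r) \<subseteq> {0..<1}" "sset (stl (sdrop g r)) \<subseteq> {0..<1}"
      using sset_sdrop[of "Suc g" r] rs unfolding tl by auto
    define s1 where "s1 = s'\<lparr>coins := sdrop (Suc g) r,
        vtxs := (vtxs s')(''w'' := (vtxs s' ''w'')(0 := Some (probe (r !! g)))),
        nums := (nums s')(''u'' := (nums s' ''u'')(0 := r !! g),
          ''d'' := (nums s' ''d'')(0 := real (deg (probe (r !! g)))),
          ''tau'' := (nums s' ''tau'')(0 := tau g), ''i'' := (nums s' ''i'')(0 := 0))\<rparr>"
    have s1: "base s1" "listed (found h r g) s1" "vtxs s1 ''w'' 0 = Some (probe (r !! g))"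
      "nums s1 ''d'' 0 = real (deg (probe (r !! g)))" "nums s1 ''i'' 0 = 0" "nums s1 ''tau'' 0 = tau g"
      "coins s1 = sdrop (Suc g) r" "out s1 = out s" "nums s1 ''s'' 0 = real g"
      using I ss by (auto simp: s1_def I_def base_def listed_def)
    have "wpt G h (While (Less (var ''i'') (var ''d'')) scan_body)
      (\<lambda>k s2. k \<le> 10 * length (cand h r g) + 11 \<and> base s2 \<and> listed (foldl adjoin (found h r g) (cand h r g)) s2 \<and>
         coins s2 = coins s1 \<and> out s2 = out s1 \<and> nums s2 ''s'' 0 = nums s1 ''s'' 0) s1"
      by (rule scan_spec) (use s1 w in \<open>auto simp: cand_def\<close>)
    then have "wpt G h (While (Less (var ''i'') (var ''d'')) scan_body)
      (\<lambda>k. wpt G h (Atom (NSet (ref ''s'') (Add (var ''s'') (Const 1))))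
         (\<lambda>l s''. \<exists>g'. I g' s'' \<and> 1 + Suc (Suc (Suc (Suc (Suc (k + l))))) + \<Phi> g' \<le> \<Phi> g)) s1"
    proof (rule wpt_mono)
      fix k s2
      assume a: "k \<le> 10 * length (cand h r g) + 11 \<and> base s2 \<and>
        listed (foldl adjoin (found h r g) (cand h r g)) s2 \<and>
        coins s2 = coins s1 \<and> out s2 = out s1 \<and> nums s2 ''s'' 0 = nums s1 ''s'' 0"
      then have "I (Suc g) (s2\<lparr>nums := (nums s2)(''s'' := (nums s2 ''s'')(0 := real g + 1))\<rparr>)"
        using s1(7-9) g by (auto simp: I_def found_Suc base_def listed_def)
      with a s1(9) \<Phi> show "wpt G h (Atom (NSet (ref ''s'') (Add (var ''s'') (Const 1))))
         (\<lambda>l s''. \<exists>g'. I g' s'' \<and> 1 + Suc (Suc (Suc (Suc (Suc (k + l))))) + \<Phi> g' \<le> \<Phi> g) s2"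
        by (auto simp: wpt_atom)
    qed
    moreover have "wpt G h probe_body Q s' \<longleftrightarrow>
       wpt G h (While (Less (var ''i'') (var ''d'')) scan_body)
         (\<lambda>k. wpt G h (Atom (NSet (ref ''s'') (Add (var ''s'') (Const 1)))) (\<lambda>l. Q (Suc (Suc (Suc (Suc (Suc (k + l)))))))) s1" for Q
      using I w(2) unfolding probe_body_def
      by (simp add: wpt_seq wpt_atom s1_def I_def base_def probe_def index_def fl tau_def add.assoc)
    ultimately show "wpt G h probe_body (\<lambda>k s''. \<exists>g'. I g' s'' \<and> 1 + k + \<Phi> g' \<le> \<Phi> g) s'"
      by simp
  next
    fix g' s' k assume "I g' s'" "\<not> beval (Less (var ''s'') (var ''M'')) s'" "k \<le> \<Phi> 0 + 1"
    moreover from this have "g' = m" by (auto simp: I_def base_def)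
    ultimately show "k \<le> (\<Sum>i<m. 10 * length (cand h r i) + 20) + 1 \<and> base s' \<and> listed (found h r m) s' \<and>
       coins s' = sdrop m r \<and> out s' = out s"
      by (auto simp: I_def \<Phi>_def atLeast0LessThan)
  qed
qed

lemma recorded_emit:
  assumes "i < length (out s)"
  shows "recorded (s\<lparr>out := (out s)[i := x # out s ! i]\<rparr>) = insert (x, i) (recorded s)"
  using recorded_update[OF assms] by (simp add: recorded_def)

lemma recorded_cong: "out s = out s' \<Longrightarrow> recorded s = recorded s'"
  by (simp add: recorded_def)

lemma heavy_row_spec:
  assumes s: "base s" "listed L s" "vtxs s ''w'' 0 = Some v" "nums s ''d'' 0 = real (deg v)"
    "nums s ''pos'' 0 = real k" "coins s = r"
  shows "wpt G h heavy_row
    (\<lambda>l s'. l \<le> 7 * length (fst (row p (t * deg v) k r)) + 1 \<and> base s' \<and> listed L s' \<and>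
       coins s' = snd (row p (t * deg v) k r) \<and> nums s' ''s'' 0 = nums s ''s'' 0 \<and>
       recorded s' = recorded s \<union> (\<Union>j\<in>set (fst (row p (t * deg v) k r)). emit h (Some v, j))) s"
proof -
  define N where "N = t * deg v"
  define R where "R = recorded s \<union> (\<Union>j\<in>set (fst (row p N k r)). emit h (Some v, j))"
  \<comment> \<open>The ghost value consists of the position and the unread coins. What is recorded
    together with what \<open>row\<close> would still emit from there never changes; when the loop
    ends, the second part is empty.\<close>
  define I where "I g s' \<longleftrightarrow> base s' \<and> listed L s' \<and> vtxs s' ''w'' 0 = Some v \<and>
     nums s' ''d'' 0 = real (deg v) \<and> nums s' ''pos'' 0 = real (fst g) \<and> coins s' = snd g \<and>
     nums s' ''s'' 0 = nums s ''s'' 0 \<and>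
     recorded s' \<union> (\<Union>j\<in>set (fst (row p N (fst g) (snd g))). emit h (Some v, j)) = R \<and>
     snd (row p N (fst g) (snd g)) = snd (row p N k r)" for g :: "nat \<times> real stream" and s' :: "'v state"
  define \<Phi> where "\<Phi> g = 7 * length (fst (row p N (fst g) (snd g)))" for g
  show ?thesis
    unfolding heavy_row_def N_def[symmetric]
  proof (rule wpt_while[where I = I and \<Phi> = \<Phi> and g = "(k, r)"])
    show "I (k, r) s" using s by (simp add: I_def R_def)
  next
    fix g s' assume I: "I g s'" and b: "beval (Less (var ''pos'') (Mul (var ''t'') (var ''d''))) s'"
    obtain k' r' where g: "g = (k', r')" by (cases g)
    have base: "consts_ok (nums s')" "length (out s') = t" "sset r' \<subseteq> {0..<1}"
      using I by (auto simp: I_def base_def g)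
    have "real k' < real t * real (deg v)" using I b base by (simp add: I_def g)
    then have k': "k' < N" by (metis N_def of_nat_less_iff of_nat_mult)
    then have d: "0 < deg v" by (cases "deg v") (auto simp: N_def)
    have i: "k' div deg v < t" using k' d by (simp add: N_def less_mult_imp_div_less)
    have md: "k' mod deg v < deg v" using d by simp
    have u: "0 \<le> shd r'" "shd r' < 1" "sset (stl r') \<subseteq> {0..<1}" using shd_coins[OF base(3)] by auto
    define k2 where "k2 = k' + 1 + skip p (shd r')"
    define x where "x = neighbors G h v ! (k' mod deg v)"
    define s1 where "s1 = s'\<lparr>vtxs := (vtxs s')(''x'' := (vtxs s' ''x'')(0 := Some x)),
       out := (out s')[k' div deg v := (v, x) # out s' ! (k' div deg v)], coins := stl r',
       nums := (nums s')(''i'' := (nums s' ''i'')(0 := real (k' div deg v)),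
          ''u'' := (nums s' ''u'')(0 := shd r'), ''pos'' := (nums s' ''pos'')(0 := real k2))\<rparr>"
    have "recorded s1 = insert ((v, x), k' div deg v) (recorded s')"
      using recorded_emit[of "k' div deg v" s' "(v, x)"] i base(2)
      by (simp add: s1_def recorded_def)
    moreover have "insert ((v, x), k' div deg v) A = emit h (Some v, k') \<union> A" for A
      by (simp add: emit_def x_def)
    ultimately have rec: "recorded s1 \<union> (\<Union>j\<in>set (fst (row p N k2 (stl r'))). emit h (Some v, j)) = R"
      using I row_less(1)[OF k', of p r'] by (auto simp: I_def g k2_def)
    have "I (k2, stl r') s1"
      using I base u rec row_less(2)[OF k', of p r'] unfolding I_def
      by (simp add: s1_def g base_def listed_def k2_def)
    moreover have "7 + \<Phi> (k2, stl r') \<le> \<Phi> g"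
      using row_less(1)[OF k', of p r'] by (simp add: \<Phi>_def g k2_def)
    moreover have "wpt G h
       (''i'' ::= Floor (Div (var ''pos'') (var ''d'')) ;;
        \<langle>QNeighbor (ref ''x'') (ref ''w'') (Sub (var ''pos'') (Mul (var ''i'') (var ''d'')))\<rangle> ;;
        \<langle>Emit (var ''i'') (ref ''w'') (ref ''x'')\<rangle> ;;
        draw_next) Q s' \<longleftrightarrow> Q 5 s1" for Q
    proof -
      have "real k2 = real k' + 1 + real (skip p (shd r'))" by (simp add: k2_def)
      then show ?thesis
      using I base i u md
      by (simp add: wpt_seq wpt_atom draw_next_def geo_def geo_skip floor_real_div real_mod I_def g
           s1_def x_def Let_def eval_nat_numeral)
    qed
    ultimately show "wpt G h
       (''i'' ::= Floor (Div (var ''pos'') (var ''d'')) ;;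
        \<langle>QNeighbor (ref ''x'') (ref ''w'') (Sub (var ''pos'') (Mul (var ''i'') (var ''d'')))\<rangle> ;;
        \<langle>Emit (var ''i'') (ref ''w'') (ref ''x'')\<rangle> ;;
        draw_next) (\<lambda>k s''. \<exists>g'. I g' s'' \<and> 1 + k + \<Phi> g' \<le> \<Phi> g) s'"
      by fastforce
  next
    fix g s' l assume I: "I g s'" and b: "\<not> beval (Less (var ''pos'') (Mul (var ''t'') (var ''d''))) s'"
      and l: "l \<le> \<Phi> (k, r) + 1"
    have "\<not> real (fst g) < real (t * deg v)" using I b by (simp add: I_def base_def)
    then have "N \<le> fst g" unfolding N_def by (simp only: of_nat_less_iff not_less)
    then have "row p N (fst g) (snd g) = ([], snd g)" by (rule row_ge)
    then show "l \<le> 7 * length (fst (row p N k r)) + 1 \<and> base s' \<and> listed L s' \<and>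
       coins s' = snd (row p N k r) \<and> nums s' ''s'' 0 = nums s ''s'' 0 \<and>
       recorded s' = recorded s \<union> (\<Union>j\<in>set (fst (row p N k r)). emit h (Some v, j))"
      using I l by (simp add: I_def \<Phi>_def R_def)
  qed
qed

lemma light_row_spec:
  assumes s: "base s" "nums s ''pos'' 0 = real k" "coins s = r"
  shows "wpt G h light_row
    (\<lambda>l s'. l \<le> 12 * length (fst (row p (t * (n * th)) k r)) + 1 \<and> length (out s') = t \<and>
       recorded s' = recorded s \<union> (\<Union>j\<in>set (fst (row p (t * (n * th)) k r)). emit h (None, j))) s"
proof -
  define N where "N = t * (n * th)"
  define R where "R = recorded s \<union> (\<Union>j\<in>set (fst (row p N k r)). emit h (None, j))"
  define I where "I g s' \<longleftrightarrow> base s' \<and> nums s' ''pos'' 0 = real (fst g) \<and> coins s' = snd g \<and>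
     recorded s' \<union> (\<Union>j\<in>set (fst (row p N (fst g) (snd g))). emit h (None, j)) = R"
    for g :: "nat \<times> real stream" and s' :: "'v state"
  define \<Phi> where "\<Phi> g = 12 * length (fst (row p N (fst g) (snd g)))" for g
  let ?body = "''i'' ::= Floor (Div (var ''pos'') (Mul (var ''n'') (var ''th''))) ;;
        ''y'' ::= Sub (var ''pos'') (Mul (var ''i'') (Mul (var ''n'') (var ''th''))) ;;
        ''z'' ::= Floor (Div (var ''y'') (var ''th'')) ;;
        \<langle>QVertex (ref ''w'') (var ''z'')\<rangle> ;;
        \<langle>QDegree (ref ''d'') (ref ''w'')\<rangle> ;;
        ''y'' ::= Sub (var ''y'') (Mul (var ''z'') (var ''th'')) ;;
        If (And (Less (var ''y'') (var ''d'')) (Not (Less (var ''th'') (var ''d''))))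
          (\<langle>QNeighbor (ref ''x'') (ref ''w'') (var ''y'')\<rangle> ;;
           \<langle>Emit (var ''i'') (ref ''w'') (ref ''x'')\<rangle>)
          (''y'' ::= Const 0) ;;
        draw_next"
  show ?thesis
    unfolding light_row_def N_def[symmetric]
  proof (rule wpt_while[where I = I and \<Phi> = \<Phi> and g = "(k, r)"])
    show "I (k, r) s" using s by (simp add: I_def R_def)
  next
    fix g s'
    assume I: "I g s'" and b: "beval (Less (var ''pos'') (Mul (var ''t'') (Mul (var ''n'') (var ''th'')))) s'"
    obtain k' r' where g: "g = (k', r')" by (cases g)
    have base: "consts_ok (nums s')" "length (out s') = t" "sset r' \<subseteq> {0..<1}"
      using I by (auto simp: I_def base_def g)
    have "real k' < real N" using I b base by (simp add: I_def g N_def)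
    then have k': "k' < N" by simp
    \<comment> \<open>A slot in range forces \<open>th\<close> to be positive, so the divisions
      below are genuine.\<close>
    then have pos: "0 < n * th" "0 < th" by (auto simp: N_def intro!: gr0I)
    define i where "i = k' div (n * th)"
    define y where "y = k' mod (n * th)"
    define z where "z = y div th"
    define j where "j = y mod th"
    define v where "v = vlist G ! z"
    have i: "i < t" using k' by (simp add: N_def i_def less_mult_imp_div_less)
    have y: "y < n * th" using pos by (simp add: y_def)
    have z: "z < length (vlist G)" using y by (simp add: z_def length_vlist less_mult_imp_div_less)
    have fl: "\<lfloor>real k' / (real n * real th)\<rfloor> = int i" "\<lfloor>real y / real th\<rfloor> = int z"
      using floor_real_div[of k' "n * th"] floor_real_div[of y th] by (simp_all add: i_def z_def)
    have md: "real k' - real i * (real n * real th) = real y" "real y - real z * real th = real j"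
      using real_mod[of k' "n * th"] real_mod[of y th] by (simp_all add: i_def y_def z_def j_def)
    have u: "0 \<le> shd r'" "shd r' < 1" "sset (stl r') \<subseteq> {0..<1}" using shd_coins[OF base(3)] by auto
    define k2 where "k2 = k' + 1 + skip p (shd r')"
    have k2: "real k2 = real k' + 1 + real (skip p (shd r'))" by (simp add: k2_def)
    have \<Phi>: "12 + \<Phi> (k2, stl r') \<le> \<Phi> g"
      using row_less(1)[OF k', of p r'] by (simp add: \<Phi>_def g k2_def)
    have em: "emit h (None, k') = (if j < deg v \<and> deg v \<le> th then {((v, neighbors G h v ! j), i)} else {})"
      by (simp add: emit_def Let_def v_def i_def y_def z_def j_def)
    have fin: "I (k2, stl r') s1" if "consts_ok (nums s1)" "length (out s1) = t" "coins s1 = stl r'"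
      "nums s1 ''pos'' 0 = real k2" "recorded s1 = emit h (None, k') \<union> recorded s'" for s1
      using that I u(3) row_less(1)[OF k', of p r'] by (auto simp: I_def g k2_def base_def)
    show "wpt G h ?body (\<lambda>k s''. \<exists>g'. I g' s'' \<and> 1 + k + \<Phi> g' \<le> \<Phi> g) s'"
    proof (cases "j < deg v \<and> deg v \<le> th")
      case True
      define s1 where "s1 = s'\<lparr>
         out := (out s')[i := (v, neighbors G h v ! j) # out s' ! i]\<rparr>"
      have rec: "recorded s1 = emit h (None, k') \<union> recorded s'"
        using recorded_emit[of i s' "(v, neighbors G h v ! j)"] i base(2) True
        by (simp add: s1_def em)
      have "wpt G h ?body (\<lambda>k s''. k \<le> 11 \<and> consts_ok (nums s'') \<and> length (out s'') = t \<and>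
         coins s'' = stl r' \<and> nums s'' ''pos'' 0 = real k2 \<and> out s'' = out s1) s'"
        using I base i u True z k2
        by (simp add: wpt_simps draw_next_def geo_def geo_skip fl md I_def g s1_def Let_def v_def[symmetric])
      then show ?thesis
      proof (rule wpt_mono)
        fix l :: nat and s'' :: "'v state"
        assume a: "l \<le> 11 \<and> consts_ok (nums s'') \<and> length (out s'') = t \<and>
           coins s'' = stl r' \<and> nums s'' ''pos'' 0 = real k2 \<and> out s'' = out s1"
        then have "recorded s'' = recorded s1" by (intro recorded_cong) simp
        with a rec have "I (k2, stl r') s''" by (intro fin) auto
        with a \<Phi> show "\<exists>g'. I g' s'' \<and> 1 + l + \<Phi> g' \<le> \<Phi> g"
          by (intro exI[of _ "(k2, stl r')"]) auto
      qed
    next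
      case False
      have "wpt G h ?body (\<lambda>k s''. k \<le> 11 \<and> consts_ok (nums s'') \<and> length (out s'') = t \<and>
         coins s'' = stl r' \<and> nums s'' ''pos'' 0 = real k2 \<and> out s'' = out s') s'"
        using I base i u False z k2
        by (auto simp: wpt_simps draw_next_def geo_def geo_skip fl md I_def g Let_def v_def[symmetric])
      then show ?thesis
      proof (rule wpt_mono)
        fix l :: nat and s'' :: "'v state"
        assume a: "l \<le> 11 \<and> consts_ok (nums s'') \<and> length (out s'') = t \<and>
           coins s'' = stl r' \<and> nums s'' ''pos'' 0 = real k2 \<and> out s'' = out s'"
        then have "recorded s'' = recorded s'" by (intro recorded_cong) simp
        with a em False have "I (k2, stl r') s''" by (intro fin) auto
        with a \<Phi> show "\<exists>g'. I g' s'' \<and> 1 + l + \<Phi> g' \<le> \<Phi> g"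
          by (intro exI[of _ "(k2, stl r')"]) auto
      qed
    qed
  next
    fix g s' l
    assume I: "I g s'" and b: "\<not> beval (Less (var ''pos'') (Mul (var ''t'') (Mul (var ''n'') (var ''th'')))) s'"
      and l: "l \<le> \<Phi> (k, r) + 1"
    have "\<not> real (fst g) < real N" using I b by (simp add: I_def base_def N_def)
    then have "row p N (fst g) (snd g) = ([], snd g)" by (intro row_ge) simp
    then show "l \<le> 12 * length (fst (row p N k r)) + 1 \<and> length (out s') = t \<and>
       recorded s' = recorded s \<union> (\<Union>j\<in>set (fst (row p N k r)). emit h (None, j))"
      using I l by (simp add: I_def \<Phi>_def R_def base_def)
  qed
qed

lemma prepare_row_spec:
  assumes "base s" "listed L s" "nums s ''s'' 0 = real g" "g < length L"
  shows "wpt G h prepare_row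
    (\<lambda>k s'. k = 6 \<and> base s' \<and> listed L s' \<and> vtxs s' ''w'' 0 = Some (L ! g) \<and>
       nums s' ''d'' 0 = real (deg (L ! g)) \<and> nums s' ''hx'' 0 = h (L ! g) \<and>
       nums s' ''sg'' 0 = \<sigma> (Some (L ! g)) \<and> nums s' ''s'' 0 = real g \<and> coins s' = coins s \<and>
       out s' = out s) s"
proof -
  have "vtxs s ''L'' g = Some (L ! g)"
    using assms by (auto simp: listed_def listing_def)
  then show ?thesis
    using assms unfolding prepare_row_def
    by (auto simp: wpt_simps base_def listed_def \<sigma>_def)
qed

definition emitted :: "('v \<Rightarrow> real) \<Rightarrow> ('v option \<times> nat) list \<Rightarrow> (('v \<times> 'v) \<times> nat) set" where
  "emitted h xs = (\<Union>x\<in>set xs. emit h x)"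

lemma emitted_append: "emitted h (xs @ ys) = emitted h xs \<union> emitted h ys"
  by (auto simp: emitted_def)

lemma emitted_map: "emitted h (map (Pair a) ks) = (\<Union>k\<in>set ks. emit h (a, k))"
  by (auto simp: emitted_def)

lemma \<sigma>_bounds: "selected h v \<Longrightarrow> 0 < \<sigma> (Some v)" "\<sigma> a \<le> 1"
  using q_pos by (auto simp: \<sigma>_def selected_def split: option.splits)

lemma tasks_Cons: "tasks h (v # L) = (if selected h v then Some v # tasks h L else tasks h L)"
  by (simp add: tasks_def)

text \<open>Since \<open>tasks\<close> always ends with \<open>None\<close>,
  \<open>vis (length L)\<close> is the light row that is still to be sampled. It stays in the
  postcondition because its outcome depends on the coins that the heavy rows have left.\<close>

lemma heavy_spec:
  fixes h :: "'v \<Rightarrow> real"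
  assumes s: "base s" "listed L s" "nums s ''s'' 0 = 0" "coins s = r"
  defines "vis \<equiv> \<lambda>j. visits p slots \<sigma> (tasks h (drop j L))"
  shows "wpt G h (While (Less (var ''s'') (var ''c'')) heavy_body)
    (\<lambda>k s'. k \<le> 7 * length (vis 0 r) + 20 * length L + 1 \<and> base s' \<and>
       length (vis (length L) (coins s')) \<le> length (vis 0 r) \<and>
       recorded s' \<union> emitted h (vis (length L) (coins s')) = recorded s \<union> emitted h (vis 0 r)) s"
proof -
  define R where "R = recorded s \<union> emitted h (vis 0 r)"
  define I where "I g s' \<longleftrightarrow> fst g \<le> length L \<and> base s' \<and> listed L s' \<and> nums s' ''s'' 0 = real (fst g) \<and>
     coins s' = snd g \<and> length (vis (fst g) (snd g)) \<le> length (vis 0 r) \<and>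
     recorded s' \<union> emitted h (vis (fst g) (snd g)) = R"
    for g :: "nat \<times> real stream" and s' :: "'v state"
  define \<Phi> where "\<Phi> g = 7 * length (vis (fst g) (snd g)) + 20 * (length L - fst g)" for g
  show ?thesis
  proof (rule wpt_while[where I = I and \<Phi> = \<Phi> and g = "(0, r)"])
    show "I (0, r) s" using s by (simp add: I_def R_def)
  next
    fix g s' assume I: "I g s'" and b: "beval (Less (var ''s'') (var ''c'')) s'"
    obtain j r' where g: "g = (j, r')" by (cases g)
    have j: "j < length L" using I b by (simp add: I_def g listed_def listing_def)
    define v where "v = L ! j"
    have dr: "drop j L = v # drop (Suc j) L" using j by (simp add: v_def Cons_nth_drop_Suc)
    define inc where "inc = ''s'' ::= Add (var ''s'') (Const 1)"
    define post where "post = (\<lambda>k s''. \<exists>g'. I g' s'' \<and> 1 + k + \<Phi> g' \<le> \<Phi> g)"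
    \<comment> \<open>Both branches end with this increment, so the obligations on the state before
      it are collected once; \<open>k\<close> is the time spent after the 6 units of
      \<open>prepare_row\<close>.\<close>
    have inc: "wpt G h inc (\<lambda>l. post (6 + (k + l))) s2"
      if "base s2" "listed L s2" "nums s2 ''s'' 0 = real j" "coins s2 = r2"
        "length (vis (Suc j) r2) \<le> length (vis j r')"
        "recorded s2 \<union> emitted h (vis (Suc j) r2) = recorded s' \<union> emitted h (vis j r')"
        "k + 7 * length (vis (Suc j) r2) \<le> 7 * length (vis j r') + 10" for s2 r2 k
    proof -
      have "I (Suc j, r2) (s2\<lparr>nums := (nums s2)(''s'' := (nums s2 ''s'')(0 := real j + 1))\<rparr>)"
        using that I j unfolding I_def g by (auto simp: base_def listed_def recorded_def)
      moreover have "7 + (k + 1) + \<Phi> (Suc j, r2) \<le> \<Phi> g"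
        using that(7) j by (simp add: \<Phi>_def g)
      ultimately show ?thesis
        using that(3) by (auto simp: inc_def wpt_atom post_def intro!: exI[of _ "Suc j"] exI[of _ r2])
    qed
    have "wpt G h prepare_row
      (\<lambda>k s1. k = 6 \<and> base s1 \<and> listed L s1 \<and> vtxs s1 ''w'' 0 = Some v \<and>
         nums s1 ''d'' 0 = real (deg v) \<and> nums s1 ''hx'' 0 = h v \<and>
         nums s1 ''sg'' 0 = \<sigma> (Some v) \<and> nums s1 ''s'' 0 = real j \<and> coins s1 = coins s' \<and> out s1 = out s') s'"
      unfolding v_def by (rule prepare_row_spec) (use I j in \<open>auto simp: I_def g\<close>)
    then have "wpt G h heavy_body post s'"
      unfolding heavy_body_def inc_def[symmetric] wpt_seq[of _ _ prepare_row]
    proof (rule wpt_mono, elim conjE)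
      fix k :: nat and s1 :: "'v state" assume k: "k = 6" and s1: "base s1" "listed L s1" "vtxs s1 ''w'' 0 = Some v"
         "nums s1 ''d'' 0 = real (deg v)" "nums s1 ''hx'' 0 = h v"
         "nums s1 ''sg'' 0 = \<sigma> (Some v)" "nums s1 ''s'' 0 = real j" "coins s1 = coins s'" "out s1 = out s'"
      have cr: "coins s1 = r'" "sset r' \<subseteq> {0..<1}" using I s1 by (auto simp: I_def g base_def)
      have co: "consts_ok (nums s1)" using s1 by (simp add: base_def)
      have rec1: "recorded s1 = recorded s'" using s1(9) by (rule recorded_cong)
      let ?b = "And (Less (var ''th'') (var ''d'')) (Less (var ''hx'') (var ''sg''))"
      have b: "beval ?b s1 \<longleftrightarrow> selected h v" using s1 co by (simp add: selected_def)
      show "wpt G h (If ?b (\<langle>Rand (ref ''u'')\<rangle> ;; ''pos'' ::= geo (Mul (var ''sg'') (var ''u'')) ;; heavy_row)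
          (''i'' ::= Const 0) ;; inc) (\<lambda>l. post (k + l)) s1"
      proof (cases "selected h v")
        case False
        let ?s2 = "s1\<lparr>nums := (nums s1)(''i'' := (nums s1 ''i'')(0 := 0))\<rparr>"
        have eq: "vis (Suc j) r' = vis j r'" using False by (simp add: vis_def dr tasks_Cons)
        have "wpt G h inc (\<lambda>l. post (6 + (2 + l))) ?s2"
          by (rule inc[where ?r2.0 = r']) (use s1 cr rec1 eq in \<open>auto simp: base_def listed_def recorded_def\<close>)
        then show ?thesis
          unfolding wpt_seq wpt_if b using False by (simp add: wpt_atom[of _ _ "NSet _ _"] k inc_def)
      next
        case True
        have u: "0 \<le> \<sigma> (Some v) * shd r'" "\<sigma> (Some v) * shd r' < 1" "sset (stl r') \<subseteq> {0..<1}"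
          using shd_coins[OF cr(2)] \<sigma>_bounds(1)[OF True] \<sigma>_bounds(2)[of "Some v"]
          by (auto intro: le_less_trans[OF mult_left_le_one_le])
        define k0 where "k0 = skip p (\<sigma> (Some v) * shd r')"
        define s2 where "s2 = s1\<lparr>coins := stl r', nums := (nums s1)(''u'' := (nums s1 ''u'')(0 := shd r'),
            ''pos'' := (nums s1 ''pos'')(0 := real k0))\<rparr>"
        define xs where "xs = fst (row p (t * deg v) k0 (stl r'))"
        define r2 where "r2 = snd (row p (t * deg v) k0 (stl r'))"
        have vis: "vis j r' = map (Pair (Some v)) xs @ vis (Suc j) r2"
          using True by (simp add: vis_def dr tasks_Cons slots_def xs_def r2_def k0_def)
        have s2: "base s2" "listed L s2" "vtxs s2 ''w'' 0 = Some v" "nums s2 ''d'' 0 = real (deg v)"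
          "nums s2 ''pos'' 0 = real k0" "coins s2 = stl r'" "nums s2 ''s'' 0 = real j"
          using s1 u by (auto simp: s2_def base_def listed_def)
        have rec2: "recorded s2 = recorded s'" using rec1 by (simp add: s2_def recorded_def)
        have "wpt G h heavy_row (\<lambda>l. wpt G h inc (\<lambda>l'. post (6 + ((3 + l) + l')))) s2"
        proof (rule wpt_mono[OF heavy_row_spec[OF s2(1-6)]], fold xs_def r2_def, elim conjE, rule inc)
          fix l :: nat and s3 :: "'v state" assume l: "l \<le> 7 * length xs + 1"
          then show "3 + l + 7 * length (vis (Suc j) r2) \<le> 7 * length (vis j r') + 10"
            by (simp add: vis)
        qed (auto simp: s2 vis emitted_append emitted_map rec2)
        moreover have "geo (Mul (var ''sg'') (var ''u'')) =
            Floor (Div (Ln (Sub (Const 1) (Mul (var ''sg'') (var ''u'')))) (Ln (Sub (Const 1) (var ''p''))))"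
          by (simp add: geo_def)
        ultimately show ?thesis
          unfolding wpt_seq wpt_if b using True s1 co cr u
          by (simp add: wpt_atom[of _ _ "Rand _"] wpt_atom[of _ _ "NSet (''pos'', _) _"] k
              s2_def k0_def geo_skip eval_nat_numeral)
      qed
    qed
    then show "wpt G h heavy_body (\<lambda>k s''. \<exists>g'. I g' s'' \<and> 1 + k + \<Phi> g' \<le> \<Phi> g) s'"
      by (simp add: post_def)
  next
    fix g s' k assume I: "I g s'" and b: "\<not> beval (Less (var ''s'') (var ''c'')) s'" and k: "k \<le> \<Phi> (0, r) + 1"
    have "fst g = length L" using I b by (simp add: I_def listed_def listing_def)
    then show "k \<le> 7 * length (vis 0 r) + 20 * length L + 1 \<and> base s' \<and>
       length (vis (length L) (coins s')) \<le> length (vis 0 r) \<and>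
       recorded s' \<union> emitted h (vis (length L) (coins s')) = recorded s \<union> emitted h (vis 0 r)"
      using I k by (simp add: I_def \<Phi>_def R_def)
  qed
qed

end

lemma create_samples_spec:
  fixes s :: "'a state"
  assumes "nums s ''i'' 0 = 0" "nums s ''t'' 0 = real t" "out s = []"
  shows "wpt G h create_samples (\<lambda>k s'. k \<le> 3 * t + 1 \<and> out s' = replicate t [] \<and> vtxs s' = vtxs s \<and>
    coins s' = coins s \<and> (\<forall>x. x \<noteq> ''i'' \<longrightarrow> nums s' x = nums s x)) s"
proof -
  define I where "I g s' \<longleftrightarrow> g \<le> t \<and> out s' = replicate g [] \<and> vtxs s' = vtxs s \<and> nums s' ''i'' 0 = real g \<and>
    coins s' = coins s \<and> (\<forall>x. x \<noteq> ''i'' \<longrightarrow> nums s' x = nums s x)" for g and s' :: "'a state"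
  show ?thesis
    unfolding create_samples_def
  proof (rule wpt_while[where I = I and \<Phi> = "\<lambda>g. 3 * (t - g)" and g = 0])
    show "I 0 s" using assms by (simp add: I_def)
  next
    fix g s' assume I: "I g s'" and b: "beval (Less (var ''i'') (var ''t'')) s'"
    have g: "g < t" using I b assms by (simp add: I_def)
    define s1 where "s1 = s'\<lparr>out := out s' @ [[]], nums := (nums s')(''i'' := (nums s' ''i'')(0 := real g + 1))\<rparr>"
    have I1: "I (Suc g) s1" using I g by (auto simp: I_def s1_def replicate_append_same[symmetric])
    have step: "wpt G h (\<langle>NewSample\<rangle> ;; ''i'' ::= Add (var ''i'') (Const 1)) Q s' \<longleftrightarrow> Q 2 s1" for Q
      using I by (simp add: wpt_simps s1_def I_def eval_nat_numeral)
    show "wpt G h (\<langle>NewSample\<rangle> ;; ''i'' ::= Add (var ''i'') (Const 1))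
        (\<lambda>k s''. \<exists>g'. I g' s'' \<and> 1 + k + 3 * (t - g') \<le> 3 * (t - g)) s'"
      unfolding step using g I1 by (intro exI[of _ "Suc g"]) simp
  next
    fix g' s' k
    assume I: "I g' s'" and b: "\<not> beval (Less (var ''i'') (var ''t'')) s'" and k: "k \<le> 3 * (t - 0) + 1"
    have "g' = t" using I b assms by (auto simp: I_def)
    then show "k \<le> 3 * t + 1 \<and> out s' = replicate t [] \<and> vtxs s' = vtxs s \<and>
      coins s' = coins s \<and> (\<forall>x. x \<noteq> ''i'' \<longrightarrow> nums s' x = nums s x)"
      using I k by (auto simp: I_def)
  qed
qed

lemma trivial_program_spec:
  assumes "\<not> (1 < real n \<and> 0 < p)"
  shows "wpt G h sampler_program (\<lambda>k s'. k \<le> 3 * t + 3 \<and> out s' = replicate t []) (init n p t \<delta> r)"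
  unfolding sampler_program_def wpt_seq[of _ _ create_samples]
proof (rule wpt_mono[OF create_samples_spec[where t = t]], goal_cases)
  case (4 k s')
  then have "nums s' ''n'' 0 = real n" "nums s' ''p'' 0 = p" by (auto simp: init_def)
  then have b: "\<not> beval (And (Less (Const 1) (var ''n'')) (Less (Const 0) (var ''p''))) s'"
    using assms by simp
  show ?case
    unfolding wpt_if using 4 b by (simp only: if_False) (simp add: wpt_atom)
qed (simp_all add: init_def)

context sampler
begin

lemma parameters_spec:
  assumes "nums s ''n'' 0 = real n" "nums s ''p'' 0 = p" "nums s ''t'' 0 = real t" "nums s ''delta'' 0 = \<delta>"
  shows "wpt G h parameters (\<lambda>k s'. k = 5 \<and> consts_ok (nums s') \<and> out s' = out s \<and> coins s' = coins s \<and>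
    vtxs s' = vtxs s \<and> (\<forall>x\<in>{''s'', ''c'', ''seen''}. nums s' x = nums s x)) s"
proof -
  have K: "real_of_int \<lfloor>2 * lg\<rfloor> + 1 = real K"
    using lg_pos by (simp add: K_def)
  have th: "real_of_int \<lfloor>sqrt (lg / q)\<rfloor> = real th"
    using lg_pos q_pos by (simp add: th_def)
  have J: "\<lfloor>real n / (real th + 1)\<rfloor> = int J"
    using floor_real_div[of n "th + 1"] by (simp add: J_def add.commute)
  show ?thesis
    using assms unfolding parameters_def
    by (simp add: wpt_simps consts_ok_def q_def[symmetric] lg_def[symmetric] K th J m_def del: consts_okD)
qed

text \<open>The heavy loop is charged 7 units for each element of \<open>vis\<close>, the light loop
  12 for each light visit, and the light visits are at most as many as all of \<open>vis\<close>; 20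
  covers the sum.\<close>

lemma program_spec:
  fixes h :: "'v \<Rightarrow> real"
  assumes r: "sset r \<subseteq> {0..<1}"
  defines "vis \<equiv> visits p slots \<sigma> (tasks h (found h r m)) (sdrop m r)"
  shows "wpt G h sampler_program
    (\<lambda>k s'. k \<le> 3 * t + 20 + (\<Sum>i<m. 10 * length (cand h r i) + 20) + 20 * length (found h r m) + 20 * length vis \<and>
       length (out s') = t \<and> recorded s' = emitted h vis) (init n p t \<delta> r)"
  unfolding sampler_program_def wpt_seq[of _ _ create_samples]
proof (rule wpt_mono[OF create_samples_spec[where t = t]], goal_cases)
  case (4 k1 s1)
  define L where "L = found h r m"
  define r1 where "r1 = sdrop m r"
  have s1: "nums s1 ''n'' 0 = real n" "nums s1 ''p'' 0 = p" "nums s1 ''t'' 0 = real t" "nums s1 ''delta'' 0 = \<delta>"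
    "nums s1 ''s'' = (\<lambda>_. 0)" "nums s1 ''c'' = (\<lambda>_. 0)" "nums s1 ''seen'' = (\<lambda>_. 0)"
    "vtxs s1 = (\<lambda>_ _. None)" "coins s1 = r" "out s1 = replicate t []" "k1 \<le> 3 * t + 1"
    using 4 by (auto simp: init_def)
  have b: "beval (And (Less (Const 1) (var ''n'')) (Less (Const 0) (var ''p''))) s1"
    using s1 two p by simp
  show ?case
    unfolding wpt_if wpt_seq[of _ _ parameters] using b
  proof (simp only: if_True, intro wpt_mono[OF parameters_spec[OF s1(1-4)]], elim conjE)
    fix k2 :: nat and s2 :: "'v state"
    assume k2: "k2 = 5" and s2: "consts_ok (nums s2)" "out s2 = out s1" "coins s2 = coins s1" "vtxs s2 = vtxs s1"
      "\<forall>x\<in>{''s'', ''c'', ''seen''}. nums s2 x = nums s1 x"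
    have base: "base s2" "listed [] s2" "nums s2 ''s'' 0 = 0" "coins s2 = r"
      using s1 s2 r by (auto simp: base_def listed_def listing_def)
    show "wpt G h (While (Less (var ''s'') (var ''M'')) probe_body ;; ''s'' ::= Const 0 ;;
        While (Less (var ''s'') (var ''c'')) heavy_body ;; \<langle>Rand (ref ''u'')\<rangle> ;;
        ''pos'' ::= geo (var ''u'') ;; light_row)
       (\<lambda>l s'. k1 + (1 + (k2 + l)) \<le> 3 * t + 20 + (\<Sum>i<m. 10 * length (cand h r i) + 20) +
            20 * length (found h r m) + 20 * length vis \<and>
          length (out s') = t \<and> recorded s' = emitted h vis) s2"
      unfolding wpt_seq[of _ _ "While _ probe_body"]
    proof (rule wpt_mono[OF probe_spec[OF base, of h]], elim conjE)
      fix k3 :: nat and s3 :: "'v state"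
      assume k3: "k3 \<le> (\<Sum>i<m. 10 * length (cand h r i) + 20) + 1" and
        s3: "base s3" "listed (found h r m) s3" "coins s3 = sdrop m r" "out s3 = out s2"
      define s4 where "s4 = s3\<lparr>nums := (nums s3)(''s'' := (nums s3 ''s'')(0 := 0))\<rparr>"
      have s4: "base s4" "listed L s4" "nums s4 ''s'' 0 = 0" "coins s4 = r1" "out s4 = replicate t []"
        using s3 s2 s1 by (auto simp: s4_def base_def listed_def L_def r1_def)
      have rec4: "recorded s4 = {}" using s4(5) by (simp add: recorded_def)
      define post where "post k s' \<longleftrightarrow> k1 + (1 + (k2 + k)) \<le> 3 * t + 20 + (\<Sum>i<m. 10 * length (cand h r i) + 20) +
            20 * length L + 20 * length vis \<and>
          length (out s') = t \<and> recorded s' = emitted h vis" for k s'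
      have vis: "vis = visits p slots \<sigma> (tasks h (drop 0 L)) r1" by (simp add: vis_def L_def r1_def)
      have "wpt G h (While (Less (var ''s'') (var ''c'')) heavy_body)
         (\<lambda>k4. wpt G h (\<langle>Rand (ref ''u'')\<rangle> ;; ''pos'' ::= geo (var ''u'') ;; light_row)
            (\<lambda>k5. post (k3 + (1 + (k4 + k5))))) s4"
      proof (rule wpt_mono[OF heavy_spec[OF s4(1-4), of h]], fold vis, elim conjE)
        fix k4 :: nat and s5 :: "'v state"
        define v5 where "v5 = visits p slots \<sigma> (tasks h (drop (length L) L)) (coins s5)"
        assume k4: "k4 \<le> 7 * length vis + 20 * length L + 1" and s5: "base s5"
          and v: "length (visits p slots \<sigma> (tasks h (drop (length L) L)) (coins s5)) \<le> length vis"
          "recorded s5 \<union> emitted h (visits p slots \<sigma> (tasks h (drop (length L) L)) (coins s5)) =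
            recorded s4 \<union> emitted h vis"
        define r5 where "r5 = coins s5"
        define xs where "xs = fst (row p (t * (n * th)) (skip p (shd r5)) (stl r5))"
        have v5: "v5 = map (Pair None) xs"
          by (simp add: v5_def tasks_def slots_def \<sigma>_def xs_def r5_def)
        have u: "0 \<le> shd r5" "shd r5 < 1" "sset (stl r5) \<subseteq> {0..<1}"
          using s5 shd_coins[of r5] by (auto simp: base_def r5_def)
        define s6 where "s6 = s5\<lparr>coins := stl r5, nums := (nums s5)(''u'' := (nums s5 ''u'')(0 := shd r5),
            ''pos'' := (nums s5 ''pos'')(0 := real (skip p (shd r5))))\<rparr>"
        have s6: "base s6" "nums s6 ''pos'' 0 = real (skip p (shd r5))" "coins s6 = stl r5"
          using s5 u by (auto simp: s6_def base_def)
        have rec6: "recorded s6 = recorded s5" by (simp add: s6_def recorded_def)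
        have "wpt G h light_row (\<lambda>k5. post (k3 + (1 + (k4 + (2 + k5))))) s6"
        proof (rule wpt_mono[OF light_row_spec[OF s6, of h]], fold xs_def, elim conjE)
          fix k5 :: nat and s7 :: "'v state"
          assume k5: "k5 \<le> 12 * length xs + 1" and s7: "length (out s7) = t"
            "recorded s7 = recorded s6 \<union> (\<Union>j\<in>set xs. emit h (None, j))"
          have "recorded s7 = emitted h vis"
            using s7(2) v(2)[folded v5_def] rec6 rec4 by (simp add: v5 emitted_map)
          moreover have "length xs \<le> length vis" using v(1)[folded v5_def] by (simp add: v5)
          ultimately show "post (k3 + (1 + (k4 + (2 + k5)))) s7"
            using k2 k3 k4 k5 s7 s1(11) by (simp add: post_def)
        qed
        moreover have "geo (var ''u'') =
            Floor (Div (Ln (Sub (Const 1) (var ''u''))) (Ln (Sub (Const 1) (var ''p''))))"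
          by (simp add: geo_def)
        ultimately show "wpt G h (\<langle>Rand (ref ''u'')\<rangle> ;; ''pos'' ::= geo (var ''u'') ;; light_row)
            (\<lambda>k5. post (k3 + (1 + (k4 + k5)))) s5"
          using s5 u
          by (simp add: wpt_seq wpt_atom[of _ _ "Rand _"] wpt_atom[of _ _ "NSet (''pos'', _) _"]
              s6_def r5_def[symmetric] base_def geo_skip)
      qed
      note heavy = this
      have post: "(\<lambda>l s'. k1 + (1 + (k2 + (k3 + l))) \<le> 3 * t + 20 + (\<Sum>i<m. 10 * length (cand h r i) + 20) +
            20 * length (found h r m) + 20 * length vis \<and>
          length (out s') = t \<and> recorded s' = emitted h vis) = (\<lambda>l. post (k3 + l))"
        by (simp add: post_def L_def fun_eq_iff)
      show "wpt G h (''s'' ::= Const 0 ;;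
        While (Less (var ''s'') (var ''c'')) heavy_body ;; \<langle>Rand (ref ''u'')\<rangle> ;;
        ''pos'' ::= geo (var ''u'') ;; light_row)
       (\<lambda>l s'. k1 + (1 + (k2 + (k3 + l))) \<le> 3 * t + 20 + (\<Sum>i<m. 10 * length (cand h r i) + 20) +
            20 * length (found h r m) + 20 * length vis \<and>
          length (out s') = t \<and> recorded s' = emitted h vis) s3"
        unfolding post wpt_seq[of _ _ "''s'' ::= _"] wpt_seq[of _ _ "While _ heavy_body"]
        using heavy by (simp add: wpt_atom[of _ _ "NSet (''s'', _) _"] s4_def[symmetric])
    qed
  qed
qed (simp_all add: init_def)

end

subsection \<open>The uniform distribution\<close>

interpretation U: prob_space unif
  by (rule prob_space_unif)

interpretation S: prob_space "stream_space unif"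
  by (rule U.prob_space_stream_space)

lemma space_coins [simp]: "space (stream_space unif) = UNIV"
  by (simp add: space_stream_space)

lemma emeasure_unif_interval:
  assumes "0 \<le> a" "a \<le> b" "b \<le> 1"
  shows "emeasure unif {a..<b} = ennreal (b - a)"
proof -
  have "{0..1} \<inter> {a..<b} = {a..<b}" using assms by auto
  then show ?thesis unfolding unif_def using assms by (simp add: divide_ennreal_def)
qed

lemma AE_unif: "AE u in unif. 0 \<le> u \<and> u < 1"
proof -
  have "emeasure unif {0..<1} = 1" using emeasure_unif_interval[of 0 1] by simp
  then have "AE u in unif. u \<in> {0..<1}" by (subst U.AE_in_set_eq_1) (auto simp: U.emeasure_eq_measure)
  then show ?thesis by simp
qed

lemma emeasure_unif_less:
  assumes "0 \<le> c" "c \<le> 1"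
  shows "emeasure unif {u. u < c} = ennreal c"
proof -
  have "emeasure unif {u. u < c} = emeasure unif {0..<c}"
    by (rule emeasure_eq_AE) (use AE_unif in \<open>auto elim: eventually_mono\<close>)
  then show ?thesis using emeasure_unif_interval[of 0 c] assms by simp
qed

text \<open>Inversion of the geometric distribution function. For p = 1 both sides say that k is
  positive, because 0 ^ 0 = 1.\<close>

lemma skip_less_iff:
  assumes p: "0 < p" "p \<le> 1" and x: "0 \<le> x" "x < 1"
  shows "skip p x < k \<longleftrightarrow> x < 1 - (1 - p) ^ k"
proof (cases "p = 1")
  case True
  then show ?thesis using x by (cases k) (auto simp: skip_def)
next
  case False
  then have l: "ln (1 - p) < 0" using p by simp
  have "skip p x < k \<longleftrightarrow> ln (1 - x) / ln (1 - p) < real k"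
  proof -
    have "0 \<le> ln (1 - x) / ln (1 - p)" using l x by (simp add: divide_nonpos_nonpos)
    then have "skip p x < k \<longleftrightarrow> \<lfloor>ln (1 - x) / ln (1 - p)\<rfloor> < int k"
      unfolding skip_def by (intro nat_less_iff) simp
    then show ?thesis by (simp add: floor_less_iff)
  qed
  also have "\<dots> \<longleftrightarrow> real k * ln (1 - p) < ln (1 - x)"
    using l by (simp add: divide_less_eq)
  also have "\<dots> \<longleftrightarrow> ln ((1 - p) ^ k) < ln (1 - x)"
    using p False by (simp add: ln_realpow)
  also have "\<dots> \<longleftrightarrow> (1 - p) ^ k < 1 - x"
    using p False x by (subst ln_less_cancel_iff) auto
  also have "\<dots> \<longleftrightarrow> x < 1 - (1 - p) ^ k" by linarith
  finally show ?thesis .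
qed

lemma measurable_skip [measurable]: "skip p \<in> measurable borel (count_space UNIV)"
  unfolding skip_def[abs_def] by measurable

lemma measurable_skip_shd [measurable]:
  "(\<lambda>r. skip p (c * shd r)) \<in> measurable (stream_space unif) (count_space UNIV)"
proof -
  have "(\<lambda>u. skip p (c * u)) \<in> measurable unif (count_space UNIV)" by measurable
  then show ?thesis by (rule measurable_compose[OF measurable_shd])
qed

text \<open>The scaled number is below the threshold exactly if the unscaled one is below the
  threshold divided by \<sigma>. The last hypothesis keeps this quotient in the unit interval, where
  its measure is its value.\<close>

lemma emeasure_skip_less:
  assumes p: "0 < p" "p \<le> 1" and s: "0 < \<sigma>" "\<sigma> \<le> 1" "1 - (1 - p) ^ k \<le> \<sigma>"
  shows "emeasure unif {u. skip p (\<sigma> * u) < k} = ennreal ((1 - (1 - p) ^ k) / \<sigma>)"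
proof -
  have "0 \<le> (1 - (1 - p) ^ k) / \<sigma>" "(1 - (1 - p) ^ k) / \<sigma> \<le> 1"
    using p s by (auto simp: power_le_one)
  note * = emeasure_unif_less[OF this]
  have "AE u in unif. u \<in> {u. skip p (\<sigma> * u) < k} \<longleftrightarrow> u \<in> {u. u < (1 - (1 - p) ^ k) / \<sigma>}"
    using AE_unif
  proof (rule eventually_mono)
    fix u :: real assume u: "0 \<le> u \<and> u < 1"
    then have "0 \<le> \<sigma> * u" "\<sigma> * u < 1"
      using s by (auto intro: le_less_trans[OF mult_left_le_one_le])
    then have "skip p (\<sigma> * u) < k \<longleftrightarrow> \<sigma> * u < 1 - (1 - p) ^ k" by (rule skip_less_iff[OF p])
    then show "u \<in> {u. skip p (\<sigma> * u) < k} \<longleftrightarrow> u \<in> {u. u < (1 - (1 - p) ^ k) / \<sigma>}"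
      using s by (simp add: field_simps)
  qed
  then have "emeasure unif {u. skip p (\<sigma> * u) < k} = emeasure unif {u. u < (1 - (1 - p) ^ k) / \<sigma>}"
    by (rule emeasure_eq_AE) auto
  then show ?thesis using * by simp
qed

lemma emeasure_skip_eq:
  assumes p: "0 < p" "p \<le> 1" and s: "0 < \<sigma>" "\<sigma> \<le> 1" "1 - (1 - p) ^ (k + 1) \<le> \<sigma>"
  shows "emeasure unif {u. skip p (\<sigma> * u) = k} = ennreal (p * (1 - p) ^ k / \<sigma>)"
proof -
  have le: "(1 - p) ^ (k + 1) \<le> (1 - p) ^ k" using p by (intro power_decreasing) auto
  have "{u. skip p (\<sigma> * u) = k} = {u. skip p (\<sigma> * u) < k + 1} - {u. skip p (\<sigma> * u) < k}" by auto
  also have "emeasure unif \<dots> = ennreal ((1 - (1 - p) ^ (k + 1)) / \<sigma>) - ennreal ((1 - (1 - p) ^ k) / \<sigma>)"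
    by (subst emeasure_Diff) (use le p s in \<open>auto simp: emeasure_skip_less\<close>)
  also have "\<dots> = ennreal ((1 - (1 - p) ^ (k + 1)) / \<sigma> - (1 - (1 - p) ^ k) / \<sigma>)"
    using p s by (intro ennreal_minus) (auto simp: power_le_one)
  also have "(1 - (1 - p) ^ (k + 1)) / \<sigma> - (1 - (1 - p) ^ k) / \<sigma> = p * (1 - p) ^ k / \<sigma>"
    by (simp add: diff_divide_distrib[symmetric] algebra_simps)
  finally show ?thesis .
qed

subsection \<open>Geometric skipping\<close>

lemma measurable_row [measurable]:
  "(\<lambda>r. fst (row p N k r)) \<in> measurable (stream_space unif) (count_space UNIV)"
  "(\<lambda>r. snd (row p N k r)) \<in> measurable (stream_space unif) (stream_space unif)"
proof (induction "N - k" arbitrary: k rule: less_induct)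
  case less
  let ?S = "stream_space unif"
  have sk: "(\<lambda>r. skip p (shd r)) \<in> measurable ?S (count_space UNIV)"
    using measurable_skip_shd[of p 1] by simp
  {
    assume k: "k < N"
    have IH: "(\<lambda>r. fst (row p N (k + 1 + i) r)) \<in> measurable ?S (count_space UNIV)"
      "(\<lambda>r. snd (row p N (k + 1 + i) r)) \<in> measurable ?S ?S" for i
      using less[of "k + 1 + i"] k by auto
    have "(\<lambda>r. k # fst (row p N (k + 1 + skip p (shd r)) (stl r))) \<in> measurable ?S (count_space UNIV)"
    proof (rule measurable_compose_countable[OF _ sk])
      fix i show "(\<lambda>r. k # fst (row p N (k + 1 + i) (stl r))) \<in> measurable ?S (count_space UNIV)"
        by (rule measurable_compose[OF measurable_compose[OF measurable_stl IH(1)]]) simp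
    qed
    moreover have "(\<lambda>r. snd (row p N (k + 1 + skip p (shd r)) (stl r))) \<in> measurable ?S ?S"
      by (rule measurable_compose_countable[OF measurable_compose[OF measurable_stl IH(2)] sk])
    ultimately have "(\<lambda>r. fst (row p N k r)) \<in> measurable ?S (count_space UNIV)"
      "(\<lambda>r. snd (row p N k r)) \<in> measurable ?S ?S"
      using k by (simp_all add: row_less)
  }
  then show "(\<lambda>r. fst (row p N k r)) \<in> measurable ?S (count_space UNIV)"
      "(\<lambda>r. snd (row p N k r)) \<in> measurable ?S ?S"
    by (cases "k < N"; simp add: row_ge)+
qed

lemma row_range: "j \<in> set (fst (row p N k r)) \<Longrightarrow> k \<le> j \<and> j < N"
proof (induction "N - k" arbitrary: k r rule: less_induct)
  case less
  show ?case
  proof (cases "k < N")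
    case True
    then have "N - (k + 1 + skip p (shd r)) < N - k" by simp
    from less.hyps[OF this, of "stl r"] True less.prems show ?thesis by (auto simp: row_less)
  qed (use less.prems in \<open>simp add: row_ge\<close>)
qed

lemma distinct_row: "distinct (fst (row p N k r))"
proof (induction "N - k" arbitrary: k r rule: less_induct)
  case less
  show ?case
  proof (cases "k < N")
    case True
    then have "N - (k + 1 + skip p (shd r)) < N - k" by simp
    from less.hyps[OF this, of "stl r"] True row_range[of k p N "k + 1 + skip p (shd r)" "stl r"]
    show ?thesis by (auto simp: row_less)
  qed (simp add: row_ge)
qed

text \<open>The functional \<open>g\<close> of the coins that the row leaves unread allows the
  integral over one row to be continued with the later rows.\<close>

definition hit :: "real \<Rightarrow> nat \<Rightarrow> nat set \<Rightarrow> (real stream \<Rightarrow> ennreal) \<Rightarrow> nat \<Rightarrow> real stream \<Rightarrow> ennreal" where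
  "hit p N Q g k r = (if Q \<subseteq> set (fst (row p N k r)) then g (snd (row p N k r)) else 0)"

lemma measurable_hit [measurable]:
  assumes [measurable]: "g \<in> borel_measurable (stream_space unif)"
  shows "hit p N Q g k \<in> borel_measurable (stream_space unif)"
proof -
  have [measurable]: "Measurable.pred (stream_space unif) (\<lambda>r. Q \<subseteq> set (fst (row p N k r)))"
    by (rule measurable_compose[OF measurable_row(1)]) simp
  show ?thesis unfolding hit_def[abs_def] by measurable
qed

text \<open>
  Conditioning on the first draw: it lands before \<open>Min Q\<close>, on it, or beyond it, and the first two
  cases restart the process with \<open>Q\<close> and \<open>Q - {Min Q}\<close>. The parameter \<open>\<sigma>\<close> conditions the
  first draw on an event of that probability.
\<close>

lemma nn_integral_row:
  assumes p: "0 < p" "p \<le> 1" and s: "0 < \<sigma>" "\<sigma> \<le> 1" "1 - (1 - p) ^ (N - k) \<le> \<sigma>"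
    and Q: "Q \<subseteq> {k..<N}" and g [measurable]: "g \<in> borel_measurable (stream_space unif)"
  shows "(\<integral>\<^sup>+ r. hit p N Q g (k + skip p (\<sigma> * shd r)) (stl r) \<partial>stream_space unif) =
    ennreal (if Q = {} then 1 else p ^ card Q / \<sigma>) * (\<integral>\<^sup>+ r. g r \<partial>stream_space unif)"
  using s Q
proof (induction "N - k" arbitrary: k \<sigma> Q rule: less_induct)
  case less
  let ?S = "stream_space unif"
  define E where "E = (\<integral>\<^sup>+ r. g r \<partial>?S)"
  define \<phi> where "\<phi> x = (\<integral>\<^sup>+ r. hit p N Q g x r \<partial>?S)" for x
  have meas: "(\<lambda>r. hit p N Q g (k + skip p (c * shd r)) (stl r)) \<in> borel_measurable ?S" for k c Q
    by (rule measurable_compose_countable[OF _ measurable_skip_shd]) measurable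
  have step: "(\<integral>\<^sup>+ r. hit p N Q g (k + skip p (\<sigma> * shd r)) (stl r) \<partial>?S) =
      (\<integral>\<^sup>+ u. \<phi> (k + skip p (\<sigma> * u)) \<partial>unif)"
    by (subst U.nn_integral_stream_space) (use meas in \<open>simp_all add: \<phi>_def\<close>)
  \<comment> \<open>Once a position \<open>x\<close> has been visited, the next skip is unscaled.
    The induction hypothesis is therefore used at \<open>x + 1\<close> with \<sigma> = 1, where its
    bound on \<sigma> is trivial.\<close>
  have IH: "\<phi> x = ennreal (p ^ card (Q - {x})) * E" if "k \<le> x" "x < N" "Q \<subseteq> {x..<N}" for x
  proof -
    have "hit p N Q g x r = hit p N (Q - {x}) g (x + 1 + skip p (1 * shd r)) (stl r)" for r
      using that(2) by (auto simp: hit_def row_less)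
    then have "\<phi> x = (\<integral>\<^sup>+ r. hit p N (Q - {x}) g (x + 1 + skip p (1 * shd r)) (stl r) \<partial>?S)"
      by (simp add: \<phi>_def)
    also have "\<dots> = ennreal (if Q - {x} = {} then 1 else p ^ card (Q - {x}) / 1) * E"
    proof -
      have a: "N - (x + 1) < N - k" using that by simp
      have b: "1 - (1 - p) ^ (N - (x + 1)) \<le> 1" using p by simp
      have c: "Q - {x} \<subseteq> {x + 1..<N}"
      proof
        fix y assume "y \<in> Q - {x}"
        with that(3) have "x \<le> y" "y < N" "y \<noteq> x" by auto
        then show "y \<in> {x + 1..<N}" by simp
      qed
      show ?thesis unfolding E_def by (rule less.hyps[OF a _ _ b c]) simp_all
    qed
    also have "(if Q - {x} = {} then 1 else p ^ card (Q - {x}) / 1) = p ^ card (Q - {x})"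
      by (metis card.empty div_by_1 power_0)
    finally show ?thesis .
  qed
  show ?case
  proof (cases "Q = {}")
    case True
    have "\<phi> (k + i) = E" for i
    proof (cases "k + i < N")
      case True
      with IH[of "k + i"] \<open>Q = {}\<close> show ?thesis by simp
    next
      case False
      then show ?thesis using \<open>Q = {}\<close> by (simp add: \<phi>_def hit_def row_ge E_def)
    qed
    with step True show ?thesis by (simp add: E_def U.emeasure_space_1[simplified])
  next
    case False
    define j where "j = Min Q"
    have fin: "finite Q" using less.prems(4) finite_subset by blast
    have j: "j \<in> Q" "k \<le> j" "j < N" using Min_in[OF fin False] less.prems(4) by (auto simp: j_def)
    have le: "j \<le> i" if "i \<in> Q" for i using that fin by (simp add: j_def)
    have QN: "i < N" if "i \<in> Q" for i using that less.prems(4) by auto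
    have \<phi>: "\<phi> (k + i) = ennreal (p ^ card Q) * E * indicator {u. skip p (\<sigma> * u) < j - k} u +
        ennreal (p ^ (card Q - 1)) * E * indicator {u. skip p (\<sigma> * u) = j - k} u"
      if i: "i = skip p (\<sigma> * u)" for i u
    proof -
      consider "k + i < j" | "k + i = j" | "j < k + i" by linarith
      then show ?thesis
      proof cases
        case 1
        have "Q \<subseteq> {k + i..<N}"
        proof
          fix x assume "x \<in> Q"
          then show "x \<in> {k + i..<N}" using le[of x] QN[of x] 1 by simp
        qed
        then have "\<phi> (k + i) = ennreal (p ^ card (Q - {k + i})) * E"
          using j 1 by (intro IH) auto
        moreover have "Q - {k + i} = Q" using 1 le by force
        ultimately show ?thesis using 1 i by (auto simp: indicator_def)
      next
        case 2
        have "Q \<subseteq> {k + i..<N}"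
        proof
          fix x assume "x \<in> Q"
          then show "x \<in> {k + i..<N}" using le[of x] QN[of x] 2 by simp
        qed
        then have "\<phi> (k + i) = ennreal (p ^ card (Q - {k + i})) * E"
          using j 2 by (intro IH) auto
        moreover have "card (Q - {k + i}) = card Q - 1" using 2 j fin by simp
        ultimately show ?thesis using 2 i by (auto simp: indicator_def)
      next
        case 3
        have "\<not> Q \<subseteq> set (fst (row p N (k + i) r))" for r
          using row_range[of j p N "k + i" r] j(1) 3 by auto
        then have "\<phi> (k + i) = 0" by (simp add: \<phi>_def hit_def)
        then show ?thesis using 3 i j(2) by (auto simp: indicator_def)
      qed
    qed
    have alg: "ennreal x * E * ennreal a + ennreal y * E * ennreal b = (ennreal (x * a) + ennreal (y * b)) * E"
      if "0 \<le> x" "0 \<le> y" for x y a b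
      unfolding ennreal_mult'[OF that(1)] ennreal_mult'[OF that(2)] by (simp add: distrib_left mult_ac)
    \<comment> \<open>The hypothesis on \<sigma> concerns the whole remaining row; powers decrease,
      so it also covers the thresholds for landing before \<open>j\<close> and on
      \<open>j\<close>.\<close>
    have pw: "(1 - p) ^ (N - k) \<le> (1 - p) ^ (j - k + 1)" "(1 - p) ^ (N - k) \<le> (1 - p) ^ (j - k)"
      by (rule power_decreasing; use p j in simp)+
    have [measurable]: "{u. skip p (\<sigma> * u) < j - k} \<in> sets unif" "{u. skip p (\<sigma> * u) = j - k} \<in> sets unif"
      by measurable
    have "(\<integral>\<^sup>+ u. \<phi> (k + skip p (\<sigma> * u)) \<partial>unif) =
       ennreal (p ^ card Q) * E * emeasure unif {u. skip p (\<sigma> * u) < j - k} +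
       ennreal (p ^ (card Q - 1)) * E * emeasure unif {u. skip p (\<sigma> * u) = j - k}"
      unfolding \<phi>[OF refl] by (subst nn_integral_add) (auto simp: nn_integral_cmult_indicator)
    also have "\<dots> = ennreal (p ^ card Q) * E * ennreal ((1 - (1 - p) ^ (j - k)) / \<sigma>) +
       ennreal (p ^ (card Q - 1)) * E * ennreal (p * (1 - p) ^ (j - k) / \<sigma>)"
      using p less.prems pw by (subst emeasure_skip_less emeasure_skip_eq; simp)+
    also have "\<dots> = (ennreal (p ^ card Q * ((1 - (1 - p) ^ (j - k)) / \<sigma>)) +
       ennreal (p ^ (card Q - 1) * (p * (1 - p) ^ (j - k) / \<sigma>))) * E"
      by (rule alg) (use p in auto)
    \<comment> \<open>Landing before \<open>j\<close> leaves all of \<open>Q\<close>; landing on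
      \<open>j\<close> leaves one element fewer but contributes a factor \<open>p\<close> itself.
      Both terms thus carry p ^ card Q / \<sigma>, with coefficients 1 - (1 - p) ^ (j - k) and (1 -
      p) ^ (j - k), which add up to 1.\<close>
    also have "ennreal (p ^ card Q * ((1 - (1 - p) ^ (j - k)) / \<sigma>)) +
       ennreal (p ^ (card Q - 1) * (p * (1 - p) ^ (j - k) / \<sigma>)) = ennreal (p ^ card Q / \<sigma>)"
    proof -
      have "p ^ (card Q - 1) * p = p ^ card Q"
        using False fin by (metis card_gt_0_iff power_minus_mult)
      then have "p ^ card Q * ((1 - (1 - p) ^ (j - k)) / \<sigma>) + p ^ (card Q - 1) * (p * (1 - p) ^ (j - k) / \<sigma>) =
         p ^ card Q / \<sigma>"
        using less.prems(1) by (simp add: field_simps)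
      then show ?thesis
        using p less.prems by (subst ennreal_plus[symmetric]) (auto simp: power_le_one)
    qed
    finally show ?thesis using step False by (simp add: E_def)
  qed
qed

lemma measurable_visits [measurable]:
  "(\<lambda>r. visits p N \<sigma> as r) \<in> measurable (stream_space unif) (count_space UNIV)"
proof (induction as)
  case (Cons a as)
  let ?S = "stream_space unif"
  have row: "(\<lambda>r. fst (row p (N a) (skip p (\<sigma> a * shd r)) (stl r))) \<in> measurable ?S (count_space UNIV)"
    "(\<lambda>r. snd (row p (N a) (skip p (\<sigma> a * shd r)) (stl r))) \<in> measurable ?S ?S"
    by (rule measurable_compose_countable[OF measurable_compose[OF measurable_stl measurable_row(1)] measurable_skip_shd])
      (rule measurable_compose_countable[OF measurable_compose[OF measurable_stl measurable_row(2)] measurable_skip_shd])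
  have "(\<lambda>r. (\<lambda>xs r. map (Pair a) xs @ visits p N \<sigma> as (snd (row p (N a) (skip p (\<sigma> a * shd r)) (stl r))))
     (fst (row p (N a) (skip p (\<sigma> a * shd r)) (stl r))) r) \<in> measurable ?S (count_space UNIV)"
  proof (rule measurable_compose_countable[OF _ row(1)])
    fix xs
    show "(\<lambda>r. map (Pair a) xs @ visits p N \<sigma> as (snd (row p (N a) (skip p (\<sigma> a * shd r)) (stl r))))
        \<in> measurable ?S (count_space UNIV)"
      by (rule measurable_compose[OF measurable_compose[OF row(2) Cons.IH]]) simp
  qed
  then show ?case by simp
qed simp

lemma visits_range: "(a, k) \<in> set (visits p N \<sigma> as r) \<Longrightarrow> a \<in> set as \<and> k < N a"
  by (induction as arbitrary: r) (auto dest: row_range)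

lemma distinct_visits: "distinct as \<Longrightarrow> distinct (visits p N \<sigma> as r)"
  by (induction as arbitrary: r) (auto simp: distinct_map distinct_row inj_on_def dest: visits_range)

text \<open>Induction over the tasks: \<open>nn_integral_row\<close> is applied with the indicator
  for the later tasks as functional of the remaining coins. Distinctness ensures that slots of the
  first task are visited only in the first row. A task without a slot in \<open>Q\<close>
  contributes the factor 1, so the product of the \<sigma> runs over the tasks of \<open>Q\<close>
  only.\<close>

lemma nn_integral_visits:
  assumes p: "0 < p" "p \<le> 1"
    and "distinct as" "\<And>a. a \<in> set as \<Longrightarrow> 0 < \<sigma> a \<and> \<sigma> a \<le> 1 \<and> 1 - (1 - p) ^ N a \<le> \<sigma> a"
    and "finite Q" "\<And>a k. (a, k) \<in> Q \<Longrightarrow> k < N a"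
  shows "(\<integral>\<^sup>+ r. indicator {r. Q \<subseteq> set (visits p N \<sigma> as r)} r \<partial>stream_space unif) =
    (if fst ` Q \<subseteq> set as then ennreal (p ^ card Q / (\<Prod>a\<in>fst ` Q. \<sigma> a)) else 0)"
  using assms(3-)
proof (induction as arbitrary: Q)
  case Nil
  then show ?case by (cases "Q = {}") (auto simp: S.emeasure_space_1[simplified])
next
  case (Cons a as)
  let ?S = "stream_space unif"
  define Qa where "Qa = {k. (a, k) \<in> Q}"
  define Q' where "Q' = {x \<in> Q. fst x \<noteq> a}"
  have Q: "Q = Pair a ` Qa \<union> Q'" by (auto simp: Qa_def Q'_def)
  have "finite (Pair a ` Qa)"
    by (rule finite_subset[OF _ Cons.prems(3)]) (auto simp: Qa_def)
  then have fin: "finite Q'" "finite Qa"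
    using Cons.prems(3) by (auto simp: Q'_def dest!: finite_imageD intro: inj_onI)
  have cQ: "card Q = card Qa + card Q'"
    unfolding Q using fin by (subst card_Un_disjoint) (auto simp: card_image inj_on_def Q'_def)
  define g where "g r = (indicator {r. Q' \<subseteq> set (visits p N \<sigma> as r)} r :: ennreal)" for r
  have gm: "g \<in> borel_measurable ?S"
  proof -
    have "Measurable.pred ?S (\<lambda>r. Q' \<subseteq> set (visits p N \<sigma> as r))"
      by (rule measurable_compose[OF measurable_visits]) simp
    then have "{r. Q' \<subseteq> set (visits p N \<sigma> as r)} \<in> sets ?S" by (simp add: pred_def)
    then show ?thesis unfolding g_def[abs_def] by measurable
  qed
  have eq: "indicator {r. Q \<subseteq> set (visits p N \<sigma> (a # as) r)} r =
      hit p (N a) Qa g (0 + skip p (\<sigma> a * shd r)) (stl r)" for r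
  proof -
    define xs where "xs = fst (row p (N a) (skip p (\<sigma> a * shd r)) (stl r))"
    define r2 where "r2 = snd (row p (N a) (skip p (\<sigma> a * shd r)) (stl r))"
    have "Q \<subseteq> set (visits p N \<sigma> (a # as) r) \<longleftrightarrow> Q \<subseteq> Pair a ` set xs \<union> set (visits p N \<sigma> as r2)"
      by (simp add: xs_def r2_def)
    also have "\<dots> \<longleftrightarrow> Qa \<subseteq> set xs \<and> Q' \<subseteq> set (visits p N \<sigma> as r2)"
      using Cons.prems(1) visits_range[of a _ p N \<sigma> as r2] unfolding Q by (force simp: Q'_def)
    finally show ?thesis
      by (simp add: hit_def g_def indicator_def xs_def r2_def)
  qed
  have "(\<integral>\<^sup>+ r. indicator {r. Q \<subseteq> set (visits p N \<sigma> (a # as) r)} r \<partial>?S) =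
     ennreal (if Qa = {} then 1 else p ^ card Qa / \<sigma> a) * (\<integral>\<^sup>+ r. g r \<partial>?S)"
    unfolding eq by (rule nn_integral_row) (use p Cons.prems gm in \<open>auto simp: Qa_def\<close>)
  also have "(\<integral>\<^sup>+ r. g r \<partial>?S) =
      (if fst ` Q' \<subseteq> set as then ennreal (p ^ card Q' / (\<Prod>a\<in>fst ` Q'. \<sigma> a)) else 0)"
    unfolding g_def by (rule Cons.IH) (use Cons.prems fin in \<open>auto simp: Q'_def\<close>)
  also have "ennreal (if Qa = {} then 1 else p ^ card Qa / \<sigma> a) * \<dots> =
      (if fst ` Q \<subseteq> set (a # as) then ennreal (p ^ card Q / (\<Prod>a\<in>fst ` Q. \<sigma> a)) else 0)"
  proof (cases "fst ` Q' \<subseteq> set as")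
    case True
    have "fst ` Q \<subseteq> set (a # as)" using True unfolding Q by auto
    moreover have "(if Qa = {} then 1 else p ^ card Qa / \<sigma> a) * (p ^ card Q' / (\<Prod>a\<in>fst ` Q'. \<sigma> a)) =
        p ^ card Q / (\<Prod>a\<in>fst ` Q. \<sigma> a)"
    proof (cases "Qa = {}")
      case True
      then show ?thesis using cQ by (simp add: Q)
    next
      case False
      then have "fst ` Q = insert a (fst ` Q')" unfolding Q by (auto simp: image_Un image_image)
      moreover have "a \<notin> fst ` Q'" by (auto simp: Q'_def)
      ultimately show ?thesis using False fin by (simp add: cQ power_add)
    qed
    moreover have "0 \<le> (if Qa = {} then 1 else p ^ card Qa / \<sigma> a)"
      using p Cons.prems(2)[of a] by simp
    ultimately show ?thesis using True by (simp add: ennreal_mult'[symmetric])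
  next
    case False
    then have "\<not> fst ` Q \<subseteq> set (a # as)" unfolding Q by (auto simp: Q'_def)
    with False show ?thesis by simp
  qed
  finally show ?case .
qed

text \<open>Linearity of expectation over the slots, each of which is visited with probability
  \<open>p / \<sigma> a\<close>; as visits are distinct, the length counts visited slots.\<close>

lemma nn_integral_length_visits:
  assumes p: "0 < p" "p \<le> 1"
    and as: "distinct as" "\<And>a. a \<in> set as \<Longrightarrow> 0 < \<sigma> a \<and> \<sigma> a \<le> 1 \<and> 1 - (1 - p) ^ N a \<le> \<sigma> a"
  shows "(\<integral>\<^sup>+ r. of_nat (length (visits p N \<sigma> as r)) \<partial>stream_space unif) =
    ennreal (\<Sum>a\<in>set as. real (N a) * (p / \<sigma> a))"
proof -
  let ?S = "stream_space unif" and ?I = "SIGMA a:set as. {..<N a}"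
  have meas: "{r. {x} \<subseteq> set (visits p N \<sigma> as r)} \<in> sets ?S" for x
  proof -
    have "Measurable.pred ?S (\<lambda>r. {x} \<subseteq> set (visits p N \<sigma> as r))"
      by (rule measurable_compose[OF measurable_visits]) simp
    then show ?thesis by (simp add: pred_def)
  qed
  have "of_nat (length (visits p N \<sigma> as r)) = (\<Sum>x\<in>?I. indicator {r. {x} \<subseteq> set (visits p N \<sigma> as r)} r :: ennreal)" for r
  proof -
    have "set (visits p N \<sigma> as r) \<subseteq> ?I" by (auto dest: visits_range)
    then have "?I \<inter> set (visits p N \<sigma> as r) = set (visits p N \<sigma> as r)" by blast
    moreover have "length (visits p N \<sigma> as r) = card (set (visits p N \<sigma> as r))"
      by (simp add: distinct_card distinct_visits as)
    moreover have "(\<Sum>x\<in>?I. indicator {r. {x} \<subseteq> set (visits p N \<sigma> as r)} r :: ennreal) =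
        (\<Sum>x\<in>?I. if x \<in> set (visits p N \<sigma> as r) then 1 else 0)"
      by (intro sum.cong) (auto simp: indicator_def)
    ultimately show ?thesis by (simp add: sum.If_cases)
  qed
  then have "(\<integral>\<^sup>+ r. of_nat (length (visits p N \<sigma> as r)) \<partial>?S) =
      (\<Sum>x\<in>?I. \<integral>\<^sup>+ r. indicator {r. {x} \<subseteq> set (visits p N \<sigma> as r)} r \<partial>?S)"
    using meas by (simp add: nn_integral_sum)
  also have "\<dots> = (\<Sum>x\<in>?I. ennreal (p / \<sigma> (fst x)))"
  proof (intro sum.cong refl)
    fix x assume x: "x \<in> ?I"
    have "(\<integral>\<^sup>+ r. indicator {r. {x} \<subseteq> set (visits p N \<sigma> as r)} r \<partial>?S) =
      (if fst ` {x} \<subseteq> set as then ennreal (p ^ card {x} / (\<Prod>a\<in>fst ` {x}. \<sigma> a)) else 0)"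
      by (rule nn_integral_visits) (use p as x in auto)
    then show "(\<integral>\<^sup>+ r. indicator {r. {x} \<subseteq> set (visits p N \<sigma> as r)} r \<partial>?S) = ennreal (p / \<sigma> (fst x))"
      using x by auto
  qed
  also have "\<dots> = ennreal (\<Sum>x\<in>?I. p / \<sigma> (fst x))"
    using p as by (intro sum_ennreal) (force intro: divide_nonneg_pos)
  also have "(\<Sum>x\<in>?I. p / \<sigma> (fst x)) = (\<Sum>a\<in>set as. real (N a) * (p / \<sigma> a))"
    using sum.Sigma[of "set as" "\<lambda>a. {..<N a}" "\<lambda>a _. p / \<sigma> a"] by (simp add: case_prod_unfold)
  finally show ?thesis .
qed

text \<open>Replacing everything after the first \<open>m\<close> coins by an independent stream
  does not change the distribution. Conditioning on a prefix of the coins is expressed by this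
  iterated integral.\<close>

lemma nn_integral_stake:
  assumes f [measurable]: "f \<in> borel_measurable (stream_space unif)"
  shows "(\<integral>\<^sup>+ r. f r \<partial>stream_space unif) =
    (\<integral>\<^sup>+ r. \<integral>\<^sup>+ r'. f (stake m r @- r') \<partial>stream_space unif \<partial>stream_space unif)"
  using f
proof (induction m arbitrary: f)
  case 0
  then show ?case by (simp add: S.emeasure_space_1[simplified])
next
  case (Suc m)
  let ?S = "stream_space unif"
  note [measurable] = Suc.prems
  have "(\<integral>\<^sup>+ r. f r \<partial>?S) = (\<integral>\<^sup>+ u. \<integral>\<^sup>+ r. f (u ## r) \<partial>?S \<partial>unif)"
    by (rule U.nn_integral_stream_space) measurable
  also have "\<dots> = (\<integral>\<^sup>+ u. \<integral>\<^sup>+ r. \<integral>\<^sup>+ r'. f (u ## (stake m r @- r')) \<partial>?S \<partial>?S \<partial>unif)"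
    by (intro nn_integral_cong Suc.IH) measurable
  also have "\<dots> = (\<integral>\<^sup>+ u. \<integral>\<^sup>+ r. \<integral>\<^sup>+ r'. f (stake (Suc m) (u ## r) @- r') \<partial>?S \<partial>?S \<partial>unif)"
    by simp
  also have "\<dots> = (\<integral>\<^sup>+ r. \<integral>\<^sup>+ r'. f (stake (Suc m) r @- r') \<partial>?S \<partial>?S)"
    by (rule U.nn_integral_stream_space[symmetric]) measurable
  finally show ?case .
qed

lemma nn_integral_snth:
  assumes f: "f \<in> borel_measurable borel"
  shows "(\<integral>\<^sup>+ r. f (r !! i) \<partial>stream_space unif) = (\<integral>\<^sup>+ u. f u \<partial>unif)"
proof (induction i)
  case 0
  note [measurable] = f
  show ?case by (subst U.nn_integral_stream_space) (simp_all add: S.emeasure_space_1[simplified])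
next
  case (Suc i)
  note [measurable] = f
  have "(\<lambda>r. f (r !! Suc i)) \<in> borel_measurable (stream_space unif)" by measurable
  then show ?case
    by (subst U.nn_integral_stream_space) (use Suc in \<open>simp_all add: U.emeasure_space_1[simplified]\<close>)
qed

lemma emeasure_prefix:
  assumes B: "B \<in> sets borel"
  shows "emeasure (stream_space unif) {r. \<forall>i<k. r !! i \<in> B} = emeasure unif B ^ k"
proof (induction k)
  case 0
  then show ?case by (simp add: S.emeasure_space_1[simplified])
next
  case (Suc k)
  note [measurable] = B
  let ?S = "stream_space unif"
  have meas: "{r. \<forall>i<k. r !! i \<in> B} \<in> sets ?S" for k
  proof -
    have "{r \<in> space ?S. \<forall>i<k. r !! i \<in> B} \<in> sets ?S" by measurable
    then show ?thesis by simp
  qed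
  have "emeasure ?S {r. \<forall>i<Suc k. r !! i \<in> B} = (\<integral>\<^sup>+ u. emeasure ?S {r. u ## r \<in> {r. \<forall>i<Suc k. r !! i \<in> B}} \<partial>unif)"
    using U.emeasure_stream_space[OF meas[of "Suc k"]] by simp
  also have "\<dots> = (\<integral>\<^sup>+ u. indicator B u * emeasure ?S {r. \<forall>i<k. r !! i \<in> B} \<partial>unif)"
  proof (intro nn_integral_cong)
    fix u
    have "{r. u ## r \<in> {r. \<forall>i<Suc k. r !! i \<in> B}} = (if u \<in> B then {r. \<forall>i<k. r !! i \<in> B} else {})"
      by (auto simp: less_Suc_eq_0_disj)
    then show "emeasure ?S {r. u ## r \<in> {r. \<forall>i<Suc k. r !! i \<in> B}} =
        indicator B u * emeasure ?S {r. \<forall>i<k. r !! i \<in> B}"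
      by simp
  qed
  also have "\<dots> = emeasure unif B * emeasure unif B ^ k"
    using Suc by (simp add: nn_integral_multc)
  finally show ?case by simp
qed

lemma less_mult_add: "i < a \<Longrightarrow> j < b \<Longrightarrow> i * b + j < a * (b :: nat)"
proof -
  assume "i < a" "j < b"
  then have "i * b + j < Suc i * b" by simp
  also have "\<dots> \<le> a * b" using \<open>i < a\<close> by (intro mult_le_mono1) simp
  finally show ?thesis .
qed

definition position :: "'a list \<Rightarrow> 'a \<Rightarrow> nat" where
  "position xs x = (LEAST j. j < length xs \<and> xs ! j = x)"

lemma position:
  assumes "x \<in> set xs"
  shows "position xs x < length xs" "xs ! position xs x = x"
proof -
  obtain j where "j < length xs \<and> xs ! j = x" using assms by (auto simp: in_set_conv_nth)
  from LeastI[of "\<lambda>j. j < length xs \<and> xs ! j = x", OF this]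
  show "position xs x < length xs" "xs ! position xs x = x" by (auto simp: position_def)
qed

lemma position_nth:
  assumes "distinct xs" "j < length xs"
  shows "position xs (xs ! j) = j"
  using position[of "xs ! j" xs] assms by (auto simp: nth_eq_iff_index_eq)

context sampler
begin

subsection \<open>Edges and slots\<close>

lemma orientedD:
  assumes "(v, u) \<in> oriented G"
  shows "v \<in> V" "u \<in> V" "u \<in> set (neighbors G h v)" "0 < deg v"
proof -
  have e: "{v, u} \<in> edges G" using assms by (simp add: oriented_def)
  then show vu: "v \<in> V" "u \<in> V" using wf by (auto simp: wf_hgraph_def doubleton_eq_iff)
  then show u: "u \<in> set (neighbors G h v)" using e by (simp add: set_neighbors)
  then show "0 < deg v" using length_neighbors[of h v] by (cases "neighbors G h v") auto
qed

text \<open>The inverse of \<open>emit\<close>. Only the position within the row depends on the hash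
  values, through the order of the neighbour list; the task does not. This is why the order has no
  influence on the probabilities.\<close>

definition slot :: "('v \<Rightarrow> real) \<Rightarrow> ('v \<times> 'v) \<times> nat \<Rightarrow> 'v option \<times> nat" where
  "slot h x = (case x of ((v, u), i) \<Rightarrow>
     if th < deg v then (Some v, i * deg v + position (neighbors G h v) u)
     else (None, i * (n * th) + (position (vlist G) v * th + position (neighbors G h v) u)))"

lemma slot_range:
  assumes "(v, u) \<in> oriented G" "i < t" "slot h ((v, u), i) = (a, k)"
  shows "k < slots a" "a = (if th < deg v then Some v else None)"
proof -
  note o = orientedD[OF assms(1)]
  have j: "position (neighbors G h v) u < deg v"
    using position(1)[OF o(3)] by (simp add: length_neighbors)
  have l: "position (vlist G) v < n"
    using position(1)[OF o(1)] by (simp add: length_vlist)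
  show "a = (if th < deg v then Some v else None)" using assms(3) by (auto simp: slot_def split: if_splits)
  show "k < slots a"
  proof (cases "th < deg v")
    case True
    then show ?thesis using assms(2,3) j by (auto simp: slot_def slots_def intro: less_mult_add)
  next
    case False
    then have "position (vlist G) v * th + position (neighbors G h v) u < n * th"
      using l j by (intro less_mult_add) auto
    then show ?thesis using assms(2,3) False by (auto simp: slot_def slots_def intro: less_mult_add)
  qed
qed

text \<open>Division with remainder is unique: the place in the row is below its width, so the slot
  number determines sample, vertex and neighbour. Distinct vertex and neighbour lists make
  \<open>position\<close> invert the lookup.\<close>

lemma emit_iff_slot:
  assumes o: "(v, u) \<in> oriented G" and i: "i < t" and k: "k < slots a"
    and a: "\<And>w. a = Some w \<Longrightarrow> th < deg w"
  shows "((v, u), i) \<in> emit h (a, k) \<longleftrightarrow> slot h ((v, u), i) = (a, k)"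
proof -
  note od = orientedD[OF o]
  define nb where "nb = neighbors G h v"
  define j where "j = position nb u"
  have j: "j < deg v" "nb ! j = u"
    using position[OF od(3)[of h]] by (simp_all add: length_neighbors j_def nb_def)
  have jj: "position nb (nb ! j') = j'" if "j' < deg v" for j'
    using position_nth[of nb j'] that distinct_neighbors[of h v] by (simp add: nb_def length_neighbors)
  show ?thesis
  proof (cases a)
    case (Some w)
    have w: "th < deg w" using a Some by simp
    have "((v, u), i) \<in> emit h (a, k) \<longleftrightarrow> w = v \<and> k div deg v = i \<and> u = nb ! (k mod deg v)"
      by (auto simp: Some emit_def nb_def)
    also have "\<dots> \<longleftrightarrow> w = v \<and> k div deg v = i \<and> k mod deg v = j"
      using j jj[of "k mod deg v"] od(4) by (auto simp: j_def)
    also have "\<dots> \<longleftrightarrow> w = v \<and> k = i * deg v + j"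
      using j by (auto simp: div_mult_mod_eq)
    also have "\<dots> \<longleftrightarrow> slot h ((v, u), i) = (a, k)"
      using w by (auto simp: slot_def Some j_def nb_def)
    finally show ?thesis .
  next
    case None
    define y where "y = k mod (n * th)"
    define l where "l = position (vlist G) v"
    have l: "l < n" "vlist G ! l = v"
      using position[OF od(1)] by (simp_all add: length_vlist l_def)
    have nth: "0 < n * th" "0 < th" using k None by (auto simp: slots_def intro!: gr0I)
    have y: "y div th < n" using nth by (simp add: y_def less_mult_imp_div_less)
    have ll: "position (vlist G) (vlist G ! l') = l'" if "l' < n" for l'
      using position_nth[OF distinctV, of l'] that by (simp add: length_vlist)
    have "((v, u), i) \<in> emit h (a, k) \<longleftrightarrow>
       vlist G ! (y div th) = v \<and> y mod th < deg v \<and> deg v \<le> th \<and> u = nb ! (y mod th) \<and> i = k div (n * th)"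
      by (auto simp: None emit_def nb_def Let_def y_def[symmetric])
    also have "\<dots> \<longleftrightarrow> y div th = l \<and> y mod th = j \<and> deg v \<le> th \<and> i = k div (n * th)"
      using j jj[of "y mod th"] l ll[OF y] by (auto simp: j_def l_def)
    also have "\<dots> \<longleftrightarrow> deg v \<le> th \<and> k = i * (n * th) + (l * th + j)"
    proof
      assume A: "y div th = l \<and> y mod th = j \<and> deg v \<le> th \<and> i = k div (n * th)"
      then have "y = l * th + j" using div_mult_mod_eq[of y th] by simp
      with A show "deg v \<le> th \<and> k = i * (n * th) + (l * th + j)"
        using div_mult_mod_eq[of k "n * th"] by (simp add: y_def)
    next
      assume A: "deg v \<le> th \<and> k = i * (n * th) + (l * th + j)"
      then have jt: "j < th" using j by simp
      have lt: "l * th + j < n * th" using l jt by (intro less_mult_add)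
      have "y = l * th + j" using A lt by (simp add: y_def)
      moreover have "k div (n * th) = i" using A lt nth by simp
      ultimately show "y div th = l \<and> y mod th = j \<and> deg v \<le> th \<and> i = k div (n * th)"
        using A jt by simp
    qed
    also have "\<dots> \<longleftrightarrow> slot h ((v, u), i) = (a, k)"
      by (auto simp: slot_def None j_def l_def nb_def)
    finally show ?thesis .
  qed
qed

lemma emit_at_most_one: "x \<in> emit h y \<Longrightarrow> x' \<in> emit h y \<Longrightarrow> x = x'"
  by (auto simp: emit_def Let_def split: prod.splits option.splits if_splits)

lemma emit_slot:
  assumes "(v, u) \<in> oriented G" "i < t"
  shows "((v, u), i) \<in> emit h (slot h ((v, u), i))"
proof -
  obtain a k where ak: "slot h ((v, u), i) = (a, k)" by (cases "slot h ((v, u), i)")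
  have "((v, u), i) \<in> emit h (a, k) \<longleftrightarrow> slot h ((v, u), i) = (a, k)"
    using slot_range[OF assms ak] by (intro emit_iff_slot assms) (auto split: if_splits)
  with ak show ?thesis by simp
qed

text \<open>A slot emits at most one pair, and every pair is emitted by its own slot.\<close>

lemma inj_on_slot: "inj_on (slot h) (oriented G \<times> {..<t})"
proof (rule inj_onI)
  fix x y assume x: "x \<in> oriented G \<times> {..<t}" and y: "y \<in> oriented G \<times> {..<t}" and xy: "slot h x = slot h y"
  have "x \<in> emit h (slot h x)" "y \<in> emit h (slot h y)"
    using x y by (auto intro: emit_slot)
  with xy have "x \<in> emit h (slot h x)" "y \<in> emit h (slot h x)" by simp_all
  then show "x = y" by (rule emit_at_most_one)
qed

lemma emit_subset:
  assumes "k < slots a" "\<And>w. a = Some w \<Longrightarrow> w \<in> V"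
  shows "emit h (a, k) \<subseteq> oriented G \<times> {..<t}"
proof (cases a)
  case (Some v)
  then have k: "k < t * deg v" using assms by (simp add: slots_def)
  then have d: "0 < deg v" by (cases "deg v") auto
  have "k mod deg v < length (neighbors G h v)" using d by (simp add: length_neighbors)
  then have "neighbors G h v ! (k mod deg v) \<in> set (neighbors G h v)" by (rule nth_mem)
  then show ?thesis using k
    by (auto simp: Some emit_def oriented_def set_neighbors less_mult_imp_div_less)
next
  case None
  then have k: "k < t * (n * th)" using assms by (simp add: slots_def)
  define y where "y = k mod (n * th)"
  define v where "v = vlist G ! (y div th)"
  have "neighbors G h v ! (y mod th) \<in> set (neighbors G h v)" if "y mod th < deg v"
    using that by (intro nth_mem) (simp add: length_neighbors)
  then show ?thesis using k
    by (auto simp: None emit_def Let_def oriented_def set_neighbors less_mult_imp_div_less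
        y_def[symmetric] v_def[symmetric])
qed

text \<open>The condition under which the scaled first skip is exact. For a heavy row it is
  Bernoulli's inequality: a row of t d slots is nonempty with probability at most t d p = q
  d.\<close>

lemma task_bounds:
  assumes "a \<in> set (tasks h L)"
  shows "0 < \<sigma> a \<and> \<sigma> a \<le> 1 \<and> 1 - (1 - p) ^ slots a \<le> \<sigma> a" "\<And>w. a = Some w \<Longrightarrow> th < deg w"
proof -
  show "0 < \<sigma> a \<and> \<sigma> a \<le> 1 \<and> 1 - (1 - p) ^ slots a \<le> \<sigma> a"
  proof (cases a)
    case None
    then show ?thesis using p by (simp add: \<sigma>_def)
  next
    case (Some v)
    then have "selected h v" using assms by (auto simp: tasks_def)
    moreover have "1 - (1 - p) ^ (t * deg v) \<le> q * real (deg v)"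
      using Bernoulli_inequality[of "- p" "t * deg v"] p by (simp add: q_def mult_ac)
    moreover have "1 - (1 - p) ^ (t * deg v) \<le> 1" using p by simp
    ultimately show ?thesis using Some \<sigma>_bounds(1)[of h v] \<sigma>_bounds(2)[of a] by (simp add: \<sigma>_def slots_def)
  qed
  show "\<And>w. a = Some w \<Longrightarrow> th < deg w" using assms by (auto simp: tasks_def selected_def)
qed

lemma distinct_tasks: "distinct L \<Longrightarrow> distinct (tasks h L)"
  by (auto simp: tasks_def distinct_map)

lemma emitted_iff:
  assumes "x \<in> oriented G \<times> {..<t}"
  shows "x \<in> emitted h (visits p slots \<sigma> (tasks h L) r) \<longleftrightarrow> slot h x \<in> set (visits p slots \<sigma> (tasks h L) r)"
proof -
  obtain v u i where x: "x = ((v, u), i)" by (metis surj_pair)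
  have "x \<in> emit h (a, k) \<longleftrightarrow> slot h x = (a, k)" if "(a, k) \<in> set (visits p slots \<sigma> (tasks h L) r)" for a k
    using visits_range[OF that] task_bounds(2)[of a h L] assms unfolding x by (intro emit_iff_slot) auto
  then have "x \<in> emit h y \<longleftrightarrow> slot h x = y" if "y \<in> set (visits p slots \<sigma> (tasks h L) r)" for y
    using that by (cases y) simp
  then show ?thesis unfolding emitted_def by blast
qed

lemma emitted_subset:
  assumes "set L \<subseteq> V"
  shows "emitted h (visits p slots \<sigma> (tasks h L) r) \<subseteq> oriented G \<times> {..<t}"
proof -
  have "emit h (a, k) \<subseteq> oriented G \<times> {..<t}" if "(a, k) \<in> set (visits p slots \<sigma> (tasks h L) r)" for a k
    using visits_range[OF that] assms by (intro emit_subset) (auto simp: tasks_def)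
  then show ?thesis unfolding emitted_def by (metis UN_least prod.exhaust)
qed

subsection \<open>The inclusion probabilities for fixed hash values\<close>

definition heavy_sources :: "(('v \<times> 'v) \<times> nat) set \<Rightarrow> 'v set" where
  "heavy_sources X = {v. th < deg v \<and> (\<exists>u i. ((v, u), i) \<in> X)}"

text \<open>For a source \<open>v\<close> of a heavy edge in \<open>X\<close> this is the density of
  a uniform number conditioned on being below \<open>\<sigma> (Some v)\<close>: the row is examined
  only there, and the scaled first skip contributes the reciprocal.\<close>

definition hash_weight :: "(('v \<times> 'v) \<times> nat) set \<Rightarrow> 'v \<Rightarrow> real \<Rightarrow> real" where
  "hash_weight X v y = (if v \<in> heavy_sources X then (if y < \<sigma> (Some v) then 1 / \<sigma> (Some v) else 0) else 1)"

text \<open>The value does not depend on \<open>L\<close>: only selected members of \<open>L\<close>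
  become tasks, and all selected vertices are members. Hence the search has no further influence
  once it has succeeded. A heavy source that is not selected makes both sides 0.\<close>

lemma nn_integral_emitted:
  assumes X: "X \<subseteq> oriented G \<times> {..<t}"
    and L: "distinct L" "set L \<subseteq> V" "\<And>v. v \<in> V \<Longrightarrow> selected h v \<Longrightarrow> v \<in> set L"
  shows "(\<integral>\<^sup>+ r. indicator {r. X \<subseteq> emitted h (visits p slots \<sigma> (tasks h L) r)} r \<partial>stream_space unif) =
    ennreal (p ^ card X * (\<Prod>v\<in>V. hash_weight X v (h v)))"
proof -
  let ?S = "stream_space unif"
  define Q where "Q = slot h ` X"
  have "finite (oriented G)"
    by (rule finite_subset[of _ "V \<times> V"]) (auto dest: orientedD(1,2))
  then have finX: "finite X" using X finite_subset by fastforce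
  have HV: "heavy_sources X \<subseteq> V" using X orientedD(1) by (fastforce simp: heavy_sources_def)
  have finH: "finite (heavy_sources X)" using HV finite_subset by blast
  have cQ: "card Q = card X"
    unfolding Q_def by (rule card_image) (rule inj_on_subset[OF inj_on_slot X])
  have r: "k < slots a" if "(a, k) \<in> Q" for a k
    using that X slot_range(1) by (force simp: Q_def)
  have fs: "fst (slot h ((v, u), i)) = (if th < deg v then Some v else None)" for v u i
    by (simp add: slot_def)
  have fQ: "fst ` Q \<subseteq> insert None (Some ` heavy_sources X)" "Some ` heavy_sources X \<subseteq> fst ` Q"
  proof -
    show "fst ` Q \<subseteq> insert None (Some ` heavy_sources X)"
      by (auto simp: Q_def fs heavy_sources_def image_image inj_image_mem_iff)
    show "Some ` heavy_sources X \<subseteq> fst ` Q"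
    proof
      fix a assume "a \<in> Some ` heavy_sources X"
      then obtain v u i where v: "a = Some v" "th < deg v" "((v, u), i) \<in> X" by (auto simp: heavy_sources_def)
      then have "a = fst (slot h ((v, u), i))" by (simp add: fs)
      with v(3) show "a \<in> fst ` Q" by (auto simp: Q_def)
    qed
  qed
  have "indicator {r. X \<subseteq> emitted h (visits p slots \<sigma> (tasks h L) r)} r =
      (indicator {r. Q \<subseteq> set (visits p slots \<sigma> (tasks h L) r)} r :: ennreal)" for r
  proof -
    have "X \<subseteq> emitted h (visits p slots \<sigma> (tasks h L) r) \<longleftrightarrow> Q \<subseteq> set (visits p slots \<sigma> (tasks h L) r)"
      unfolding Q_def image_subset_iff using emitted_iff[OF subsetD[OF X], of _ h L r] by blast
    then show ?thesis by (simp add: indicator_def)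
  qed
  then have "(\<integral>\<^sup>+ r. indicator {r. X \<subseteq> emitted h (visits p slots \<sigma> (tasks h L) r)} r \<partial>?S) =
      (\<integral>\<^sup>+ r. indicator {r. Q \<subseteq> set (visits p slots \<sigma> (tasks h L) r)} r \<partial>?S)"
    by simp
  also have "\<dots> = (if fst ` Q \<subseteq> set (tasks h L) then ennreal (p ^ card Q / (\<Prod>a\<in>fst ` Q. \<sigma> a)) else 0)"
    by (rule nn_integral_visits[OF p distinct_tasks[OF L(1)] task_bounds(1)]) (use finX r in \<open>auto simp: Q_def\<close>)
  also have "\<dots> = ennreal (p ^ card X * (\<Prod>v\<in>V. hash_weight X v (h v)))"
  proof (cases "\<forall>v\<in>heavy_sources X. h v < \<sigma> (Some v)")
    case True
    have "fst ` Q \<subseteq> set (tasks h L)"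
    proof
      fix a assume "a \<in> fst ` Q"
      then consider "a = None" | v where "a = Some v" "v \<in> heavy_sources X" using fQ(1) by auto
      then show "a \<in> set (tasks h L)"
      proof cases
        case (2 v)
        then have "selected h v" using True by (auto simp: selected_def heavy_sources_def)
        then have "v \<in> set L" using L(3) HV 2 by auto
        then show ?thesis using \<open>selected h v\<close> 2 by (auto simp: tasks_def)
      qed (simp add: tasks_def)
    qed
    moreover have "(\<Prod>a\<in>fst ` Q. \<sigma> a) = (\<Prod>a\<in>Some ` heavy_sources X. \<sigma> a)"
    proof (rule prod.mono_neutral_right)
      show "finite (fst ` Q)" using finX by (simp add: Q_def)
      show "\<forall>a\<in>fst ` Q - Some ` heavy_sources X. \<sigma> a = 1"
      proof
        fix a assume "a \<in> fst ` Q - Some ` heavy_sources X"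
        then have "a = None" using subsetD[OF fQ(1), of a] by simp
        then show "\<sigma> a = 1" by (simp add: \<sigma>_def)
      qed
    qed (fact fQ(2))
    moreover have "\<dots> = (\<Prod>v\<in>heavy_sources X. \<sigma> (Some v))"
      by (subst prod.reindex) auto
    moreover have "(\<Prod>v\<in>V. hash_weight X v (h v)) = (\<Prod>v\<in>heavy_sources X. 1 / \<sigma> (Some v))"
    proof -
      have "(\<Prod>v\<in>V. hash_weight X v (h v)) = (\<Prod>v\<in>heavy_sources X. hash_weight X v (h v))"
        using HV by (intro prod.mono_neutral_right) (auto simp: hash_weight_def)
      also have "\<dots> = (\<Prod>v\<in>heavy_sources X. 1 / \<sigma> (Some v))"
        using True by (intro prod.cong) (auto simp: hash_weight_def)
      finally show ?thesis .
    qed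
    ultimately show ?thesis by (simp add: cQ prod_dividef)
  next
    case False
    then obtain v where v: "v \<in> heavy_sources X" "\<not> h v < \<sigma> (Some v)" by auto
    then have "Some v \<notin> set (tasks h L)" by (auto simp: tasks_def selected_def)
    then have "\<not> fst ` Q \<subseteq> set (tasks h L)" using v(1) fQ(2) by auto
    moreover have "(\<Prod>v\<in>V. hash_weight X v (h v)) = 0"
      using v HV by (intro prod_zero) (auto simp: hash_weight_def)
    ultimately show ?thesis by (simp only: if_False mult_zero_right ennreal_0)
  qed
  finally show ?thesis .
qed

text \<open>The hash values are independent, so the integral of the product is the product of the
  integrals, and each weight has mean 1 as a density or a constant.\<close>

lemma nn_integral_hash_weight:
  "(\<integral>\<^sup>+ h. (\<Prod>v\<in>V. ennreal (hash_weight X v (h v))) \<partial>(\<Pi>\<^sub>M v\<in>V. unif)) = 1"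
proof -
  interpret P: product_sigma_finite "\<lambda>v. unif" ..
  have m: "(\<lambda>y. ennreal (hash_weight X v y)) \<in> borel_measurable unif" for v
    unfolding hash_weight_def by measurable
  have "(\<integral>\<^sup>+ h. (\<Prod>v\<in>V. ennreal (hash_weight X v (h v))) \<partial>(\<Pi>\<^sub>M v\<in>V. unif)) =
      (\<Prod>v\<in>V. \<integral>\<^sup>+ y. ennreal (hash_weight X v y) \<partial>unif)"
    by (rule P.product_nn_integral_prod) (use m in auto)
  also have "\<dots> = (\<Prod>v\<in>V. 1)"
  proof (rule prod.cong[OF refl])
    fix v assume "v \<in> V"
    show "(\<integral>\<^sup>+ y. ennreal (hash_weight X v y) \<partial>unif) = 1"
    proof (cases "v \<in> heavy_sources X")
      case True
      then have s: "0 < \<sigma> (Some v)" "\<sigma> (Some v) \<le> 1"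
        using q_pos by (auto simp: heavy_sources_def \<sigma>_def)
      have "(\<integral>\<^sup>+ y. ennreal (hash_weight X v y) \<partial>unif) =
          (\<integral>\<^sup>+ y. ennreal (1 / \<sigma> (Some v)) * indicator {y. y < \<sigma> (Some v)} y \<partial>unif)"
        using True by (intro nn_integral_cong) (auto simp: hash_weight_def indicator_def)
      also have "\<dots> = ennreal (1 / \<sigma> (Some v)) * ennreal (\<sigma> (Some v))"
        using s by (subst nn_integral_cmult_indicator) (auto simp: emeasure_unif_less)
      also have "\<dots> = 1" using s by (simp add: ennreal_mult'[symmetric])
      finally show ?thesis .
    next
      case False
      then show ?thesis by (simp add: hash_weight_def U.emeasure_space_1[simplified])
    qed
  qed
  finally show ?thesis by simp
qed

end

context sampler
begin

subsection \<open>The event that all heavy vertices are discovered\<close>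

text \<open>No hash value occurs here. For degree d only the first K (n div d) probes count, since
  the hash bound \<open>tau\<close> of any later one is below q d and may cut off \<open>v\<close>
  although it is selected.\<close>

definition discovers :: "real stream \<Rightarrow> bool" where
  "discovers r \<longleftrightarrow> (\<forall>v\<in>V. th < deg v \<longrightarrow> (\<exists>s<K * (n div deg v). {probe (r !! s), v} \<in> edges G))"

lemma found_subset: "set (found h r s) \<subseteq> V"
  by (auto simp: found_def set_adjoin_all cand_def set_neighbors)

lemma distinct_found: "distinct (found h r s)"
  by (simp add: found_def distinct_adjoin_all)

lemma probes_le: "th < deg v \<Longrightarrow> K * (n div deg v) \<le> m"
  unfolding m_def J_def by (intro mult_le_mono2 div_le_mono2) auto

text \<open>For a probe \<open>s\<close> that counts for \<open>v\<close>, the round number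
  \<open>s div K + 1\<close> is at most n / deg v. Hence \<open>tau s\<close> is at least q deg v,
  and thus at least \<open>\<sigma> (Some v)\<close>, which exceeds the hash value of a selected
  vertex.\<close>

lemma discovers_found:
  assumes "discovers r" "v \<in> V" "selected h v"
  shows "v \<in> set (found h r m)"
proof -
  have d: "th < deg v" "h v < \<sigma> (Some v)" using assms(3) by (auto simp: selected_def)
  then obtain s where s: "s < K * (n div deg v)" "{probe (r !! s), v} \<in> edges G"
    using assms by (auto simp: discovers_def)
  have "s div K < n div deg v" using s(1) by (simp add: less_mult_imp_div_less mult.commute)
  then have "real (s div K) + 1 \<le> real (n div deg v)" by linarith
  also have "\<dots> \<le> real n / real (deg v)" by (rule of_nat_div_le_of_nat)
  finally have "real (deg v) * (real (s div K) + 1) \<le> real n" using d by (simp add: field_simps)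
  then have "q * (real (deg v) * (real (s div K) + 1)) \<le> q * real n" using q_pos by simp
  then have "q * real (deg v) \<le> tau s" by (simp add: tau_def field_simps)
  then have "h v < tau s" using d(2) by (simp add: \<sigma>_def)
  then have "v \<in> set (cand h r s)" using s assms(2) by (simp add: cand_def set_neighbors)
  moreover have "s < m" using s(1) probes_le[OF d(1)] by simp
  ultimately show ?thesis by (auto simp: found_def set_adjoin_all)
qed

lemma found_shift: "found h (stake m r @- r') m = found h r m"
proof -
  have "map (cand h (stake m r @- r')) [0..<m] = map (cand h r) [0..<m]"
    by (intro map_cong refl) (simp add: cand_def)
  then show ?thesis by (simp only: found_def)
qed

lemma discovers_shift: "discovers (stake m r @- r') \<longleftrightarrow> discovers r"
proof -
  have "s < m" if "th < deg v" "s < K * (n div deg v)" for s v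
    using that probes_le[of v] by simp
  then have "(stake m r @- r') !! s = r !! s" if "th < deg v" "s < K * (n div deg v)" for s v
    using that by simp
  then have "(\<exists>s<K * (n div deg v). {probe ((stake m r @- r') !! s), v} \<in> edges G) \<longleftrightarrow>
      (\<exists>s<K * (n div deg v). {probe (r !! s), v} \<in> edges G)" if "th < deg v" for v
    using that by auto
  then show ?thesis unfolding discovers_def by blast
qed

lemma emeasure_probe:
  assumes "A \<subseteq> V"
  shows "emeasure unif {u. probe u \<in> A \<and> 0 \<le> u \<and> u < 1} = ennreal (real (card A) / real n)"
proof -
  \<comment> \<open>The vertex with number \<open>i\<close> is probed for the numbers in the
    interval \<open>B i\<close> of length 1/n; for indices below n these intervals partition the
    half-open unit interval.\<close>
  define B where "B = (\<lambda>i. {real i / real n..<(real i + 1) / real n})"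
  define I where "I = {i. i < n \<and> vlist G ! i \<in> A}"
  have n: "0 < real n" using n_pos by simp
  have B: "u \<in> B i \<longleftrightarrow> 0 \<le> u \<and> nat \<lfloor>u * real n\<rfloor> = i" for u i
  proof -
    have "u \<in> B i \<longleftrightarrow> real i \<le> u * real n \<and> u * real n < real i + 1"
      using n by (simp add: B_def field_simps)
    also have "\<dots> \<longleftrightarrow> \<lfloor>u * real n\<rfloor> = int i" by (simp add: floor_eq_iff)
    also have "\<dots> \<longleftrightarrow> 0 \<le> u \<and> nat \<lfloor>u * real n\<rfloor> = i"
      using n by (auto simp: zero_le_floor zero_le_mult_iff intro!: nat_0_le[symmetric])
        (metis n of_int_0_le_iff of_int_floor_le of_int_of_nat_eq of_nat_0_le_iff order_trans zero_le_mult_iff less_le_not_le)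
    finally show ?thesis .
  qed
  have lt: "nat \<lfloor>u * real n\<rfloor> < n \<longleftrightarrow> u < 1" if "0 \<le> u" for u
  proof -
    have "nat \<lfloor>u * real n\<rfloor> < n \<longleftrightarrow> \<lfloor>u * real n\<rfloor> < int n" using that n by (intro nat_less_iff) simp
    also have "\<dots> \<longleftrightarrow> u < 1" using n by (simp add: floor_less_iff)
    finally show ?thesis .
  qed
  have "{u. probe u \<in> A \<and> 0 \<le> u \<and> u < 1} = (\<Union>i\<in>I. B i)"
    using lt by (auto simp: I_def B probe_def)
  moreover have "emeasure unif (\<Union>i\<in>I. B i) = (\<Sum>i\<in>I. emeasure unif (B i))"
  proof (rule sum_emeasure[symmetric])
    show "disjoint_family_on B I" unfolding disjoint_family_on_def using B by (metis disjoint_iff)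
    show "B ` I \<subseteq> sets unif" by (auto simp: B_def)
  qed (simp add: I_def)
  moreover have "emeasure unif (B i) = ennreal (1 / real n)" if "i \<in> I" for i
  proof -
    have "real i + 1 \<le> real n" using that by (simp add: I_def)
    then show ?thesis using n unfolding B_def
      by (subst emeasure_unif_interval) (auto simp: field_simps)
  qed
  moreover have "card I = card A"
  proof (rule bij_betw_same_card[of "(!) (vlist G)"], rule bij_betw_imageI)
    show "inj_on ((!) (vlist G)) I" using distinctV by (auto simp: I_def inj_on_def nth_eq_iff_index_eq length_vlist)
    show "(!) (vlist G) ` I = A" using assms by (force simp: I_def in_set_conv_nth length_vlist)
  qed
  ultimately show ?thesis
    by (simp add: ennreal_of_nat_eq_real_of_nat ennreal_mult'[symmetric])
qed

lemma neighbor_sym: "{u \<in> V. {u, v} \<in> edges G} = {u \<in> V. {v, u} \<in> edges G}"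
  by (simp add: insert_commute)

lemma measurable_probe: "Measurable.pred borel (\<lambda>u. P (probe u))"
proof -
  have "(\<lambda>u. nat \<lfloor>u * real n\<rfloor>) \<in> measurable borel (count_space UNIV)" by measurable
  from measurable_compose[OF this, of "\<lambda>i. P (vlist G ! i)" "count_space UNIV"]
  show ?thesis by (simp add: probe_def)
qed

lemma emeasure_probe_neighbor:
  "emeasure unif {u. {probe u, v} \<in> edges G} = ennreal (real (deg v) / real n)"
proof -
  let ?A = "{u \<in> V. {u, v} \<in> edges G}"
  have 1: "{u. {probe u, v} \<in> edges G} \<in> sets borel"
    using measurable_probe[of "\<lambda>w. {w, v} \<in> edges G"] by (simp add: pred_def)
  have "AE u in unif. u \<in> {u. {probe u, v} \<in> edges G} \<longleftrightarrow> u \<in> {u. probe u \<in> ?A \<and> 0 \<le> u \<and> u < 1}"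
    using AE_unif by (rule eventually_mono) (use probe_in in auto)
  moreover have "{u. probe u \<in> ?A \<and> 0 \<le> u \<and> u < 1} \<in> sets borel"
  proof -
    have "{u \<in> space borel. probe u \<in> ?A \<and> 0 \<le> u \<and> u < 1} \<in> sets borel"
      using measurable_probe[of "\<lambda>w. w \<in> ?A"] by measurable
    then show ?thesis by simp
  qed
  ultimately have "emeasure unif {u. {probe u, v} \<in> edges G} =
      emeasure unif {u. probe u \<in> ?A \<and> 0 \<le> u \<and> u < 1}"
    using 1 by (intro emeasure_eq_AE) auto
  also have "\<dots> = ennreal (real (card ?A) / real n)" by (rule emeasure_probe) auto
  also have "card ?A = deg v" unfolding Defs.degree_def neighbor_sym ..
  finally show ?thesis .
qed

lemma measurable_discovers: "Measurable.pred (stream_space unif) discovers"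
proof -
  have [measurable]: "Measurable.pred (stream_space unif) (\<lambda>r. {probe (r !! s), v} \<in> edges G)" for s v
  proof -
    have "(\<lambda>r. r !! s) \<in> measurable (stream_space unif) borel"
      using measurable_snth[of s unif] measurable_cong_sets[OF refl sets_unif] by simp
    from measurable_compose[OF this measurable_probe[of "\<lambda>w. {w, v} \<in> edges G"]] show ?thesis .
  qed
  show ?thesis unfolding discovers_def by measurable
qed

text \<open>Union bound over the heavy vertices. A vertex of degree d is missed with probability (1
  - d/n) ^ (K (n div d)), which is at most exp (- K (d/n) (n div d)). Since K is at least 2
  \<open>lg\<close> and (d/n) (n div d) at least 1/2, this is at most exp (- lg) =
  \<delta>/n.\<close>

lemma prob_discovers: "1 - \<delta> \<le> measure (stream_space unif) {r. discovers r}"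
proof -
  let ?S = "stream_space unif"
  define miss where "miss v = {r. \<forall>s<K * (n div deg v). r !! s \<in> {u. {probe u, v} \<notin> edges G}}" for v
  have Bm: "{u. {probe u, v} \<notin> edges G} \<in> sets borel" for v
    using measurable_probe[of "\<lambda>w. {w, v} \<notin> edges G"] by (simp add: pred_def)
  have mm: "miss v \<in> sets ?S" for v
  proof -
    have [measurable]: "{u. {probe u, v} \<notin> edges G} \<in> sets unif" using Bm by simp
    have "{r \<in> space ?S. \<forall>s<K * (n div deg v). r !! s \<in> {u. {probe u, v} \<notin> edges G}} \<in> sets ?S"
      by measurable
    then show ?thesis by (simp add: miss_def)
  qed
  have miss: "measure ?S (miss v) \<le> \<delta> / real n" if v: "v \<in> V" "th < deg v" for v
  proof -
    define x where "x = real (deg v) / real n"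
    have dn: "deg v < n" "0 < deg v" using deg_le[OF v(1)] v(2) by auto
    have x: "0 < x" "x < 1" using dn by (auto simp: x_def)
    have "emeasure unif {u. {probe u, v} \<notin> edges G} = emeasure unif (space unif - {u. {probe u, v} \<in> edges G})"
      by (rule arg_cong[where f = "emeasure unif"]) auto
    also have "\<dots> = emeasure unif (space unif) - emeasure unif {u. {probe u, v} \<in> edges G}"
      using measurable_probe[of "\<lambda>w. {w, v} \<in> edges G"]
      by (intro emeasure_compl) (auto simp: emeasure_probe_neighbor pred_def)
    also have "\<dots> = ennreal (1 - x)"
      using x U.emeasure_space_1
      by (simp only: emeasure_probe_neighbor x_def[symmetric] ennreal_1[symmetric])
         (intro ennreal_minus, simp)
    finally have "emeasure ?S (miss v) = ennreal (1 - x) ^ (K * (n div deg v))"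
      unfolding miss_def using emeasure_prefix[OF Bm] by simp
    also have "\<dots> = ennreal ((1 - x) ^ (K * (n div deg v)))" using x by (simp add: ennreal_power)
    finally have "measure ?S (miss v) = (1 - x) ^ (K * (n div deg v))"
      using x by (simp add: measure_def)
    also have "\<dots> \<le> exp (- x) ^ (K * (n div deg v))"
      using x exp_ge_add_one_self[of "- x"] by (intro power_mono) auto
    also have "\<dots> = exp (- (x * real (K * (n div deg v))))"
      by (simp add: exp_of_nat_mult[symmetric] mult.commute)
    also have "\<dots> \<le> exp (- lg)"
    proof -
      \<comment> \<open>The remainder of n is smaller than the degree, and the quotient is at least
        1, so the remainder is at most the part of n that the quotient accounts for.\<close>
      have "real n \<le> 2 * (real (deg v) * real (n div deg v))"
      proof -
        have "1 \<le> n div deg v" using dn by (simp add: Suc_le_eq div_greater_zero_iff)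
        then have "n mod deg v \<le> deg v * (n div deg v)"
          using dn by (metis less_imp_le mod_less_divisor mult_le_mono2 nat_mult_1_right order_trans)
        then have "n \<le> 2 * (deg v * (n div deg v))"
          using mult_div_mod_eq[of "deg v" n] by linarith
        then show ?thesis by (metis of_nat_le_iff of_nat_mult of_nat_numeral)
      qed
      then have "1 / 2 \<le> x * real (n div deg v)" using n_pos by (simp add: x_def field_simps)
      moreover have "2 * lg \<le> real K"
        unfolding K_def using lg_pos by (simp add: less_imp_le) linarith
      ultimately have "2 * lg * (1 / 2) \<le> real K * (x * real (n div deg v))"
        using lg_pos by (intro mult_mono) auto
      then show ?thesis by (simp add: mult_ac)
    qed
    also have "\<dots> = \<delta> / real n"
      using \<delta> n_pos by (simp add: lg_def exp_minus)
    finally show ?thesis .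
  qed
  have "{r. \<not> discovers r} \<subseteq> (\<Union>v\<in>{v\<in>V. th < deg v}. miss v)"
    by (auto simp: discovers_def miss_def)
  then have "measure ?S {r. \<not> discovers r} \<le> measure ?S (\<Union>v\<in>{v\<in>V. th < deg v}. miss v)"
    using mm by (intro S.finite_measure_mono) auto
  also have "\<dots> \<le> (\<Sum>v\<in>{v\<in>V. th < deg v}. measure ?S (miss v))"
    using mm by (intro S.finite_measure_subadditive_finite) auto
  also have "\<dots> \<le> real (card {v\<in>V. th < deg v}) * (\<delta> / real n)"
    using miss by (intro sum_bounded_above) auto
  also have "\<dots> \<le> real n * (\<delta> / real n)"
  proof (intro mult_right_mono)
    show "real (card {v\<in>V. th < deg v}) \<le> real n"
      unfolding nverts_def by (simp, intro card_mono) auto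
  qed (use \<delta> in auto)
  also have "\<dots> = \<delta>" using n_pos by simp
  finally have "measure ?S {r. \<not> discovers r} \<le> \<delta>" .
  moreover have "measure ?S {r. \<not> discovers r} = 1 - measure ?S {r. discovers r}"
    using S.prob_compl[of "{r. discovers r}"] measurable_discovers
    by (simp add: pred_def Compl_eq_Diff_UNIV[symmetric] Collect_neg_eq[symmetric])
  ultimately show ?thesis by simp
qed

end

section \<open>Integration over coins and hash values\<close>

lemma AE_coins: "AE r in stream_space unif. sset r \<subseteq> {0..<1}"
proof -
  have "AE r in stream_space unif. stream_all (\<lambda>u. u \<in> {0..<1}) r"
    by (rule U.AE_stream_all) (use AE_unif in auto)
  then show ?thesis by (rule eventually_mono) (auto simp: stream_all_def sset_range)
qed

lemma sets_coins: "{r. sset r \<subseteq> {0..<1}} \<in> sets (stream_space unif)"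
proof -
  have "streams {0..<1} \<in> sets (stream_space unif)" by (rule streams_sets) simp
  moreover have "{r. sset r \<subseteq> {0..<1}} = streams {0..<1::real}"
    by (intro set_eqI) (simp only: mem_Collect_eq streams_iff_sset)
  ultimately show ?thesis by simp
qed

lemma nn_integral_component:
  assumes "u \<in> V" "finite V" and g: "g \<in> borel_measurable unif"
  shows "(\<integral>\<^sup>+ h. g (h u) \<partial>(\<Pi>\<^sub>M v\<in>V. unif)) = (\<integral>\<^sup>+ y. g y \<partial>unif)"
proof -
  interpret P: product_sigma_finite "\<lambda>v. unif" ..
  have "(\<integral>\<^sup>+ h. g (h u) \<partial>(\<Pi>\<^sub>M v\<in>V. unif)) = (\<integral>\<^sup>+ h. (\<Prod>v\<in>V. if v = u then g (h v) else 1) \<partial>(\<Pi>\<^sub>M v\<in>V. unif))"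
    using assms by (simp add: prod.delta)
  also have "\<dots> = (\<Prod>v\<in>V. \<integral>\<^sup>+ y. (if v = u then g y else 1) \<partial>unif)"
    by (rule P.product_nn_integral_prod) (use assms in auto)
  also have "\<dots> = (\<Prod>v\<in>V. if v = u then (\<integral>\<^sup>+ y. g y \<partial>unif) else 1)"
    by (intro prod.cong) (auto simp: U.emeasure_space_1[simplified])
  also have "\<dots> = (\<integral>\<^sup>+ y. g y \<partial>unif)" using assms by (simp add: prod.delta)
  finally show ?thesis .
qed

lemma ennreal_combine:
  assumes "0 \<le> a" "0 \<le> b" "0 \<le> c"
  shows "of_nat k + 30 * ennreal a + 20 * (ennreal b + ennreal c) = ennreal (real k + 30 * a + 20 * (b + c))"
  using assms by (simp add: ennreal_mult' ennreal_of_nat_eq_real_of_nat)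

context sampler
begin

abbreviation "hashes \<equiv> \<Pi>\<^sub>M v\<in>V. unif"

definition run :: "('v \<Rightarrow> real) \<Rightarrow> real stream \<Rightarrow> ('v option \<times> nat) list" where
  "run h r = visits p slots \<sigma> (tasks h (found h r m)) (sdrop m r)"

lemma halts_run:
  assumes "sset r \<subseteq> {0..<1}"
  obtains k s where "halts sampler_program G p t \<delta> (h, r) k s" "length (out s) = t"
    "recorded s = emitted h (run h r)"
    "k \<le> 3 * t + 20 + (\<Sum>i<m. 10 * length (cand h r i) + 20) + 20 * length (found h r m) + 20 * length (run h r)"
  using program_spec[OF assms, of h] unfolding wpt_def halts_def run_def[symmetric] by auto

lemma included_iff:
  assumes "sset r \<subseteq> {0..<1}" "(h, r) \<in> space (rspace G)"
  shows "(h, r) \<in> included sampler_program G p t \<delta> e i \<longleftrightarrow> (e, i) \<in> emitted h (run h r)"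
proof -
  obtain k s where s: "halts sampler_program G p t \<delta> (h, r) k s" "recorded s = emitted h (run h r)"
    using halts_run[OF assms(1)] by metis
  have "(h, r) \<in> included sampler_program G p t \<delta> e i \<longleftrightarrow> i < length (out s) \<and> e \<in> set (out s ! i)"
    using assms(2) by (auto simp: included_def returned_eq[OF s(1)])
  also have "\<dots> \<longleftrightarrow> (e, i) \<in> recorded s" by (simp add: recorded_def)
  finally show ?thesis using s(2) by simp
qed

lemma returned_run:
  assumes "sset r \<subseteq> {0..<1}"
  shows "\<exists>Ts. returned sampler_program G p t \<delta> (h, r) = Some Ts \<and> length Ts = t \<and> (\<forall>T\<in>set Ts. T \<subseteq> oriented G)"
proof -
  obtain k s where s: "halts sampler_program G p t \<delta> (h, r) k s" "length (out s) = t"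
    "recorded s = emitted h (run h r)"
    using halts_run[OF assms] by metis
  have "recorded s \<subseteq> oriented G \<times> {..<t}"
    unfolding s(3) run_def by (rule emitted_subset[OF found_subset])
  then have "set (out s ! i) \<subseteq> oriented G" if "i < length (out s)" for i
    using that by (auto simp: recorded_def)
  then have "set xs \<subseteq> oriented G" if "xs \<in> set (out s)" for xs
    using that by (metis in_set_conv_nth)
  then show ?thesis using s(2) by (auto simp: returned_eq[OF s(1)])
qed

text \<open>A condition on the coins alone, so conditioning on it leaves the hash values independent
  and uniform. The range condition holds almost surely and is included because the program then
  halts at every point of the event, as the final statement demands.\<close>

definition good :: "real stream set" where
  "good = {r. sset r \<subseteq> {0..<1} \<and> discovers r}"

lemma sets_good: "good \<in> sets (stream_space unif)"
proof -
  have "good = {r. sset r \<subseteq> {0..<1}} \<inter> {r. discovers r}" by (auto simp: good_def)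
  then show ?thesis using sets_coins measurable_discovers by (simp add: pred_def)
qed

lemma AE_good: "AE r in stream_space unif. r \<in> good \<longleftrightarrow> discovers r"
  using AE_coins by (rule eventually_mono) (auto simp: good_def)

lemma sset_stake_shift: "sset r \<subseteq> A \<Longrightarrow> sset r' \<subseteq> A \<Longrightarrow> sset (stake k r @- r') \<subseteq> A"
  using sset_shift[of "stake k r" "sdrop k r"] by (auto simp: stake_sdrop)

lemma run_shift: "run h (stake m r @- r') = visits p slots \<sigma> (tasks h (found h r m)) r'"
  unfolding run_def by (simp add: found_shift sdrop_shift)

text \<open>For fixed hash values the first \<open>m\<close> coins determine the list and whether
  the search succeeds, and the remaining coins are fresh. On success they contribute
  \<open>w h\<close> whatever the prefix was, so the prefix contributes only the probability of
  \<open>good\<close>. Integrating \<open>w\<close> over the hash values leaves p ^ card X.\<close>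

lemma emeasure_included:
  assumes X: "X \<subseteq> oriented G \<times> {..<t}"
  shows "emeasure (rspace G) {\<omega> \<in> space (rspace G). snd \<omega> \<in> good \<and>
      (\<forall>x\<in>X. \<omega> \<in> included sampler_program G p t \<delta> (fst x) (snd x))} =
    ennreal (p ^ card X) * emeasure (stream_space unif) good"
proof -
  let ?S = "stream_space unif"
  have "finite (oriented G)"
    by (rule finite_subset[of _ "V \<times> V"]) (auto dest: orientedD(1,2))
  then have finX: "finite X" using X finite_subset by fastforce
  define A where "A = {\<omega> \<in> space (rspace G). snd \<omega> \<in> good \<and>
      (\<forall>x\<in>X. \<omega> \<in> included sampler_program G p t \<delta> (fst x) (snd x))}"
  have A: "A \<in> sets (hashes \<Otimes>\<^sub>M ?S)"
  proof -
    note [measurable] = sets_good included_measurable[OF distinctV]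
    have [measurable]: "snd \<in> measurable (rspace G) ?S" unfolding rspace_def by measurable
    have "A \<in> sets (rspace G)" unfolding A_def using finX by measurable
    then show ?thesis by (simp add: rspace_def)
  qed
  define w where "w h = ennreal (p ^ card X * (\<Prod>v\<in>V. hash_weight X v (h v)))" for h
  have inner: "(\<integral>\<^sup>+ r. indicator A (h, r) \<partial>?S) = w h * emeasure ?S good" if h: "h \<in> space hashes" for h
  proof -
    have sp: "(h, r) \<in> space (rspace G)" for r using h by (simp add: rspace_def space_pair_measure)
    define f where "f r = (indicator A (h, r) :: ennreal)" for r
    have "f \<in> borel_measurable ?S"
    proof -
      have "Pair h -` A \<in> sets ?S" by (rule sets_Pair1[OF A])
      moreover have "f = indicator (Pair h -` A)" by (auto simp: f_def indicator_def fun_eq_iff)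
      ultimately show ?thesis by simp
    qed
    then have "(\<integral>\<^sup>+ r. f r \<partial>?S) = (\<integral>\<^sup>+ r. \<integral>\<^sup>+ r'. f (stake m r @- r') \<partial>?S \<partial>?S)"
      by (rule nn_integral_stake)
    also have "\<dots> = (\<integral>\<^sup>+ r. w h * indicator good r \<partial>?S)"
    proof (rule nn_integral_cong_AE, rule eventually_mono[OF AE_coins])
      fix r :: "real stream" assume r: "sset r \<subseteq> {0..<1}"
      let ?L = "found h r m"
      have "(\<integral>\<^sup>+ r'. f (stake m r @- r') \<partial>?S) = (\<integral>\<^sup>+ r'. (if discovers r then
          indicator {r'. X \<subseteq> emitted h (visits p slots \<sigma> (tasks h ?L) r')} r' else 0) \<partial>?S)"
      proof (rule nn_integral_cong_AE, rule eventually_mono[OF AE_coins])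
        fix r' :: "real stream" assume r': "sset r' \<subseteq> {0..<1}"
        note rr = sset_stake_shift[OF r r', of m]
        have "(h, stake m r @- r') \<in> A \<longleftrightarrow> discovers r \<and> X \<subseteq> emitted h (visits p slots \<sigma> (tasks h ?L) r')"
          using rr sp included_iff[OF rr sp]
          by (auto simp: A_def good_def discovers_shift run_shift[symmetric] subset_iff)
        then show "f (stake m r @- r') = (if discovers r then
            indicator {r'. X \<subseteq> emitted h (visits p slots \<sigma> (tasks h ?L) r')} r' else 0)"
          by (simp add: f_def indicator_def)
      qed
      also have "\<dots> = (if discovers r then w h else 0)"
      proof (cases "discovers r")
        case True
        then show ?thesis
          using nn_integral_emitted[OF X distinct_found found_subset discovers_found[OF True], where h = h]
          by (simp add: w_def)
      qed simp
      also have "\<dots> = w h * indicator good r" using r by (simp add: good_def)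
      finally show "(\<integral>\<^sup>+ r'. f (stake m r @- r') \<partial>?S) = w h * indicator good r" .
    qed
    also have "\<dots> = w h * emeasure ?S good" using sets_good by (simp add: nn_integral_cmult_indicator)
    finally show ?thesis by (simp add: f_def)
  qed
  have w: "w h = ennreal (p ^ card X) * (\<Prod>v\<in>V. ennreal (hash_weight X v (h v)))" for h
  proof -
    have "0 \<le> hash_weight X v y" for v y
      using q_pos by (auto simp: hash_weight_def \<sigma>_def)
    then show ?thesis using p by (simp add: w_def ennreal_mult' prod_ennreal)
  qed
  have wm: "(\<lambda>h. \<Prod>v\<in>V. ennreal (hash_weight X v (h v))) \<in> borel_measurable hashes"
  proof (rule borel_measurable_prod_ennreal)
    fix v assume v: "v \<in> V"
    have "(\<lambda>y. ennreal (hash_weight X v y)) \<in> borel_measurable unif" unfolding hash_weight_def by measurable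
    from measurable_compose[OF measurable_component_singleton[OF v] this]
    show "(\<lambda>h. ennreal (hash_weight X v (h v))) \<in> borel_measurable hashes" .
  qed
  have "emeasure (rspace G) A = (\<integral>\<^sup>+ h. \<integral>\<^sup>+ r. indicator A (h, r) \<partial>?S \<partial>hashes)"
    unfolding rspace_def by (rule S.emeasure_pair_measure[OF A])
  also have "\<dots> = (\<integral>\<^sup>+ h. ennreal (p ^ card X) * (\<Prod>v\<in>V. ennreal (hash_weight X v (h v))) * emeasure ?S good \<partial>hashes)"
    using inner w by (intro nn_integral_cong) simp
  also have "\<dots> = ennreal (p ^ card X) * emeasure ?S good"
    using wm nn_integral_hash_weight[of X] by (simp add: nn_integral_multc nn_integral_cmult)
  finally show ?thesis unfolding A_def .
qed

lemma measure_good: "1 - \<delta> \<le> measure (stream_space unif) good"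
proof -
  have "measure (stream_space unif) good = measure (stream_space unif) {r. discovers r}"
    by (rule S.finite_measure_eq_AE)
      (use AE_good sets_good measurable_discovers in \<open>auto simp: pred_def\<close>)
  then show ?thesis using prob_discovers by simp
qed

subsection \<open>The expected running time\<close>

text \<open>Counts the candidates vertex by vertex: for a given \<open>u\<close> the hash test is
  fixed, and the random probe is one of its neighbours with probability deg u / n.\<close>

lemma nn_integral_cand:
  "(\<integral>\<^sup>+ r. of_nat (length (cand h r i)) \<partial>stream_space unif) =
    (\<Sum>u\<in>V. indicator {y. y < tau i} (h u) * ennreal (real (deg u) / real n))"
  "(\<lambda>r. of_nat (length (cand h r i)) :: ennreal) \<in> borel_measurable (stream_space unif)"
proof -
  let ?S = "stream_space unif"
  define B where "B u = {y. {probe y, u} \<in> edges G}" for u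
  have B: "B u \<in> sets borel" for u
    using measurable_probe[of "\<lambda>w. {w, u} \<in> edges G"] by (simp add: B_def pred_def)
  have eq: "(of_nat (length (cand h r i)) :: ennreal) =
      (\<Sum>u\<in>V. indicator {y. y < tau i} (h u) * indicator (B u) (r !! i))" for r
  proof -
    have "distinct (cand h r i)" using distinct_neighbors by (simp add: cand_def)
    then have "length (cand h r i) = card (set (cand h r i))" by (rule distinct_card[symmetric])
    also have "set (cand h r i) = {u \<in> V. h u < tau i \<and> {probe (r !! i), u} \<in> edges G}"
      by (auto simp: cand_def set_neighbors)
    finally have "(of_nat (length (cand h r i)) :: ennreal) =
        (\<Sum>u\<in>{u \<in> V. h u < tau i \<and> {probe (r !! i), u} \<in> edges G}. 1)" by simp
    also have "\<dots> = (\<Sum>u\<in>V. if h u < tau i \<and> {probe (r !! i), u} \<in> edges G then 1 else 0)"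
      by (subst sum.inter_filter) auto
    also have "\<dots> = (\<Sum>u\<in>V. indicator {y. y < tau i} (h u) * indicator (B u) (r !! i))"
      by (intro sum.cong) (auto simp: B_def indicator_def)
    finally show ?thesis .
  qed
  have m: "(\<lambda>r. indicator (B u) (r !! i) :: ennreal) \<in> borel_measurable ?S" for u
  proof -
    have "(indicator (B u) :: real \<Rightarrow> ennreal) \<in> borel_measurable unif" using B by simp
    from measurable_compose[OF measurable_snth this] show ?thesis .
  qed
  show "(\<lambda>r. of_nat (length (cand h r i)) :: ennreal) \<in> borel_measurable ?S"
    unfolding eq using m by (intro borel_measurable_sum borel_measurable_times_ennreal) auto
  have "(\<integral>\<^sup>+ r. of_nat (length (cand h r i)) \<partial>?S) =
      (\<Sum>u\<in>V. \<integral>\<^sup>+ r. indicator {y. y < tau i} (h u) * indicator (B u) (r !! i) \<partial>?S)"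
    unfolding eq using m by (subst nn_integral_sum) auto
  also have "\<dots> = (\<Sum>u\<in>V. indicator {y. y < tau i} (h u) * ennreal (real (deg u) / real n))"
  proof (intro sum.cong refl)
    fix u
    have "(\<integral>\<^sup>+ r. indicator (B u) (r !! i) \<partial>?S) = emeasure unif (B u)"
      using nn_integral_snth[of "indicator (B u)" i] B by simp
    then show "(\<integral>\<^sup>+ r. indicator {y. y < tau i} (h u) * indicator (B u) (r !! i) \<partial>?S) =
        indicator {y. y < tau i} (h u) * ennreal (real (deg u) / real n)"
      using m[of u] by (simp add: nn_integral_cmult B_def emeasure_probe_neighbor)
  qed
  finally show "(\<integral>\<^sup>+ r. of_nat (length (cand h r i)) \<partial>?S) =
    (\<Sum>u\<in>V. indicator {y. y < tau i} (h u) * ennreal (real (deg u) / real n))" .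
qed

text \<open>The expected number of visits of a heavy row for a given hash value: t deg v slots, each
  visited with probability p / \<sigma>. Its mean over the hash value is q deg v, since the row is
  examined with probability \<sigma>.\<close>

definition row_cost :: "'v \<Rightarrow> real \<Rightarrow> real" where
  "row_cost v y = (if th < deg v \<and> y < \<sigma> (Some v) then q * real (deg v) / \<sigma> (Some v) else 0)"

lemma row_cost_nonneg: "0 \<le> row_cost v y"
  using q_pos by (auto simp: row_cost_def \<sigma>_def)

lemma nn_integral_run_le:
  assumes "distinct L" "set L \<subseteq> V"
  shows "(\<integral>\<^sup>+ r. of_nat (length (visits p slots \<sigma> (tasks h L) r)) \<partial>stream_space unif) \<le>
    ennreal (q * real (n * th) + (\<Sum>v\<in>V. row_cost v (h v)))"
proof -
  have "(\<integral>\<^sup>+ r. of_nat (length (visits p slots \<sigma> (tasks h L) r)) \<partial>stream_space unif) =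
      ennreal (\<Sum>a\<in>set (tasks h L). real (slots a) * (p / \<sigma> a))"
    by (rule nn_integral_length_visits[OF p distinct_tasks[OF assms(1)] task_bounds(1)])
  also have "\<dots> \<le> ennreal (q * real (n * th) + (\<Sum>v\<in>V. row_cost v (h v)))"
  proof (rule ennreal_leI)
    let ?F = "set (filter (selected h) L)"
    have "(\<Sum>a\<in>set (tasks h L). real (slots a) * (p / \<sigma> a)) =
        real (slots None) * (p / \<sigma> None) + (\<Sum>a\<in>Some ` ?F. real (slots a) * (p / \<sigma> a))"
      by (simp add: tasks_def)
    also have "(\<Sum>a\<in>Some ` ?F. real (slots a) * (p / \<sigma> a)) = (\<Sum>v\<in>?F. row_cost v (h v))"
      by (subst sum.reindex) (auto simp: slots_def row_cost_def selected_def q_def intro!: sum.cong)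
    also have "\<dots> \<le> (\<Sum>v\<in>V. row_cost v (h v))"
      using assms(2) row_cost_nonneg by (intro sum_mono2) auto
    also have "real (slots None) * (p / \<sigma> None) = q * real (n * th)"
      by (simp add: slots_def \<sigma>_def q_def)
    finally show "(\<Sum>a\<in>set (tasks h L). real (slots a) * (p / \<sigma> a)) \<le>
       q * real (n * th) + (\<Sum>v\<in>V. row_cost v (h v))" by simp
  qed
  finally show ?thesis .
qed

lemma handshake: "(\<Sum>v\<in>V. real (deg v)) = 2 * real (nedges G)"
proof -
  have E: "e \<in> edges G \<Longrightarrow> e \<subseteq> V \<and> card e = 2" for e
    using wf by (auto simp: wf_hgraph_def card_insert_if)
  have fin: "finite (edges G)" using E by (intro finite_subset[of "edges G" "Pow V"]) auto
  have d: "deg v = card {e \<in> edges G. v \<in> e}" if "v \<in> V" for v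
    unfolding Defs.degree_def
  proof (rule bij_betw_same_card[of "\<lambda>u. {v, u}"], rule bij_betw_imageI)
    show "inj_on (\<lambda>u. {v, u}) {u \<in> V. {v, u} \<in> edges G}" by (auto simp: inj_on_def doubleton_eq_iff)
    show "(\<lambda>u. {v, u}) ` {u \<in> V. {v, u} \<in> edges G} = {e \<in> edges G. v \<in> e}"
    proof (intro equalityI subsetI)
      fix e assume "e \<in> {e \<in> edges G. v \<in> e}"
      then have e: "e \<in> edges G" "v \<in> e" by auto
      then obtain a b where "e = {a, b}" using E[of e] by (auto simp: card_2_iff)
      with e have "\<exists>u. e = {v, u}" by auto
      then show "e \<in> (\<lambda>u. {v, u}) ` {u \<in> V. {v, u} \<in> edges G}" using e E[of e] by auto
    qed auto
  qed
  have "(\<Sum>v\<in>V. deg v) = (\<Sum>v\<in>V. \<Sum>e\<in>edges G. if v \<in> e then 1 else 0)"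
    using fin d by (intro sum.cong) (auto simp: sum.If_cases Int_def)
  also have "\<dots> = (\<Sum>e\<in>edges G. \<Sum>v\<in>V. if v \<in> e then 1 else 0)" by (rule sum.swap)
  also have "\<dots> = (\<Sum>e\<in>edges G. 2)"
  proof (intro sum.cong refl)
    fix e assume "e \<in> edges G"
    then have "V \<inter> e = e" "card e = 2" using E by auto
    then show "(\<Sum>v\<in>V. if v \<in> e then 1 else 0) = (2 :: nat)" by (simp add: sum.If_cases)
  qed
  finally have "(\<Sum>v\<in>V. deg v) = 2 * nedges G" by (simp add: nedges_def)
  then show ?thesis by (metis of_nat_mult of_nat_numeral of_nat_sum)
qed

text \<open>For fixed hash values the coins are split at \<open>m\<close>, the tail paying for the
  rows and the prefix for the scans. The hash values are integrated last; probes and hash values are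
  independent, so probabilities multiply, and \<open>handshake\<close> sums the degrees.\<close>

lemma nn_integral_runtime:
  "(\<integral>\<^sup>+ \<omega>. runtime sampler_program G p t \<delta> \<omega> \<partial>rspace G) \<le>
    ennreal (real (3 * t + 20 + 20 * m) + 30 * (\<Sum>i<m. tau i * (2 * real (nedges G) / real n)) +
      20 * (q * real (n * th) + q * (2 * real (nedges G))))"
proof -
  let ?S = "stream_space unif"
  define RT where "RT = runtime sampler_program G p t \<delta>"
  have RT: "RT \<in> borel_measurable (hashes \<Otimes>\<^sub>M ?S)"
    using runtime_measurable[OF distinctV] by (simp add: RT_def rspace_def)
  define c0 where "c0 = 3 * t + 20 + 20 * m"
  define Z where "Z h = ennreal (q * real (n * th) + (\<Sum>v\<in>V. row_cost v (h v)))" for h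
  have n0: "0 \<le> tau i" "0 \<le> real (deg u) / real n" for i u using q_pos by (auto simp: tau_def)
  have inner: "(\<integral>\<^sup>+ r. RT (h, r) \<partial>?S) \<le> of_nat c0 + 30 * (\<Sum>i<m. \<Sum>u\<in>V. indicator {y. y < tau i} (h u) *
      ennreal (real (deg u) / real n)) + 20 * Z h" if h: "h \<in> space hashes" for h
  proof -
    define N where "N r = (\<Sum>i<m. length (cand h r i))" for r
    have Nm: "(\<lambda>r. of_nat (N r) :: ennreal) \<in> borel_measurable ?S"
      unfolding N_def of_nat_sum by (intro borel_measurable_sum nn_integral_cand(2))
    have "(\<lambda>r. RT (h, r)) \<in> borel_measurable ?S"
      by (rule measurable_compose[OF measurable_Pair1'[OF h] RT])
    then have "(\<integral>\<^sup>+ r. RT (h, r) \<partial>?S) = (\<integral>\<^sup>+ r. \<integral>\<^sup>+ r'. RT (h, stake m r @- r') \<partial>?S \<partial>?S)"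
      by (rule nn_integral_stake)
    also have "\<dots> \<le> (\<integral>\<^sup>+ r. of_nat c0 + 30 * of_nat (N r) + 20 * Z h \<partial>?S)"
    proof (rule nn_integral_mono_AE, rule eventually_mono[OF AE_coins])
      fix r :: "real stream" assume r: "sset r \<subseteq> {0..<1}"
      let ?v = "\<lambda>r'. visits p slots \<sigma> (tasks h (found h r m)) r'"
      have "(\<integral>\<^sup>+ r'. RT (h, stake m r @- r') \<partial>?S) \<le>
          (\<integral>\<^sup>+ r'. of_nat (c0 + 30 * N r) + 20 * of_nat (length (?v r')) \<partial>?S)"
      proof (rule nn_integral_mono_AE, rule eventually_mono[OF AE_coins])
        fix r' :: "real stream" assume r': "sset r' \<subseteq> {0..<1}"
        let ?r = "stake m r @- r'"
        obtain k s where ks: "halts sampler_program G p t \<delta> (h, ?r) k s"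
          "k \<le> 3 * t + 20 + (\<Sum>i<m. 10 * length (cand h ?r i) + 20) + 20 * length (found h ?r m) + 20 * length (run h ?r)"
          using halts_run[OF sset_stake_shift[OF r r', of m]] by metis
        have c: "(\<Sum>i<m. 10 * length (cand h ?r i) + 20) = 10 * N r + 20 * m"
        proof -
          have "(\<Sum>i<m. 10 * length (cand h ?r i) + 20) = (\<Sum>i<m. 10 * length (cand h r i) + 20)"
            by (intro sum.cong) (auto simp: cand_def)
          then show ?thesis by (simp add: N_def sum.distrib sum_distrib_left)
        qed
        have f: "length (found h r m) \<le> N r"
          using length_adjoin_all[of "[]" "concat (map (cand h r) [0..<m])"]
          by (simp add: found_def N_def length_concat comp_def interv_sum_list_conv_sum_set_nat atLeast0LessThan)
        \<comment> \<open>Each candidate costs 10 units in the scan, and the vertices found are at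
          most as many as the candidates, at 20 units each in the heavy loop.\<close>
        have "k \<le> c0 + 30 * N r + 20 * length (?v r')"
          using ks(2) f unfolding c run_shift found_shift by (simp add: c0_def)
        then have "(of_nat k :: ennreal) \<le> of_nat (c0 + 30 * N r + 20 * length (?v r'))"
          by (rule of_nat_mono)
        then show "RT (h, ?r) \<le> of_nat (c0 + 30 * N r) + 20 * of_nat (length (?v r'))"
          unfolding RT_def runtime_eq[OF ks(1)] by simp
      qed
      also have "\<dots> = of_nat (c0 + 30 * N r) + 20 * (\<integral>\<^sup>+ r'. of_nat (length (?v r')) \<partial>?S)"
      proof -
        have "(\<lambda>r'. of_nat (length (?v r')) :: ennreal) \<in> borel_measurable ?S"
          by (rule measurable_compose[OF measurable_visits]) simp
        then show ?thesis by (simp add: nn_integral_add nn_integral_cmult S.emeasure_space_1[simplified])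
      qed
      also have "\<dots> \<le> of_nat (c0 + 30 * N r) + 20 * Z h"
        unfolding Z_def by (intro add_left_mono mult_left_mono nn_integral_run_le distinct_found found_subset) simp
      finally show "(\<integral>\<^sup>+ r'. RT (h, stake m r @- r') \<partial>?S) \<le> of_nat c0 + 30 * of_nat (N r) + 20 * Z h" by simp
    qed
    also have "\<dots> = of_nat c0 + 30 * (\<integral>\<^sup>+ r. of_nat (N r) \<partial>?S) + 20 * Z h"
      using Nm by (simp add: nn_integral_add nn_integral_cmult S.emeasure_space_1[simplified])
    also have "(\<integral>\<^sup>+ r. of_nat (N r) \<partial>?S) =
        (\<Sum>i<m. \<Sum>u\<in>V. indicator {y. y < tau i} (h u) * ennreal (real (deg u) / real n))"
      unfolding N_def of_nat_sum by (subst nn_integral_sum) (auto simp: nn_integral_cand)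
    finally show ?thesis .
  qed
  have comp: "(\<lambda>h. g (h u)) \<in> borel_measurable hashes" if "u \<in> V" "g \<in> borel_measurable borel" for u and g :: "real \<Rightarrow> ennreal"
  proof -
    have "g \<in> borel_measurable unif" using that by simp
    from measurable_compose[OF measurable_component_singleton[OF that(1)] this] show ?thesis .
  qed
  have tm: "(\<lambda>h. indicator {y. y < tau i} (h u) * ennreal (real (deg u) / real n)) \<in> borel_measurable hashes"
    if "u \<in> V" for i u
    by (rule comp[OF that]) measurable
  have rm: "(\<lambda>h. ennreal (row_cost v (h v))) \<in> borel_measurable hashes" if "v \<in> V" for v
    by (rule comp[OF that]) (unfold row_cost_def, measurable)
  have tI: "(\<integral>\<^sup>+ h. indicator {y. y < tau i} (h u) * ennreal (real (deg u) / real n) \<partial>hashes) \<le>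
      ennreal (tau i * (real (deg u) / real n))" if u: "u \<in> V" for i u
  proof -
    have "(\<integral>\<^sup>+ h. indicator {y. y < tau i} (h u) * ennreal (real (deg u) / real n) \<partial>hashes) =
        (\<integral>\<^sup>+ y. indicator {y. y < tau i} y * ennreal (real (deg u) / real n) \<partial>unif)"
      by (rule nn_integral_component[OF u]) auto
    also have "\<dots> = emeasure unif {y. y < tau i} * ennreal (real (deg u) / real n)"
      by (simp add: nn_integral_multc)
    \<comment> \<open>In early rounds \<open>tau i\<close> may exceed 1; it then still bounds the
      probability, but no longer equals it.\<close>
    also have "\<dots> \<le> ennreal (tau i) * ennreal (real (deg u) / real n)"
    proof (rule mult_right_mono, cases "tau i \<le> 1")
      case True
      then show "emeasure unif {y. y < tau i} \<le> ennreal (tau i)" using n0 by (simp add: emeasure_unif_less)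
    next
      case False
      then have "1 \<le> ennreal (tau i)" by simp
      then show "emeasure unif {y. y < tau i} \<le> ennreal (tau i)" by (rule order_trans[OF U.emeasure_le_1])
    qed simp
    finally show ?thesis unfolding ennreal_mult'[OF n0(1)] .
  qed
  have rI: "(\<integral>\<^sup>+ h. ennreal (row_cost v (h v)) \<partial>hashes) \<le> ennreal (q * real (deg v))" if v: "v \<in> V" for v
  proof (cases "th < deg v")
    case True
    then have s: "0 < \<sigma> (Some v)" "\<sigma> (Some v) \<le> 1" using q_pos by (auto simp: \<sigma>_def)
    have "(\<integral>\<^sup>+ h. ennreal (row_cost v (h v)) \<partial>hashes) = (\<integral>\<^sup>+ y. ennreal (row_cost v y) \<partial>unif)"
      by (rule nn_integral_component[OF v]) (auto simp: row_cost_def)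
    also have "\<dots> = (\<integral>\<^sup>+ y. ennreal (q * real (deg v) / \<sigma> (Some v)) * indicator {y. y < \<sigma> (Some v)} y \<partial>unif)"
      using True by (intro nn_integral_cong) (auto simp: row_cost_def indicator_def)
    also have "\<dots> = ennreal (q * real (deg v) / \<sigma> (Some v)) * ennreal (\<sigma> (Some v))"
      using s by (subst nn_integral_cmult_indicator) (auto simp: emeasure_unif_less)
    also have "\<dots> = ennreal (q * real (deg v))"
      using s q_pos by (subst ennreal_mult'[symmetric]) auto
    finally show ?thesis by simp
  qed (simp add: row_cost_def)
  have Zs: "Z h = ennreal (q * real (n * th)) + (\<Sum>v\<in>V. ennreal (row_cost v (h v)))" for h
    unfolding Z_def using q_pos row_cost_nonneg by (simp add: ennreal_plus sum_nonneg sum_ennreal)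
  interpret H: prob_space hashes by (intro prob_space_PiM prob_space_unif)
  have "(\<integral>\<^sup>+ \<omega>. RT \<omega> \<partial>rspace G) = (\<integral>\<^sup>+ h. \<integral>\<^sup>+ r. RT (h, r) \<partial>?S \<partial>hashes)"
    unfolding rspace_def by (rule S.nn_integral_fst[OF RT, symmetric])
  also have "\<dots> \<le> (\<integral>\<^sup>+ h. of_nat c0 + 30 * (\<Sum>i<m. \<Sum>u\<in>V. indicator {y. y < tau i} (h u) *
      ennreal (real (deg u) / real n)) + 20 * (ennreal (q * real (n * th)) + (\<Sum>v\<in>V. ennreal (row_cost v (h v)))) \<partial>hashes)"
    unfolding Zs[symmetric] by (intro nn_integral_mono inner)
  also have "\<dots> = of_nat c0 + 30 * (\<Sum>i<m. \<Sum>u\<in>V. \<integral>\<^sup>+ h. indicator {y. y < tau i} (h u) *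
      ennreal (real (deg u) / real n) \<partial>hashes) + 20 * (ennreal (q * real (n * th)) +
      (\<Sum>v\<in>V. \<integral>\<^sup>+ h. ennreal (row_cost v (h v)) \<partial>hashes))"
  proof -
    have 1: "(\<lambda>h. \<Sum>i<m. \<Sum>u\<in>V. indicator {y. y < tau i} (h u) * ennreal (real (deg u) / real n)) \<in> borel_measurable hashes"
      by (intro borel_measurable_sum tm)
    have 2: "(\<lambda>h. \<Sum>v\<in>V. ennreal (row_cost v (h v))) \<in> borel_measurable hashes"
      by (intro borel_measurable_sum rm)
    have 3: "(\<integral>\<^sup>+ h. (\<Sum>i<m. \<Sum>u\<in>V. indicator {y. y < tau i} (h u) * ennreal (real (deg u) / real n)) \<partial>hashes) =
       (\<Sum>i<m. \<Sum>u\<in>V. \<integral>\<^sup>+ h. indicator {y. y < tau i} (h u) * ennreal (real (deg u) / real n) \<partial>hashes)"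
      by (subst nn_integral_sum, intro borel_measurable_sum tm, assumption)
        (intro sum.cong refl nn_integral_sum tm)
    have 4: "(\<integral>\<^sup>+ h. (\<Sum>v\<in>V. ennreal (row_cost v (h v))) \<partial>hashes) =
       (\<Sum>v\<in>V. \<integral>\<^sup>+ h. ennreal (row_cost v (h v)) \<partial>hashes)"
      by (rule nn_integral_sum) (rule rm)
    show ?thesis
      using 1 2 unfolding 3[symmetric] 4[symmetric]
      by (simp add: nn_integral_add nn_integral_cmult H.emeasure_space_1)
  qed
  also have "\<dots> \<le> of_nat c0 + 30 * (\<Sum>i<m. \<Sum>u\<in>V. ennreal (tau i * (real (deg u) / real n))) +
      20 * (ennreal (q * real (n * th)) + (\<Sum>v\<in>V. ennreal (q * real (deg v))))"
    by (intro add_mono mult_left_mono sum_mono tI rI) auto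
  also have "(\<Sum>i<m. \<Sum>u\<in>V. ennreal (tau i * (real (deg u) / real n))) =
      ennreal (\<Sum>i<m. tau i * (2 * real (nedges G) / real n))"
  proof -
    have "(\<Sum>u\<in>V. ennreal (tau i * (real (deg u) / real n))) = ennreal (tau i * (2 * real (nedges G) / real n))" for i
      using n0 by (subst sum_ennreal)
        (auto simp: sum_distrib_left[symmetric] sum_divide_distrib[symmetric] handshake)
    then show ?thesis using n0 by (simp add: sum_ennreal)
  qed
  also have "(\<Sum>v\<in>V. ennreal (q * real (deg v))) = ennreal (q * (2 * real (nedges G)))"
    using q_pos by (subst sum_ennreal) (auto simp: sum_distrib_left[symmetric] handshake)
  also have "of_nat c0 + 30 * ennreal (\<Sum>i<m. tau i * (2 * real (nedges G) / real n)) +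
      20 * (ennreal (q * real (n * th)) + ennreal (q * (2 * real (nedges G)))) =
      ennreal (real c0 + 30 * (\<Sum>i<m. tau i * (2 * real (nedges G) / real n)) +
      20 * (q * real (n * th) + q * (2 * real (nedges G))))"
    by (rule ennreal_combine) (use n0 q_pos in \<open>auto intro!: sum_nonneg\<close>)
  finally show ?thesis unfolding RT_def c0_def .
qed

end

section \<open>Numerical estimate of the expected time\<close>

lemma sum_div_group:
  fixes f :: "nat \<Rightarrow> real"
  assumes "0 < k"
  shows "(\<Sum>i<k * l. f (i div k)) = real k * (\<Sum>j<l. f j)"
proof -
  have "(\<Sum>i\<in>{j * k..<j * k + k}. f (i div k)) = real k * f j" for j
  proof -
    have "i div k = j" if "i \<in> {j * k..<j * k + k}" for i
      using that assms by (intro div_nat_eqI) (auto simp: mult.commute)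
    then have "(\<Sum>i\<in>{j * k..<j * k + k}. f (i div k)) = (\<Sum>i\<in>{j * k..<j * k + k}. f j)"
      by (intro sum.cong) auto
    then show ?thesis by simp
  qed
  then show ?thesis
    using sum.nat_group[of "\<lambda>i. f (i div k)" k l] by (simp add: sum_distrib_left mult.commute)
qed

text \<open>Each new term 1/(l + 2) is at most ln ((l + 2)/(l + 1)), by ln x \<le> x - 1 at x = (l +
  1)/(l + 2).\<close>

lemma harmonic_le: "(\<Sum>j<Suc l. 1 / (real j + 1)) \<le> 1 + ln (real (Suc l))"
proof (induction l)
  case (Suc l)
  have "ln ((real l + 1) / (real l + 2)) \<le> (real l + 1) / (real l + 2) - 1"
    by (rule ln_le_minus_one) simp
  also have "\<dots> = - (1 / (real l + 2))" by (simp add: field_simps)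
  finally have "1 / (real l + 2) \<le> ln (real l + 2) - ln (real l + 1)"
    by (simp add: ln_div)
  with Suc show ?case by (simp add: add.commute)
qed simp

context sampler
begin

lemma time_bound:
  "real (3 * t + 20 + 20 * m) + 30 * (\<Sum>i<m. tau i * (2 * real (nedges G) / real n)) +
      20 * (q * real (n * th) + q * (2 * real (nedges G))) \<le>
   2000 * (sqrt (real t * p) * real n * sqrt (ln (real n) * ln (real n / \<delta>)) +
      real t * (1 + p * real (nedges G) * (ln (real n))\<^sup>2 * ln (real n / \<delta>)))"
proof -
  define e where "e = real (nedges G)"
  define l where "l = ln (real n)"
  have ln2: "1 / 2 \<le> ln (2 :: real)" using ln2_ge_two_thirds by simp
  have "ln 2 \<le> ln (real n)" using two by simp
  with ln2 lg_ge(2) have l: "1 / 2 \<le> l" "l \<le> lg" by (auto simp: l_def)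
  have lg: "1 / 2 \<le> lg" using l by simp
  have e: "0 \<le> e" by (simp add: e_def)
  have n: "0 < real n" using n_pos by simp
  \<comment> \<open>The common size of the number of probes and of the light visits. The term
    \<open>y\<close> of the claimed bound has the additional factor sqrt (ln n), which is at least
    1/2.\<close>
  define x where "x = real n * sqrt (q * lg)"
  define y where "y = sqrt q * real n * sqrt (l * lg)"
  have y0: "0 \<le> y" using q_pos l lg by (simp add: y_def)
  have xy: "x \<le> 2 * y"
  proof -
    have "sqrt (1 / 4) \<le> sqrt l" using l by (intro real_sqrt_le_mono) simp
    then have "1 \<le> 2 * sqrt l" by (simp add: real_sqrt_divide)
    then have "x * 1 \<le> x * (2 * sqrt l)" using q_pos lg by (intro mult_left_mono) (auto simp: x_def)
    also have "x * (2 * sqrt l) = 2 * y" by (simp add: x_def y_def real_sqrt_mult)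
    finally show ?thesis by simp
  qed
  have K: "real K \<le> 4 * lg"
  proof -
    have "real K \<le> 2 * lg + 1" unfolding K_def using lg_pos by simp
    then show ?thesis using lg by simp
  qed
  have ratio: "q * sqrt (lg / q) = sqrt (q * lg)"
    using q_pos lg_pos by (simp add: real_sqrt_divide real_sqrt_mult field_simps)
  have light: "q * real (n * th) \<le> x"
  proof -
    have "real th \<le> sqrt (lg / q)" unfolding th_def using lg_pos q_pos by simp
    then have "q * real n * real th \<le> q * real n * sqrt (lg / q)"
      using q_pos by (intro mult_left_mono) auto
    also have "\<dots> = x" using ratio by (simp add: x_def mult_ac)
    finally show ?thesis by (simp add: mult_ac)
  qed
  have m4: "real m \<le> 4 * x"
  proof -
    have "sqrt (lg / q) < real th + 1" unfolding th_def using lg_pos q_pos by simp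
    then have "real J * sqrt (lg / q) \<le> real J * (real th + 1)" by (intro mult_left_mono) auto
    also have "\<dots> \<le> real n"
    proof -
      have "J * (th + 1) \<le> n" by (simp add: J_def del: mult_Suc_right add_Suc_right)
      then have "real (J * (th + 1)) \<le> real n" by (rule of_nat_mono)
      then show ?thesis by (simp add: distrib_left)
    qed
    finally have "real J * sqrt (lg / q) \<le> real n" .
    then have "real J * sqrt (lg / q) * (sqrt (q * lg)) \<le> real n * sqrt (q * lg)"
      using q_pos lg_pos by (intro mult_right_mono) auto
    moreover have "sqrt (lg / q) * sqrt (q * lg) = lg"
      using q_pos lg_pos by (simp add: real_sqrt_mult[symmetric])
    ultimately have "real J * lg \<le> x" by (simp add: x_def mult.assoc)
    moreover have "real m \<le> 4 * (real J * lg)"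
      using mult_right_mono[OF K, of "real J"] by (simp add: m_def mult_ac)
    ultimately show ?thesis by linarith
  qed
  have harm: "(\<Sum>j<J. 1 / (real j + 1)) \<le> 1 + l"
  proof (cases J)
    case 0
    then show ?thesis using l by simp
  next
    case (Suc j)
    have "Suc j \<le> n" using Suc by (simp add: J_def) (metis div_le_dividend)
    then have "ln (real (Suc j)) \<le> l" unfolding l_def by (subst ln_le_cancel_iff) auto
    with harmonic_le[of j] Suc show ?thesis by simp
  qed
  define z where "z = q * e * (l\<^sup>2 * lg)"
  have l2: "l \<le> 2 * l\<^sup>2" using mult_right_mono[of "1/2" l l] l by (simp add: power2_eq_square)
  have scan: "(\<Sum>i<m. tau i * (2 * e / real n)) \<le> 48 * z"
  proof -
    have "(\<Sum>i<m. tau i * (2 * e / real n)) = (\<Sum>i<K * J. 2 * q * e * (1 / (real (i div K) + 1)))"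
      using n by (intro sum.cong) (auto simp: m_def tau_def)
    also have "\<dots> = real K * (\<Sum>j<J. 2 * q * e * (1 / (real j + 1)))"
      using sum_div_group[OF K_pos, of "\<lambda>j. 2 * q * e * (1 / (real j + 1))" J] by simp
    also have "\<dots> = real K * (2 * q * e * (\<Sum>j<J. 1 / (real j + 1)))"
      by (simp add: sum_distrib_left)
    \<comment> \<open>From l \<ge> 1/2 follow 1 + l \<le> 3 l and l \<le> 2 l^2, so the harmonic sum
      is at most 3 (2 l^2).\<close>
    also have "\<dots> \<le> 4 * lg * (2 * q * e * (3 * (2 * l\<^sup>2)))"
      using K harm l l2 lg q_pos e by (intro mult_mono) (auto intro!: mult_nonneg_nonneg sum_nonneg)
    also have "\<dots> = 48 * z" by (simp add: z_def)
    finally show ?thesis .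
  qed
  have qe: "q * e \<le> 8 * z"
  proof -
    have "1 / 2 * (1 / 2) \<le> l * l" using l by (intro mult_mono) auto
    then have "1 / 4 * (1 / 2) \<le> l\<^sup>2 * lg" using lg by (intro mult_mono) (auto simp: power2_eq_square)
    then have "q * e * (1 / 8) \<le> q * e * (l\<^sup>2 * lg)" using q_pos e by (intro mult_left_mono) auto
    then show ?thesis by (simp add: z_def)
  qed
  have z0: "0 \<le> z" using q_pos e lg by (simp add: z_def)
  \<comment> \<open>The coefficients add up to 23 for \<open>t\<close>, to 160 + 40 = 200 for
    \<open>y\<close> and to 1440 + 320 = 1760 for \<open>z\<close>; 2000 exceeds all of
    them.\<close>
  have "real (3 * t + 20 + 20 * m) + 30 * (\<Sum>i<m. tau i * (2 * e / real n)) +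
      20 * (q * real (n * th) + q * (2 * e)) \<le> 2000 * (y + (real t + z))"
    using m4 xy scan qe light y0 z0 t by (simp add: algebra_simps)
  also have "y + (real t + z) = sqrt (real t * p) * real n * sqrt (l * lg) + real t * (1 + p * e * l\<^sup>2 * lg)"
    by (simp add: y_def z_def q_def algebra_simps)
  finally show ?thesis unfolding e_def l_def lg_def .
qed

end

section \<open>Conditioning on the good event, degenerate inputs and the conclusion\<close>

lemma uniform_indep_events:
  assumes M: "prob_space M" and S: "S \<in> sets M" "0 < measure M S"
    and A: "\<And>x. x \<in> I \<Longrightarrow> A x \<in> sets M"
    and main: "\<And>X. X \<subseteq> I \<Longrightarrow> finite X \<Longrightarrow>
      measure M (S \<inter> {\<omega> \<in> space M. \<forall>x\<in>X. \<omega> \<in> A x}) = p ^ card X * measure M S"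
  shows "\<forall>x\<in>I. measure (uniform_measure M S) (A x) = p"
    "prob_space.indep_events (uniform_measure M S) A I"
proof -
  interpret M: prob_space M by fact
  have e: "emeasure M S \<noteq> 0" "emeasure M S \<noteq> \<infinity>" using S(2) by (auto simp: M.emeasure_eq_measure)
  interpret N: prob_space "uniform_measure M S" by (rule prob_space_uniform_measure[OF e])
  \<comment> \<open>Singletons give the individual probabilities, larger sets the product rule. The
    empty set is excluded because its intersection is the whole type.\<close>
  have pr: "measure (uniform_measure M S) (\<Inter>x\<in>X. A x) = p ^ card X"
    if X: "X \<subseteq> I" "finite X" "X \<noteq> {}" for X
  proof -
    have sets: "(\<Inter>x\<in>X. A x) \<in> sets M" using X A by (intro sets.finite_INT) auto
    have "(\<Inter>x\<in>X. A x) = {\<omega> \<in> space M. \<forall>x\<in>X. \<omega> \<in> A x}"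
      using sets.sets_into_space[OF sets] by auto
    then have "measure M (S \<inter> (\<Inter>x\<in>X. A x)) = p ^ card X * measure M S" using main[OF X(1,2)] by simp
    then show ?thesis using measure_uniform_measure[OF e sets] S(2) by simp
  qed
  have single: "measure (uniform_measure M S) (A x) = p" if "x \<in> I" for x
    using pr[of "{x}"] that by simp
  then show "\<forall>x\<in>I. measure (uniform_measure M S) (A x) = p" by simp
  show "N.indep_events A I"
    unfolding N.indep_events_def
  proof (intro conjI allI impI)
    show "A ` I \<subseteq> N.events" using A by auto
    fix X assume X: "X \<subseteq> I" "X \<noteq> {}" "finite X"
    have "(\<Prod>x\<in>X. N.prob (A x)) = (\<Prod>x\<in>X. p)" using single X by (intro prod.cong) auto
    then show "N.prob (\<Inter>x\<in>X. A x) = (\<Prod>x\<in>X. N.prob (A x))" using pr[OF X(1,3,2)] by simp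
  qed
qed

lemma oriented_empty:
  assumes "wf_hgraph G" "\<not> 1 < real (nverts G)"
  shows "oriented G = {}"
proof (rule ccontr)
  assume "oriented G \<noteq> {}"
  then obtain u v where e: "{u, v} \<in> edges G" by (auto simp: oriented_def)
  with assms(1) obtain a b where ab: "a \<in> set (vlist G)" "b \<in> set (vlist G)" "a \<noteq> b"
    by (fastforce simp: wf_hgraph_def)
  then have "card {a, b} \<le> card (set (vlist G))" by (intro card_mono) auto
  with ab assms(2) show False by (simp add: nverts_def)
qed

lemma sampler_program_correct:
  fixes G :: "'v hgraph"
  assumes wf: "wf_hgraph G" and p: "0 \<le> p" "p \<le> 1" and t: "1 \<le> t" and \<delta>: "0 < \<delta>" "\<delta> < 1"
  obtains S where "S \<in> sets (rspace G)" "1 - \<delta> \<le> measure (rspace G) S"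
    "\<And>\<omega>. \<omega> \<in> S \<Longrightarrow> \<exists>Ts. returned sampler_program G p t \<delta> \<omega> = Some Ts \<and> length Ts = t \<and>
       (\<forall>T \<in> set Ts. T \<subseteq> oriented G)"
    "\<And>X. X \<subseteq> oriented G \<times> {..<t} \<Longrightarrow> finite X \<Longrightarrow> measure (rspace G) (S \<inter> {\<omega> \<in> space (rspace G).
       \<forall>x\<in>X. \<omega> \<in> (case x of (e, i) \<Rightarrow> included sampler_program G p t \<delta> e i)}) = p ^ card X * measure (rspace G) S"
    "(\<integral>\<^sup>+ \<omega>. runtime sampler_program G p t \<delta> \<omega> \<partial>rspace G) \<le>
      ennreal (2000 * (sqrt (real t * p) * real (nverts G)
                      * sqrt (ln (real (nverts G)) * ln (real (nverts G) / \<delta>))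
                    + real t * (1 + p * real (nedges G) * (ln (real (nverts G)))\<^sup>2
                                      * ln (real (nverts G) / \<delta>))))"
proof (cases "1 < real (nverts G) \<and> 0 < p")
  case True
  then interpret sampler G p t \<delta> by unfold_locales (use assms in auto)
  let ?M = "rspace G" and ?S = "stream_space unif"
  interpret R: prob_space ?M by (rule prob_space_rspace)
  define T where "T = {\<omega> \<in> space ?M. snd \<omega> \<in> good}"
  have inc: "measure ?M (T \<inter> {\<omega> \<in> space ?M. \<forall>x\<in>X. \<omega> \<in> (case x of (e, i) \<Rightarrow>
      included sampler_program G p t \<delta> e i)}) = p ^ card X * measure ?S good"
    if X: "X \<subseteq> oriented G \<times> {..<t}" for X
  proof -
    have "T \<inter> {\<omega> \<in> space ?M. \<forall>x\<in>X. \<omega> \<in> (case x of (e, i) \<Rightarrow> included sampler_program G p t \<delta> e i)} =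
      {\<omega> \<in> space ?M. snd \<omega> \<in> good \<and> (\<forall>x\<in>X. \<omega> \<in> included sampler_program G p t \<delta> (fst x) (snd x))}"
      by (auto simp: T_def case_prod_unfold)
    then show ?thesis
      using emeasure_included[OF X] p(1) by (simp add: measure_def enn2real_mult)
  qed
  have mT: "measure ?M T = measure ?S good"
    using inc[of "{}"] by (simp add: T_def Int_def conj_commute)
  show ?thesis
  proof (rule that[of T])
    have [measurable]: "snd \<in> measurable ?M ?S" unfolding rspace_def by measurable
    note [measurable] = sets_good
    show "T \<in> sets ?M" unfolding T_def by measurable
    show "1 - \<delta> \<le> measure ?M T" using measure_good mT by simp
    show "\<exists>Ts. returned sampler_program G p t \<delta> \<omega> = Some Ts \<and> length Ts = t \<and> (\<forall>T \<in> set Ts. T \<subseteq> oriented G)"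
      if "\<omega> \<in> T" for \<omega>
      using that returned_run[of "snd \<omega>" "fst \<omega>"] by (simp add: T_def good_def)
    show "measure ?M (T \<inter> {\<omega> \<in> space ?M. \<forall>x\<in>X. \<omega> \<in> (case x of (e, i) \<Rightarrow>
        included sampler_program G p t \<delta> e i)}) = p ^ card X * measure ?M T"
      if "X \<subseteq> oriented G \<times> {..<t}" for X
      using inc[OF that] mT by simp
    show "(\<integral>\<^sup>+ \<omega>. runtime sampler_program G p t \<delta> \<omega> \<partial>?M) \<le>
      ennreal (2000 * (sqrt (real t * p) * real n * sqrt (ln (real n) * ln (real n / \<delta>))
        + real t * (1 + p * real (nedges G) * (ln (real n))\<^sup>2 * ln (real n / \<delta>))))"
      by (rule order_trans[OF nn_integral_runtime ennreal_leI[OF time_bound]])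
  qed
next
  case False
  let ?M = "rspace G"
  interpret R: prob_space ?M by (rule prob_space_rspace)
  have run: "\<exists>k s. halts sampler_program G p t \<delta> \<omega> k s \<and> k \<le> 3 * t + 3 \<and> out s = replicate t []" for \<omega>
    using trivial_program_spec[OF False, of G "fst \<omega>" t \<delta> "snd \<omega>"] unfolding wpt_def halts_def .
  have ret: "returned sampler_program G p t \<delta> \<omega> = Some (replicate t {})" for \<omega>
    using run[of \<omega>] by (auto dest!: returned_eq)
  have inc: "included sampler_program G p t \<delta> e i = {}" for e i
    by (auto simp: included_def ret)
  have zero: "n < 2 \<Longrightarrow> ln (real n) = 0" for n :: nat
    by (cases "n = 0") (auto simp: less_2_cases_iff)
  show ?thesis
  proof (rule that[of "space ?M"])
    show "1 - \<delta> \<le> measure ?M (space ?M)" using \<delta> by (simp add: R.prob_space)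
    show "\<exists>Ts. returned sampler_program G p t \<delta> \<omega> = Some Ts \<and> length Ts = t \<and> (\<forall>T \<in> set Ts. T \<subseteq> oriented G)" for \<omega>
      by (simp add: ret)
    show "measure ?M (space ?M \<inter> {\<omega> \<in> space ?M. \<forall>x\<in>X. \<omega> \<in> (case x of (e, i) \<Rightarrow>
        included sampler_program G p t \<delta> e i)}) = p ^ card X * measure ?M (space ?M)"
      if X: "X \<subseteq> oriented G \<times> {..<t}" "finite X" for X
    proof (cases "X = {}")
      case True
      then show ?thesis by simp
    next
      case nonempty: False
      \<comment> \<open>A nonempty \<open>X\<close> needs an oriented edge, hence two vertices, so
        this branch is taken because p = 0; both sides of the product formula then vanish.\<close>
      then have "p = 0" using X(1) False oriented_empty[OF wf] p(1) by auto
      then have "p ^ card X = 0" using nonempty X(2) by (simp add: card_gt_0_iff)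
      moreover have "{\<omega> \<in> space ?M. \<forall>x\<in>X. \<omega> \<in> (case x of (e, i) \<Rightarrow>
          included sampler_program G p t \<delta> e i)} = {}"
        using nonempty by (auto simp: inc)
      ultimately show ?thesis by (simp only: Int_empty_right measure_empty mult_zero_left)
    qed
    have "runtime sampler_program G p t \<delta> \<omega> \<le> ennreal (2000 * real t)" for \<omega>
    proof -
      obtain k s where k: "halts sampler_program G p t \<delta> \<omega> k s" "k \<le> 3 * t + 3" using run by blast
      have "real k \<le> 2000 * real t" using k(2) t by linarith
      then show ?thesis
        unfolding runtime_eq[OF k(1)] ennreal_of_nat_eq_real_of_nat by (rule ennreal_leI)
    qed
    then have "(\<integral>\<^sup>+ \<omega>. runtime sampler_program G p t \<delta> \<omega> \<partial>?M) \<le> (\<integral>\<^sup>+ \<omega>. ennreal (2000 * real t) \<partial>?M)"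
      by (intro nn_integral_mono)
    also have "\<dots> = ennreal (2000 * real t)" by (simp add: R.emeasure_space_1)
    \<comment> \<open>Either p = 0 or ln n = 0, the latter including n = 0 by ln 0 = 0, so all terms
      of the bound except \<open>t\<close> vanish.\<close>
    also have "2000 * real t = 2000 * (sqrt (real t * p) * real (nverts G)
                      * sqrt (ln (real (nverts G)) * ln (real (nverts G) / \<delta>))
                    + real t * (1 + p * real (nedges G) * (ln (real (nverts G)))\<^sup>2
                                      * ln (real (nverts G) / \<delta>)))"
      using False p(1) zero[of "nverts G"] by (cases "p = 0") auto
    finally show "(\<integral>\<^sup>+ \<omega>. runtime sampler_program G p t \<delta> \<omega> \<partial>?M) \<le>
      ennreal (2000 * (sqrt (real t * p) * real (nverts G)
                      * sqrt (ln (real (nverts G)) * ln (real (nverts G) / \<delta>))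
                    + real t * (1 + p * real (nedges G) * (ln (real (nverts G)))\<^sup>2
                                      * ln (real (nverts G) / \<delta>))))" .
  qed simp_all
qed

theorem mainTheorem2:
  shows "\<exists>(A :: com) (C :: real). \<forall>(G :: 'v hgraph) (p :: real) (t :: nat) (\<delta> :: real).
    wf_hgraph G \<longrightarrow> 0 \<le> p \<longrightarrow> p \<le> 1 \<longrightarrow> 1 \<le> t \<longrightarrow> 0 < \<delta> \<longrightarrow> \<delta> < 1 \<longrightarrow>
    (\<exists>S \<in> sets (rspace G).
       measure (rspace G) S \<ge> 1 - \<delta> \<and>
       (\<forall>\<omega> \<in> S. \<exists>Ts. returned A G p t \<delta> \<omega> = Some Ts \<and> length Ts = t \<and>
          (\<forall>T \<in> set Ts. T \<subseteq> oriented G)) \<and>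
       (\<forall>e \<in> oriented G. \<forall>i < t.
          measure (uniform_measure (rspace G) S) (included A G p t \<delta> e i) = p) \<and>
       prob_space.indep_events (uniform_measure (rspace G) S)
         (\<lambda>(e, i). included A G p t \<delta> e i) (oriented G \<times> {..<t})) \<and>
    runtime A G p t \<delta> \<in> borel_measurable (rspace G) \<and>
    (\<integral>\<^sup>+ \<omega>. runtime A G p t \<delta> \<omega> \<partial>rspace G) \<le>
      ennreal (C * (sqrt (real t * p) * real (nverts G)
                      * sqrt (ln (real (nverts G)) * ln (real (nverts G) / \<delta>))
                    + real t * (1 + p * real (nedges G) * (ln (real (nverts G)))\<^sup>2
                                      * ln (real (nverts G) / \<delta>))))"
proof (intro exI[of _ sampler_program] exI[of _ 2000] allI impI)
  fix G :: "'v hgraph" and p :: real and t :: nat and \<delta> :: real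
  assume G: "wf_hgraph G" and p: "0 \<le> p" "p \<le> 1" and t: "1 \<le> t" and \<delta>: "0 < \<delta>" "\<delta> < 1"
  have dist: "distinct (vlist G)" using G by (simp add: wf_hgraph_def)
  let ?A = "\<lambda>(e, i). included sampler_program G p t \<delta> e i"
  obtain S where S: "S \<in> sets (rspace G)" "1 - \<delta> \<le> measure (rspace G) S"
    "\<And>\<omega>. \<omega> \<in> S \<Longrightarrow> \<exists>Ts. returned sampler_program G p t \<delta> \<omega> = Some Ts \<and> length Ts = t \<and>
       (\<forall>T \<in> set Ts. T \<subseteq> oriented G)"
    and main: "\<And>X. X \<subseteq> oriented G \<times> {..<t} \<Longrightarrow> finite X \<Longrightarrow>
       measure (rspace G) (S \<inter> {\<omega> \<in> space (rspace G). \<forall>x\<in>X. \<omega> \<in> ?A x}) = p ^ card X * measure (rspace G) S"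
    and time: "(\<integral>\<^sup>+ \<omega>. runtime sampler_program G p t \<delta> \<omega> \<partial>rspace G) \<le>
      ennreal (2000 * (sqrt (real t * p) * real (nverts G)
                      * sqrt (ln (real (nverts G)) * ln (real (nverts G) / \<delta>))
                    + real t * (1 + p * real (nedges G) * (ln (real (nverts G)))\<^sup>2
                                      * ln (real (nverts G) / \<delta>))))"
    by (rule sampler_program_correct[OF G p t \<delta>], rule that; (assumption | blast))
  have A: "?A x \<in> sets (rspace G)" for x
    using included_measurable[OF dist] by (simp add: case_prod_unfold)
  \<comment> \<open>Conditioning on \<open>S\<close> is legitimate because 1 - \<delta> is
    positive.\<close>
  have "0 < measure (rspace G) S" using S(2) \<delta>(2) by simp
  note indep = uniform_indep_events[where A = ?A and I = "oriented G \<times> {..<t}", OF prob_space_rspace S(1) this A main]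
  have "measure (uniform_measure (rspace G) S) (included sampler_program G p t \<delta> e i) = p"
    if "e \<in> oriented G" "i < t" for e i
    using bspec[OF indep(1), where x = "(e, i)"] that by simp
  with S indep(2) runtime_measurable[OF dist] time
  show "(\<exists>S \<in> sets (rspace G).
       measure (rspace G) S \<ge> 1 - \<delta> \<and>
       (\<forall>\<omega> \<in> S. \<exists>Ts. returned sampler_program G p t \<delta> \<omega> = Some Ts \<and> length Ts = t \<and>
          (\<forall>T \<in> set Ts. T \<subseteq> oriented G)) \<and>
       (\<forall>e \<in> oriented G. \<forall>i < t.
          measure (uniform_measure (rspace G) S) (included sampler_program G p t \<delta> e i) = p) \<and>
       prob_space.indep_events (uniform_measure (rspace G) S) ?A (oriented G \<times> {..<t})) \<and>
    runtime sampler_program G p t \<delta> \<in> borel_measurable (rspace G) \<and>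
    (\<integral>\<^sup>+ \<omega>. runtime sampler_program G p t \<delta> \<omega> \<partial>rspace G) \<le>
      ennreal (2000 * (sqrt (real t * p) * real (nverts G)
                      * sqrt (ln (real (nverts G)) * ln (real (nverts G) / \<delta>))
                    + real t * (1 + p * real (nedges G) * (ln (real (nverts G)))\<^sup>2
                                      * ln (real (nverts G) / \<delta>))))"
    by (intro conjI bexI[of _ S]) auto
qed

end
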